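(* Let $\varepsilon'_0$ and $\varepsilon_i$, $i\in\mathbb{Z}$, be independent and identically distributed real random variables, and let $X_k=g(\dots,\varepsilon_{k-1},\varepsilon_k)$, $k\in\mathbb{Z}$, where $g$ is measurable and each $X_k$ is a well-defined random variable. Assume the distribution function $F$ of $X_k$ has a square integrable density $f$ with square integrable derivative $f'$, and that for every $k\ge1$ the conditional distribution function $F_k(x\mid\xi_0)=\mathbb{P}(X_k\le x\mid \xi_0)$ has a derivative $f_k(x\mid\xi_0)$ in $x$ (almost surely). Let $(b_n)$ be positive numbers with $b_n\to0$ and $\log n=O(nb_n)$. Assume there is a constant $c_0>0$ such that $\sup_{x\in\mathbb{R}} f_1(x\mid\xi_0)\le c_0$ almost surely, and that $$\sum_{k=1}^{\infty}\Big[\int_{\mathbb{R}}(1+\theta^2)\,\big\|\varphi_k(\theta\mid\xi_0)-\varphi_k(\theta\mid\xi_0^* )\big\|^2\,d\theta\Big]^{1/2}<\infty.$$ Let $\iota(n)=(\log n)^{1/2}\log\log n$. Then $$\Delta_n(b_n)=O_{\mathrm{a.s.}}\big(\sqrt{b_n\log n}\big)+o_{\mathrm{a.s.}}\big(b_n\,\iota(n)\big),$$ i.e. $\Delta_n(b_n)\le A_n+B_n$ where $\limsup_n A_n/\sqrt{b_n\log n}<\infty$ almost surely and $B_n/(b_n\iota(n))\to0$ almost surely.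
   Context: Notation: $\xi_k=(\dots,\varepsilon_{k-1},\varepsilon_k)$ for $k\in\mathbb{Z}$; for $k\ge0$, $\xi_k^*=(\xi_{-1},\varepsilon'_0,\varepsilon_1,\dots,\varepsilon_k)$ (i.e. $\xi_k$ with $\varepsilon_0$ replaced by $\varepsilon'_0$). $f_1(x\mid\xi_0)$ is the conditional density of $X_1$ given $\xi_0$. The conditional characteristic function is $\varphi_k(\theta\mid\xi_0)=\mathbb{E}(e^{\sqrt{-1}\theta X_k}\mid\xi_0)$, and $\varphi_k(\theta\mid\xi_0^* )$ denotes the same function of the history evaluated at $\xi_0^*$ (equivalently the conditional characteristic function of $X_k^*=g(\xi_k^* )$ given $\xi_0^*$). $\|Z\|=(\mathbb{E}|Z|^2)^{1/2}$. Empirical distribution function $F_n(x)=n^{-1}\sum_{i=1}^n\mathbf{1}_{X_i\le x}$, $G_n(x)=\sqrt n[F_n(x)-F(x)]$, and modulus of continuity $\Delta_n(b)=\sup_{x,y\in\mathbb{R},\,|x-y|\le b}|G_n(x)-G_n(y)|$. *)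

theory Defs
  imports "HOL-Probability.Probability" "HOL-Library.Landau_Symbols"
begin

text \<open>Histories are encoded as functions nat => real, position j holding the
innovation with time index k - j (so xi_k = (..., eps_{k-1}, eps_k)).\<close>

definition hist :: "(int \<Rightarrow> 'a \<Rightarrow> real) \<Rightarrow> int \<Rightarrow> 'a \<Rightarrow> nat \<Rightarrow> real" where
  "hist eps k \<omega> = (\<lambda>j. eps (k - int j) \<omega>)"

definition hist0_star :: "(int \<Rightarrow> 'a \<Rightarrow> real) \<Rightarrow> ('a \<Rightarrow> real) \<Rightarrow> 'a \<Rightarrow> nat \<Rightarrow> real" where
  "hist0_star eps eps0' \<omega> = (\<lambda>j. if j = 0 then eps0' \<omega> else eps (- int j) \<omega>)"

text \<open>Extend a history h (of time 0) by future innovations e 0 = eps_1, e 1 = eps_2, ...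
up to time k.\<close>
definition extend_hist :: "nat \<Rightarrow> (nat \<Rightarrow> real) \<Rightarrow> (nat \<Rightarrow> real) \<Rightarrow> nat \<Rightarrow> real" where
  "extend_hist k h e = (\<lambda>j. if j < k then e (k - 1 - j) else h (j - k))"

text \<open>Regular version of the conditional distribution function
F_k(x | xi_0 = h) = P(X_k <= x | xi_0 = h), where mu is the law of the innovations.\<close>
definition cond_cdf :: "real measure \<Rightarrow> ((nat \<Rightarrow> real) \<Rightarrow> real) \<Rightarrow> nat \<Rightarrow> real \<Rightarrow> (nat \<Rightarrow> real) \<Rightarrow> real" where
  "cond_cdf \<mu> g k x h = measure (PiM UNIV (\<lambda>_::nat. \<mu>)) {e \<in> space (PiM UNIV (\<lambda>_::nat. \<mu>)). g (extend_hist k h e) \<le> x}"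

definition cond_cf :: "real measure \<Rightarrow> ((nat \<Rightarrow> real) \<Rightarrow> real) \<Rightarrow> nat \<Rightarrow> real \<Rightarrow> (nat \<Rightarrow> real) \<Rightarrow> complex" where
  "cond_cf \<mu> g k \<theta> h = integral\<^sup>L (PiM UNIV (\<lambda>_::nat. \<mu>)) (\<lambda>e. cis (\<theta> * g (extend_hist k h e)))"

definition emp_cdf :: "(int \<Rightarrow> 'a \<Rightarrow> real) \<Rightarrow> nat \<Rightarrow> real \<Rightarrow> 'a \<Rightarrow> real" where
  "emp_cdf X n x \<omega> = (\<Sum>i\<in>{1..n}. (if X (int i) \<omega> \<le> x then 1 else 0)) / real n"

definition emp_proc :: "(int \<Rightarrow> 'a \<Rightarrow> real) \<Rightarrow> (real \<Rightarrow> real) \<Rightarrow> nat \<Rightarrow> real \<Rightarrow> 'a \<Rightarrow> real" where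
  "emp_proc X F n x \<omega> = sqrt (real n) * (emp_cdf X n x \<omega> - F x)"

definition modulus :: "(int \<Rightarrow> 'a \<Rightarrow> real) \<Rightarrow> (real \<Rightarrow> real) \<Rightarrow> nat \<Rightarrow> real \<Rightarrow> 'a \<Rightarrow> real" where
  "modulus X F n b \<omega> =
     (SUP p \<in> {(x, y). \<bar>x - y\<bar> \<le> b}. \<bar>emp_proc X F n (fst p) \<omega> - emp_proc X F n (snd p) \<omega>\<bar>)"

definition iota :: "nat \<Rightarrow> real" where
  "iota n = sqrt (ln (real n)) * ln (ln (real n))"

end

theory Submission
  imports Defs
begin

text \<open>
  Write $\xi_k$ for the history up to time $k$. The increment of the empirical process splits into
  the martingale $\sum_i (1_{x < X_i \le y} - P(x < X_i \le y \mid \xi_{i-1}))$ and the smooth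
  remainder $\sum_i (P(x < X_i \le y \mid \xi_{i-1}) - P(x < X_i \le y))$, both divided by
  $\sqrt n$.

  For the martingale, conditional probabilities of an interval $I$ are at most $c_0 |I|$, and a
  $\cosh$ version of Freedman's inequality bounds the tail over $I$ by an exponentially small factor
  times $P(X_0 \in I)$. This last factor makes the union bound over a grid of mesh $1/n$ on the whole
  line finite, without any tail assumption, and Borel-Cantelli gives the rate $\sqrt{b_n \log n}$.

  For the remainder, Levy's inversion formula and Cauchy-Schwarz with weight $1 + \theta^2$ give
  $b_n$ times the square root of
  $W_n = \int (1 + \theta^2) |\sum_i (\varphi_1(\theta \mid \xi_{i-1}) - \varphi(\theta))|^2 d\theta$.
  Telescoping over the lag of the conditioning writes the inner sum as a series of martingales whose
  increments are dominated by the coupling distances of the hypothesis; Doob's inequality then gives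
  $E \max_{k \le n} W_k = O(n)$. As $\sum_j 1 / (j (\log j)^2) < \infty$, the maxima along
  $n = 2^j$ are $o(n \iota(n)^2)$ almost surely.
\<close>

section \<open>Bounded functionals of an innovation sequence\<close>

text \<open>Conditioning is done without sigma-algebras. On the product space of histories,
  conditioning on the past means integrating out entry 0, and stationarity means that dropping entry
  0 preserves the law. For bounded functions these integrals exist at every history, so the
  martingale identities carry no exceptional sets. The function cosh - 1 is used instead of an
  exponential because it vanishes at 0: the constant 1 of an exponential moment would be paid once
  per cell, and there are infinitely many cells. Telescoping over L lags leaves a remainder for
  which no rate is known. With n and \<theta> fixed, L tends to infinity, so it suffices that
  predictions from the remote past converge in L^1 to the mean. The maximum over k <= n is taken for
  each \<theta> inside the integral; the result is monotone in n, which carries the dyadic estimate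
  to every n. The characteristic functions need not be integrable one by one, so Levy inversion is
  applied to a signed combination of laws at once.\<close>

definition htail :: "(nat \<Rightarrow> real) \<Rightarrow> nat \<Rightarrow> real" where
  "htail h = (\<lambda>j. h (Suc j))"

lemma htail_case_nat [simp]: "htail (case_nat x h) = h"
  by (simp add: htail_def)

text \<open>Index 0 of a history is its newest entry, so \<open>psum u n h\<close> adds \<open>u\<close> over \<open>h\<close> and its
  \<open>n - 1\<close> predecessors.\<close>

primrec psum :: "((nat \<Rightarrow> real) \<Rightarrow> 'b::real_normed_vector) \<Rightarrow> nat \<Rightarrow> (nat \<Rightarrow> real) \<Rightarrow> 'b" where
  "psum u 0 h = 0"
| "psum u (Suc n) h = psum u n (htail h) + u h"

text \<open>Each partial sum is read at its own tail of \<open>h\<close>: this is the running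
  maximum, started from 0, of the partial sums along a single path.\<close>

primrec pmax :: "((nat \<Rightarrow> real) \<Rightarrow> real) \<Rightarrow> nat \<Rightarrow> (nat \<Rightarrow> real) \<Rightarrow> real" where
  "pmax u 0 h = 0"
| "pmax u (Suc n) h = max (pmax u n (htail h)) (psum u (Suc n) h)"

text \<open>For z = -w < 0 the quadratic Taylor polynomial bounds exp w from below, and its product
  with 1 - w + w^2 is 1 + w^2/2 + w^3/2 + w^4/2 >= 1.\<close>

lemma exp_le_one_plus_sq:
  fixes z :: real assumes "\<bar>z\<bar> \<le> 1" shows "exp z \<le> 1 + z + z\<^sup>2"
proof (cases "z \<ge> 0")
  case True then show ?thesis using exp_bound[of z] assms by simp
next
  case False
  define w where "w = -z"
  have w: "0 < w" using False by (simp add: w_def)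
  have l: "1 + w + w\<^sup>2 / 2 \<le> exp w" using w by (intro exp_lower_Taylor_quadratic) auto
  have "1 \<le> 1 + w\<^sup>2 / 2 + w ^ 3 / 2 + w ^ 4 / 2" using w by simp
  also have "\<dots> = (1 - w + w\<^sup>2) * (1 + w + w\<^sup>2 / 2)"
    by (simp add: field_simps power2_eq_square power3_eq_cube power4_eq_xxxx)
  also have "\<dots> \<le> (1 - w + w\<^sup>2) * exp w"
  proof (rule mult_left_mono[OF l])
    have "0 \<le> (1 - w)\<^sup>2 + w" using w by simp
    then show "0 \<le> 1 - w + w\<^sup>2" by (simp add: power2_eq_square algebra_simps)
  qed
  finally have "exp (-w) \<le> 1 - w + w\<^sup>2" by (simp add: exp_minus field_simps)
  then show ?thesis by (simp add: w_def)
qed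

section \<open>Conditional expectation and martingale bounds on the space of histories\<close>

locale innovations = prob_space \<mu> for \<mu> :: "real measure" +
  assumes sets_mu [simp, measurable_cong]: "sets \<mu> = sets borel"
begin

sublocale seq: sequence_space \<mu>
  by unfold_locales

abbreviation S :: "(nat \<Rightarrow> real) measure" where "S \<equiv> PiM UNIV (\<lambda>_::nat. \<mu>)"

lemma space_mu [simp]: "space \<mu> = UNIV"
  using sets_eq_imp_space_eq[OF sets_mu] by simp

lemma prob_UNIV: "prob UNIV = 1"
  using prob_space by simp

lemma space_S [simp]: "space S = UNIV"
  by (simp add: space_PiM PiE_UNIV_domain)

lemma sets_S: "sets S = sets (PiM UNIV (\<lambda>_::nat. borel))"
  by (rule sets_PiM_cong) auto

lemma htail_measurable [measurable]: "htail \<in> S \<rightarrow>\<^sub>M S"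
  unfolding htail_def by (rule measurable_PiM_single') (auto simp: PiE_UNIV_domain)

lemma case_nat_S [measurable]: "(\<lambda>(x, h). case_nat x h) \<in> \<mu> \<Otimes>\<^sub>M S \<rightarrow>\<^sub>M S"
  unfolding split_beta' by measurable

text \<open>Boundedness is required at every history and not almost everywhere: then every slice in
  the newest entry is integrable, and conditional expectations exist pointwise.\<close>

definition bounded_rv :: "((nat \<Rightarrow> real) \<Rightarrow> 'b::{banach, second_countable_topology}) \<Rightarrow> bool" where
  "bounded_rv f \<longleftrightarrow> f \<in> borel_measurable S \<and> (\<exists>C. \<forall>h. norm (f h) \<le> C)"

lemma bounded_rvI: "f \<in> borel_measurable S \<Longrightarrow> (\<And>h. norm (f h) \<le> C) \<Longrightarrow> bounded_rv f"
  unfolding bounded_rv_def by blast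

lemma bounded_rv_meas: "bounded_rv f \<Longrightarrow> f \<in> borel_measurable S"
  by (simp add: bounded_rv_def)

lemma bounded_rv_integrable: "bounded_rv f \<Longrightarrow> integrable S f"
  unfolding bounded_rv_def by (auto intro: seq.P.integrable_const_bound)

lemma bounded_rv_const [intro, simp]: "bounded_rv (\<lambda>_. c)"
  by (rule bounded_rvI[where C="norm c"]) auto

lemma bounded_rv_add [intro]: assumes "bounded_rv f" "bounded_rv g" shows "bounded_rv (\<lambda>h. f h + g h)"
proof -
  obtain C D where "\<forall>h. norm (f h) \<le> C" "\<forall>h. norm (g h) \<le> D" using assms by (auto simp: bounded_rv_def)
  then have "norm (f h + g h) \<le> C + D" for h by (meson add_mono norm_triangle_le)
  with assms show ?thesis by (intro bounded_rvI[where C="C+D"]) (auto simp: bounded_rv_def)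
qed

lemma bounded_rv_mult [intro]:
  fixes f g :: "_ \<Rightarrow> 'b::{banach, second_countable_topology, real_normed_algebra}"
  assumes "bounded_rv f" "bounded_rv g" shows "bounded_rv (\<lambda>h. f h * g h)"
proof -
  obtain C D where C: "\<forall>h. norm (f h) \<le> C" "\<forall>h. norm (g h) \<le> D" using assms by (auto simp: bounded_rv_def)
  then have "norm (f h * g h) \<le> C * D" for h
    by (meson mult_mono norm_ge_zero norm_mult_ineq order_trans)
  with assms show ?thesis by (intro bounded_rvI[where C="C*D"]) (auto simp: bounded_rv_def)
qed

lemma bounded_rv_cont:
  fixes f :: "_ \<Rightarrow> 'b::euclidean_space"
  assumes "continuous_on UNIV F" "bounded_rv f" shows "bounded_rv (\<lambda>h. F (f h))"
proof -
  obtain C where C: "\<forall>h. norm (f h) \<le> C" using assms by (auto simp: bounded_rv_def)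
  have "compact (F ` cball 0 C)"
    by (intro compact_continuous_image continuous_on_subset[OF assms(1)]) auto
  then obtain D where D: "\<forall>y\<in>F ` cball 0 C. norm y \<le> D" using compact_imp_bounded bounded_iff by blast
  have [measurable]: "F \<in> borel_measurable borel" using assms(1) by (rule borel_measurable_continuous_onI)
  have [measurable]: "f \<in> borel_measurable S" using assms by (simp add: bounded_rv_def)
  show ?thesis using C D by (intro bounded_rvI[where C=D]) auto
qed

lemma bounded_rv_diff [intro]:
  fixes f g :: "_ \<Rightarrow> 'b::euclidean_space"
  assumes "bounded_rv f" "bounded_rv g" shows "bounded_rv (\<lambda>h. f h - g h)"
  using bounded_rv_add[OF assms(1) bounded_rv_cont[of uminus g]] assms by (simp add: continuous_intros)

lemma bounded_rv_htail [intro]: "bounded_rv f \<Longrightarrow> bounded_rv (\<lambda>h. f (htail h))"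
  unfolding bounded_rv_def by auto

lemma bounded_rv_sum [intro]: "(\<And>i. i \<in> I \<Longrightarrow> bounded_rv (f i)) \<Longrightarrow> bounded_rv (\<lambda>h. \<Sum>i\<in>I. f i h)"
  by (induction I rule: infinite_finite_induct) auto

lemma bounded_rv_psum [intro]: "bounded_rv u \<Longrightarrow> bounded_rv (psum u n)"
proof (induction n)
  case 0
  have "psum u 0 = (\<lambda>_. 0)" by (rule ext) simp
  then show ?case by (simp only: bounded_rv_const)
next
  case (Suc n)
  then show ?case using bounded_rv_add[OF bounded_rv_htail[of "psum u n"]] by (auto simp: psum.simps(2)[abs_def])
qed

lemma bounded_rv_max [intro]:
  fixes f g :: "_ \<Rightarrow> real"
  assumes "bounded_rv f" "bounded_rv g" shows "bounded_rv (\<lambda>h. max (f h) (g h))"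
proof -
  obtain C D where C: "\<forall>h. norm (f h) \<le> C" "\<forall>h. norm (g h) \<le> D" using assms by (auto simp: bounded_rv_def)
  then have "norm (max (f h) (g h)) \<le> max C D" for h
    by (smt (verit) real_norm_def)
  with assms show ?thesis by (intro bounded_rvI[where C="max C D"]) (auto simp: bounded_rv_def)
qed

lemma bounded_rv_pmax [intro]: "bounded_rv u \<Longrightarrow> bounded_rv (pmax u n)"
proof (induction n)
  case 0
  have "pmax u 0 = (\<lambda>_. 0)" by (rule ext) simp
  then show ?case by (simp only: bounded_rv_const)
next
  case (Suc n)
  have "bounded_rv (\<lambda>h. max (pmax u n (htail h)) (psum u (Suc n) h))"
    using Suc by (intro bounded_rv_max bounded_rv_htail[of "pmax u n"] bounded_rv_psum) auto
  then show ?case by (simp add: pmax.simps(2)[abs_def])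
qed

text \<open>A version, defined for every \<open>h\<close>, of the conditional expectation of f(xi_1)
  given xi_0 = h.\<close>

definition cond_step :: "((nat \<Rightarrow> real) \<Rightarrow> 'b::{banach, second_countable_topology}) \<Rightarrow> (nat \<Rightarrow> real) \<Rightarrow> 'b" where
  "cond_step f h = (\<integral>x. f (case_nat x h) \<partial>\<mu>)"

lemma bounded_rv_slice:
  assumes "bounded_rv f" shows "integrable \<mu> (\<lambda>x. f (case_nat x h))"
proof -
  have [measurable]: "f \<in> borel_measurable S" using assms by (simp add: bounded_rv_def)
  have [measurable]: "(\<lambda>x. case_nat x h) \<in> \<mu> \<rightarrow>\<^sub>M S"
    using measurable_compose[OF measurable_Pair2'[of h S \<mu>] case_nat_S]  by simp
  obtain C where "\<forall>h. norm (f h) \<le> C" using assms by (auto simp: bounded_rv_def)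
  then show ?thesis by (intro integrable_const_bound[where B=C]) auto
qed

lemma cond_step_meas:
  assumes [measurable]: "f \<in> borel_measurable S" shows "cond_step f \<in> borel_measurable S"
  unfolding cond_step_def by measurable

lemma bounded_rv_cond_step [intro]: assumes "bounded_rv f" shows "bounded_rv (cond_step f)"
proof -
  obtain C where C: "\<forall>h. norm (f h) \<le> C" using assms by (auto simp: bounded_rv_def)
  have "norm (cond_step f h) \<le> C" for h
  proof -
    have "norm (cond_step f h) \<le> (\<integral>x. norm (f (case_nat x h)) \<partial>\<mu>)" unfolding cond_step_def by simp
    also have "\<dots> \<le> (\<integral>x. C \<partial>\<mu>)"
      using C bounded_rv_slice[OF assms, of h] by (intro integral_mono) auto
    finally show ?thesis by (simp add: prob_UNIV)
  qed
  then show ?thesis using cond_step_meas assms by (intro bounded_rvI[where C=C]) (auto simp: bounded_rv_def)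
qed

text \<open>\<open>S\<close> is the image of the product of \<mu> and \<open>S\<close> under
  \<open>case_nat\<close>, so Fubini applies. This is the tower property.\<close>

lemma integral_S: assumes "bounded_rv f" shows "integral\<^sup>L S f = integral\<^sup>L S (cond_step f)"
proof -
  interpret pair_sigma_finite \<mu> S by unfold_locales
  interpret PP: pair_prob_space \<mu> S by unfold_locales
  have [measurable]: "f \<in> borel_measurable S" using assms by (simp add: bounded_rv_def)
  obtain C where C: "\<forall>h. norm (f h) \<le> C" using assms by (auto simp: bounded_rv_def)
  have "integral\<^sup>L S f = integral\<^sup>L (distr (\<mu> \<Otimes>\<^sub>M S) S (\<lambda>(x, h). case_nat x h)) f"
    by (simp add: seq.PiM_iter)
  also have "\<dots> = (\<integral>p. f (case p of (x, h) \<Rightarrow> case_nat x h) \<partial>(\<mu> \<Otimes>\<^sub>M S))"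
    by (subst integral_distr) auto
  also have "\<dots> = (\<integral>p. (case p of (x, h) \<Rightarrow> f (case_nat x h)) \<partial>(\<mu> \<Otimes>\<^sub>M S))"
    by (simp add: split_beta')
  also have "\<dots> = (\<integral>h. \<integral>x. f (case_nat x h) \<partial>\<mu> \<partial>S)"
  proof (subst integral_snd)
    show "integrable (\<mu> \<Otimes>\<^sub>M S) (\<lambda>(x, h). f (case_nat x h))"
      using C by (intro PP.P.integrable_const_bound[where B=C]) (auto simp: split_beta')
  qed auto
  finally show ?thesis by (simp add: cond_step_def[abs_def])
qed

lemma cond_step_htail: "cond_step (\<lambda>h. f (htail h)) = f"
  by (simp add: cond_step_def fun_eq_iff prob_UNIV)

lemma integral_htail: "bounded_rv f \<Longrightarrow> (\<integral>h. f (htail h) \<partial>S) = integral\<^sup>L S f"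
  using integral_S[of "\<lambda>h. f (htail h)"] by (simp add: cond_step_htail bounded_rv_htail)

text \<open>A factor read at \<open>htail h\<close> does not see the newest entry and can be taken
  out of the conditional expectation. For \<open>cond_step u\<close> identically 0 the integral
  vanishes, which makes increments orthogonal to the past.\<close>

lemma integral_htail_mult:
  fixes f u :: "_ \<Rightarrow> 'b::{banach, second_countable_topology, real_normed_algebra}"
  assumes "bounded_rv f" "bounded_rv u"
  shows "(\<integral>h. f (htail h) * u h \<partial>S) = (\<integral>h. f h * cond_step u h \<partial>S)"
proof -
  have "(\<integral>h. f (htail h) * u h \<partial>S) = integral\<^sup>L S (cond_step (\<lambda>h. f (htail h) * u h))"
    using assms by (intro integral_S) auto
  also have "cond_step (\<lambda>h. f (htail h) * u h) = (\<lambda>h. f h * cond_step u h)"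
    using bounded_rv_slice[OF assms(2)] by (simp add: cond_step_def fun_eq_iff)
  finally show ?thesis .
qed

text \<open>Orthogonality of martingale increments: the cross term vanishes, and shift invariance
  returns the tail sum to the induction hypothesis.\<close>

lemma psum_sq_integral:
  fixes u :: "_ \<Rightarrow> real"
  assumes u: "bounded_rv u" "\<And>h. cond_step u h = 0"
  shows "(\<integral>h. (psum u n h)\<^sup>2 \<partial>S) = n * (\<integral>h. (u h)\<^sup>2 \<partial>S)"
proof (induction n)
  case (Suc n)
  have [intro]: "bounded_rv (\<lambda>h. psum u n h)" using bounded_rv_psum[OF u(1)] .
  note bounded_rv_integrable[intro] bounded_rv_htail[of "psum u n", intro] bounded_rv_htail[of "\<lambda>h. (psum u n h)\<^sup>2", intro]
  have sq [intro]: "bounded_rv f \<Longrightarrow> bounded_rv (\<lambda>h. (f h :: real)\<^sup>2)" for f by (auto simp: power2_eq_square)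
  have "(\<integral>h. (psum u (Suc n) h)\<^sup>2 \<partial>S) =
    (\<integral>h. ((psum u n (htail h))\<^sup>2 + 2 * (psum u n (htail h) * u h)) + (u h)\<^sup>2 \<partial>S)"
    by (simp add: power2_sum algebra_simps)
  also have "\<dots> = (\<integral>h. (psum u n (htail h))\<^sup>2 \<partial>S) + 2 * (\<integral>h. psum u n (htail h) * u h \<partial>S)
     + (\<integral>h. (u h)\<^sup>2 \<partial>S)"
    by (subst Bochner_Integration.integral_add, force intro: u, force intro: u,
        subst Bochner_Integration.integral_add, force intro: u, force intro: u) simp
  also have "(\<integral>h. (psum u n (htail h))\<^sup>2 \<partial>S) = (\<integral>h. (psum u n h)\<^sup>2 \<partial>S)"
    using integral_htail[of "\<lambda>h. (psum u n h)\<^sup>2"] by auto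
  also have "(\<integral>h. psum u n (htail h) * u h \<partial>S) = 0"
    using integral_htail_mult[OF bounded_rv_psum[OF u(1)] u(1)] u(2) by simp
  finally show ?case using Suc by (simp add: algebra_simps)
qed simp

text \<open>Doob's $L^2$ inequality, from the pathwise estimate
  $m'^2 - 2 m' s' \le m^2 - 2 m s - 2 m u$ for $s' = s + u$, $m' = \max(m, s')$.\<close>

lemma doob_L2:
  assumes u: "bounded_rv u" "\<And>h. cond_step u h = 0"
  shows "(\<integral>h. (pmax u n h)\<^sup>2 \<partial>S) \<le> 4 * n * (\<integral>h. (u h)\<^sup>2 \<partial>S)"
proof -
  note bounded_rv_integrable[intro]
  have sq [intro]: "bounded_rv f \<Longrightarrow> bounded_rv (\<lambda>h. (f h :: real)\<^sup>2)" for f by (auto simp: power2_eq_square)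
  have [intro]: "bounded_rv (\<lambda>h. psum u n h)" "bounded_rv (\<lambda>h. pmax u n h)" for n
    using bounded_rv_psum[OF u(1)] bounded_rv_pmax[OF u(1)] .
  have b: "bounded_rv (\<lambda>h. (pmax u n h)\<^sup>2 - 2 * (pmax u n h * psum u n h))" for n
    by (intro bounded_rv_diff bounded_rv_mult) auto
  have "(\<integral>h. (pmax u n h)\<^sup>2 - 2 * (pmax u n h * psum u n h) \<partial>S) \<le> 0"
  proof (induction n)
    case (Suc n)
    let ?m = "\<lambda>h. pmax u n (htail h)" and ?s = "\<lambda>h. psum u n (htail h)"
    have b': "bounded_rv (\<lambda>h. (?m h)\<^sup>2 - 2 * (?m h * ?s h))" using bounded_rv_htail[OF b] .
    have b'': "bounded_rv (\<lambda>h. ?m h * u h)" using bounded_rv_htail[of "pmax u n"] u by (intro bounded_rv_mult) auto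
    have "(\<integral>h. (pmax u (Suc n) h)\<^sup>2 - 2 * (pmax u (Suc n) h * psum u (Suc n) h) \<partial>S)
       \<le> (\<integral>h. ((?m h)\<^sup>2 - 2 * (?m h * ?s h)) - 2 * (?m h * u h) \<partial>S)"
    proof (rule integral_mono)
      show "integrable S (\<lambda>h. (pmax u (Suc n) h)\<^sup>2 - 2 * (pmax u (Suc n) h * psum u (Suc n) h))"
        by (intro bounded_rv_integrable b)
      show "integrable S (\<lambda>h. ((?m h)\<^sup>2 - 2 * (?m h * ?s h)) - 2 * (?m h * u h))"
        by (intro bounded_rv_integrable bounded_rv_diff bounded_rv_mult[OF bounded_rv_const] b' b'')
      fix h
      have "(max m (s+v))\<^sup>2 - 2 * (max m (s+v) * (s+v)) \<le> m\<^sup>2 - 2 * (m * s) - 2 * (m * v)" for m s v :: real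
      proof (cases "m \<ge> s + v")
        case True then show ?thesis by (simp add: max_def algebra_simps)
      next
        case False
        have "0 \<le> (m - (s+v))\<^sup>2" by simp
        with False show ?thesis by (simp add: max_def algebra_simps power2_eq_square)
      qed
      then show "(pmax u (Suc n) h)\<^sup>2 - 2 * (pmax u (Suc n) h * psum u (Suc n) h)
        \<le> ((?m h)\<^sup>2 - 2 * (?m h * ?s h)) - 2 * (?m h * u h)" by simp
    qed
    also have "\<dots> = (\<integral>h. (?m h)\<^sup>2 - 2 * (?m h * ?s h) \<partial>S) - 2 * (\<integral>h. ?m h * u h \<partial>S)"
      using bounded_rv_integrable[OF b'] bounded_rv_integrable[OF b''] by simp
    also have "(\<integral>h. ?m h * u h \<partial>S) = 0"
      using integral_htail_mult[OF bounded_rv_pmax[OF u(1)] u(1)] u(2) by simp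
    also have "(\<integral>h. (?m h)\<^sup>2 - 2 * (?m h * ?s h) \<partial>S) = (\<integral>h. (pmax u n h)\<^sup>2 - 2 * (pmax u n h * psum u n h) \<partial>S)"
      using integral_htail[OF b] .
    finally show ?case using Suc by simp
  qed simp
  \<comment> \<open>The square (m - 2 s)^2 >= 0 absorbs the cross term at the price of half of m^2;
    together with the second moment of the partial sum this gives the factor 4.\<close>
  moreover have "(\<integral>h. (1/2) * (pmax u n h)\<^sup>2 - 2 * (psum u n h)\<^sup>2 \<partial>S)
      \<le> (\<integral>h. (pmax u n h)\<^sup>2 - 2 * (pmax u n h * psum u n h) \<partial>S)"
  proof (rule integral_mono)
    show "integrable S (\<lambda>h. (1/2) * (pmax u n h)\<^sup>2 - 2 * (psum u n h)\<^sup>2)"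
      by (intro bounded_rv_integrable bounded_rv_diff bounded_rv_mult) auto
    fix h
    have "0 \<le> (pmax u n h - 2 * psum u n h)\<^sup>2" by simp
    then show "(1/2) * (pmax u n h)\<^sup>2 - 2 * (psum u n h)\<^sup>2 \<le> (pmax u n h)\<^sup>2 - 2 * (pmax u n h * psum u n h)"
      by (simp add: algebra_simps power2_eq_square)
  qed (use b in auto)
  moreover have "(\<integral>h. (1/2) * (pmax u n h)\<^sup>2 - 2 * (psum u n h)\<^sup>2 \<partial>S) =
     (1/2) * (\<integral>h. (pmax u n h)\<^sup>2 \<partial>S) - 2 * (\<integral>h. (psum u n h)\<^sup>2 \<partial>S)"
    using bounded_rv_integrable[OF sq[of "pmax u n"]] bounded_rv_integrable[OF sq[of "psum u n"]] bounded_rv_psum[OF u(1)] bounded_rv_pmax[OF u(1)]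
    by simp
  ultimately show ?thesis using psum_sq_integral[OF u, of n] by simp
qed

text \<open>A Freedman-type exponential bound. The factor \<open>p\<close> on the right makes it summable over
  a partition of the whole line.\<close>

lemma cosh_psum_bound:
  fixes t v p :: real
  assumes u: "bounded_rv u" "\<And>h. cond_step u h = 0" "\<And>h. \<bar>u h\<bar> \<le> 1"
    and q: "bounded_rv q" "\<And>h. 0 \<le> q h" "\<And>h. cond_step (\<lambda>h. (u h)\<^sup>2) h \<le> q h" "AE h in S. q h \<le> v"
    and p: "integral\<^sup>L S q \<le> p" and t: "0 \<le> t" "t \<le> 1" and v: "0 \<le> v"
  shows "(\<integral>h. cosh (t * psum u n h) - 1 \<partial>S) \<le> n * (t\<^sup>2 * p) * (1 + t\<^sup>2 * v) ^ n"
proof (induction n)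
  case (Suc n)
  note bounded_rv_integrable[intro]
  have sq [intro]: "bounded_rv f \<Longrightarrow> bounded_rv (\<lambda>h. (f h :: real)\<^sup>2)" for f by (auto simp: power2_eq_square)
  have ch: "bounded_rv f \<Longrightarrow> bounded_rv (\<lambda>h. cosh (t * f h))" for f
    by (rule bounded_rv_cont[of "\<lambda>x. cosh (t * x)"]) (auto intro!: continuous_intros)
  have sh: "bounded_rv f \<Longrightarrow> bounded_rv (\<lambda>h. sinh (t * f h))" for f
    by (rule bounded_rv_cont[of "\<lambda>x. sinh (t * x)"]) (auto intro!: continuous_intros)
  have s: "bounded_rv (psum u n)" "bounded_rv (psum u (Suc n))" using u(1) by blast+
  let ?c = "\<lambda>h. cosh (t * psum u n h)" and ?s = "\<lambda>h. sinh (t * psum u n h)"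
  have c: "bounded_rv ?c" "bounded_rv ?s" using ch sh s by auto
  have cu: "bounded_rv (\<lambda>h. ?c (htail h) * (u h)\<^sup>2)" "bounded_rv (\<lambda>h. ?s (htail h) * u h)"
    using bounded_rv_htail[OF c(1)] bounded_rv_htail[OF c(2)] u(1) by (auto intro!: bounded_rv_mult)
  \<comment> \<open>For |z| <= 1 one has cosh (a + z) <= cosh a (1 + z^2) + z sinh a. The sinh term
    is a past factor times an increment and integrates to 0, so only a second order term is
    left.\<close>
  have "(\<integral>h. cosh (t * psum u (Suc n) h) - 1 \<partial>S) \<le>
    (\<integral>h. (?c (htail h) - 1) + (t\<^sup>2 * (?c (htail h) * (u h)\<^sup>2) + t * (?s (htail h) * u h)) \<partial>S)"
  proof (rule integral_mono)
    show "integrable S (\<lambda>h. cosh (t * psum u (Suc n) h) - 1)"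
      using ch[OF s(2)] by (intro bounded_rv_integrable bounded_rv_diff bounded_rv_const)
    show "integrable S (\<lambda>h. (?c (htail h) - 1) + (t\<^sup>2 * (?c (htail h) * (u h)\<^sup>2) + t * (?s (htail h) * u h)))"
      by (intro bounded_rv_integrable bounded_rv_add bounded_rv_diff bounded_rv_const bounded_rv_mult[OF bounded_rv_const] bounded_rv_htail[OF c(1)] cu)
    fix h
    define a where "a = t * psum u n (htail h)"
    have tu: "\<bar>t * u h\<bar> \<le> 1" using u(3)[of h] t by (simp add: abs_mult mult_le_one)
    have "cosh (a + t * u h) = (exp a * exp (t * u h) + exp (-a) * exp (- (t * u h))) / 2"
      by (simp add: cosh_field_def exp_add[symmetric])
    also have "\<dots> \<le> (exp a * (1 + t * u h + (t * u h)\<^sup>2) + exp (-a) * (1 + - (t * u h) + (- (t * u h))\<^sup>2)) / 2"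
      using tu by (intro divide_right_mono add_mono mult_left_mono exp_le_one_plus_sq) auto
    also have "\<dots> = cosh a + (t\<^sup>2 * (cosh a * (u h)\<^sup>2) + t * (sinh a * u h))"
      by (simp add: cosh_field_def sinh_field_def field_simps power2_eq_square)
    finally show "cosh (t * psum u (Suc n) h) - 1 \<le>
       (?c (htail h) - 1) + (t\<^sup>2 * (?c (htail h) * (u h)\<^sup>2) + t * (?s (htail h) * u h))"
      by (simp add: a_def algebra_simps)
  qed
  also have "\<dots> = (\<integral>h. ?c (htail h) - 1 \<partial>S) + (t\<^sup>2 * (\<integral>h. ?c (htail h) * (u h)\<^sup>2 \<partial>S) + t * (\<integral>h. ?s (htail h) * u h \<partial>S))"
    using bounded_rv_integrable[OF bounded_rv_htail[OF c(1)]] cu[THEN bounded_rv_integrable] by simp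
  also have "(\<integral>h. ?c (htail h) - 1 \<partial>S) = (\<integral>h. ?c h - 1 \<partial>S)"
    by (intro integral_htail[of "\<lambda>h. ?c h - 1"] bounded_rv_diff c bounded_rv_const)
  also have "(\<integral>h. ?s (htail h) * u h \<partial>S) = 0"
    using integral_htail_mult[OF c(2) u(1)] u(2) by simp
  also have "(\<integral>h. ?c (htail h) * (u h)\<^sup>2 \<partial>S) = (\<integral>h. ?c h * cond_step (\<lambda>h. (u h)\<^sup>2) h \<partial>S)"
    using integral_htail_mult[OF c(1) sq[OF u(1)]] .
  also have "(\<integral>h. ?c h * cond_step (\<lambda>h. (u h)\<^sup>2) h \<partial>S) \<le> (\<integral>h. v * (?c h - 1) + q h \<partial>S)"
  proof (rule integral_mono_AE)
    show "integrable S (\<lambda>h. ?c h * cond_step (\<lambda>h. (u h)\<^sup>2) h)"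
      using c bounded_rv_cond_step[OF sq[OF u(1)]] by auto
    show "integrable S (\<lambda>h. v * (?c h - 1) + q h)"
      by (intro bounded_rv_integrable bounded_rv_add bounded_rv_mult[OF bounded_rv_const] bounded_rv_diff c bounded_rv_const q)
    show "AE h in S. ?c h * cond_step (\<lambda>h. (u h)\<^sup>2) h \<le> v * (?c h - 1) + q h"
      using q(4)
    proof eventually_elim
      case (elim h)
      have c1: "?c h \<ge> 1" by (rule cosh_real_ge_1)
      have "?c h * cond_step (\<lambda>h. (u h)\<^sup>2) h \<le> ?c h * q h"
        using q(3) c1 by (intro mult_left_mono) auto
      \<comment> \<open>Only the part cosh - 1 is charged with the uniform bound \<open>v\<close>.
        The remaining summand \<open>q h\<close> is integrated exactly, and this is where the factor
        \<open>p\<close> comes from.\<close>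
      also have "\<dots> = (?c h - 1) * q h + q h" by (simp add: algebra_simps)
      also have "\<dots> \<le> (?c h - 1) * v + q h" using elim c1 by (intro add_mono mult_left_mono) auto
      finally show ?case by (simp add: mult.commute)
    qed
  qed
  also have "(\<integral>h. v * (?c h - 1) + q h \<partial>S) = v * (\<integral>h. ?c h - 1 \<partial>S) + integral\<^sup>L S q"
    using bounded_rv_integrable[OF c(1)] bounded_rv_integrable[OF q(1)] by simp
  finally have "(\<integral>h. cosh (t * psum u (Suc n) h) - 1 \<partial>S) \<le>
     (1 + t\<^sup>2 * v) * (\<integral>h. ?c h - 1 \<partial>S) + t\<^sup>2 * integral\<^sup>L S q"
    by (simp add: algebra_simps mult_left_mono mult_right_mono)
  also have "\<dots> \<le> (1 + t\<^sup>2 * v) * (n * (t\<^sup>2 * p) * (1 + t\<^sup>2 * v) ^ n) + t\<^sup>2 * p"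
    using Suc p v by (intro add_mono mult_left_mono) auto
  also have "\<dots> \<le> (1 + t\<^sup>2 * v) * (n * (t\<^sup>2 * p) * (1 + t\<^sup>2 * v) ^ n) + t\<^sup>2 * p * (1 + t\<^sup>2 * v) ^ Suc n"
  proof -
    have "0 \<le> integral\<^sup>L S q" using q(2) by simp
    then have "0 \<le> p" using p by simp
    moreover have "1 \<le> (1 + t\<^sup>2 * v) ^ Suc n" using v by (intro one_le_power) auto
    ultimately have "t\<^sup>2 * p * 1 \<le> t\<^sup>2 * p * (1 + t\<^sup>2 * v) ^ Suc n" by (intro mult_left_mono) auto
    then show ?thesis by simp
  qed
  also have "\<dots> = Suc n * (t\<^sup>2 * p) * (1 + t\<^sup>2 * v) ^ Suc n" by (simp add: algebra_simps)
  finally show ?case .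
qed simp

end

section \<open>Prediction several steps ahead and the remote past\<close>

lemma extend_hist_0 [simp]: "extend_hist 0 h e = h"
  by (simp add: extend_hist_def)

text \<open>The entry \<open>e 0\<close> is the oldest of the new ones, so it may be appended to the
  history first. Hence k + 1 steps of prediction are one step applied to k steps.\<close>

lemma extend_hist_Suc_case_nat [simp]:
  "extend_hist (Suc k) h (case_nat x e) = extend_hist k (case_nat x h) e"
proof
  fix j
  show "extend_hist (Suc k) h (case_nat x e) j = extend_hist k (case_nat x h) e j"
  proof (cases j k rule: linorder_cases)
    case less
    then obtain d where d: "k - j = Suc d" by (cases "k - j") auto
    then have "k - Suc j = d" by simp
    with d less show ?thesis by (simp add: extend_hist_def)
  next
    case equal then show ?thesis by (simp add: extend_hist_def)
  next
    case greater
    then obtain d where d: "j - k = Suc d" by (cases "j - k") auto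
    then have "j - Suc k = d" by simp
    with d greater show ?thesis by (simp add: extend_hist_def)
  qed
qed

context innovations
begin

lemma measurable_extend_hist [measurable]: "(\<lambda>(h, e). extend_hist k h e) \<in> S \<Otimes>\<^sub>M S \<rightarrow>\<^sub>M S"
  unfolding split_beta' extend_hist_def
  by (rule measurable_PiM_single') (auto simp: PiE_UNIV_domain)

lemma measurable_extend_hist2: "(\<lambda>e. extend_hist k h e) \<in> S \<rightarrow>\<^sub>M S"
  using measurable_compose[OF measurable_Pair1'[of h S S] measurable_extend_hist] by simp

lemma integral_S_swap: assumes "bounded_rv f" shows "integral\<^sup>L S f = (\<integral>x. \<integral>h. f (case_nat x h) \<partial>S \<partial>\<mu>)"
proof -
  interpret pair_sigma_finite \<mu> S by unfold_locales
  interpret PP: pair_prob_space \<mu> S by unfold_locales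
  have [measurable]: "f \<in> borel_measurable S" using assms by (simp add: bounded_rv_def)
  obtain C where C: "\<forall>h. norm (f h) \<le> C" using assms by (auto simp: bounded_rv_def)
  have "integrable (\<mu> \<Otimes>\<^sub>M S) (\<lambda>(x, h). f (case_nat x h))"
    using C by (intro PP.P.integrable_const_bound[where B=C]) (auto simp: split_beta')
  from Fubini_integral[OF this] show ?thesis
    by (simp add: integral_S[OF assms] cond_step_def[abs_def])
qed

text \<open>A version of E(f(xi_k) | xi_0 = h), written with \<open>extend_hist\<close> so that it
  matches \<open>cond_cf\<close> literally.\<close>

definition cond_iter :: "nat \<Rightarrow> ((nat \<Rightarrow> real) \<Rightarrow> 'b::{banach, second_countable_topology}) \<Rightarrow> (nat \<Rightarrow> real) \<Rightarrow> 'b" where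
  "cond_iter k f h = (\<integral>e. f (extend_hist k h e) \<partial>S)"

lemma bounded_rv_extend: "bounded_rv f \<Longrightarrow> bounded_rv (\<lambda>e. f (extend_hist k h e))"
  unfolding bounded_rv_def using measurable_compose[OF measurable_extend_hist2] by blast

lemma cond_iter_0 [simp]: "cond_iter 0 f = f"
  by (simp add: cond_iter_def fun_eq_iff seq.P.prob_space[simplified])

lemma cond_iter_Suc: assumes "bounded_rv f" shows "cond_iter (Suc k) f = cond_step (cond_iter k f)"
proof
  fix h
  show "cond_iter (Suc k) f h = cond_step (cond_iter k f) h"
    unfolding cond_iter_def cond_step_def by (subst integral_S_swap[OF bounded_rv_extend[OF assms]]) simp
qed

lemma bounded_rv_cond_iter [intro]: "bounded_rv f \<Longrightarrow> bounded_rv (cond_iter k f)"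
  by (induction k) (auto simp: cond_iter_Suc)

lemma integral_cond_iter: "bounded_rv f \<Longrightarrow> integral\<^sup>L S (cond_iter k f) = integral\<^sup>L S f"
  by (induction k) (auto simp: cond_iter_Suc integral_S[symmetric] bounded_rv_cond_iter)

lemma cond_iter_norm_le: assumes "bounded_rv f" shows "norm (cond_iter k f h) \<le> cond_iter k (\<lambda>h. norm (f h)) h"
  unfolding cond_iter_def by simp

lemma bounded_rv_norm [intro]: "bounded_rv f \<Longrightarrow> bounded_rv (\<lambda>h. norm (f h))"
  unfolding bounded_rv_def by auto

text \<open>By stationarity this says that predictions of \<open>f\<close> from the remote past tend
  to the mean in L^1. No rate is asked for.\<close>

definition forgets :: "((nat \<Rightarrow> real) \<Rightarrow> 'b::euclidean_space) \<Rightarrow> bool" where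
  "forgets f \<longleftrightarrow> (\<lambda>k. \<integral>h. norm (cond_iter k f h - integral\<^sup>L S f) \<partial>S) \<longlonglongrightarrow> 0"

lemma forgets_const: "forgets (\<lambda>_. c)"
  by (simp add: forgets_def cond_iter_def seq.P.prob_space[simplified])

lemma cond_iter_add: "bounded_rv f \<Longrightarrow> bounded_rv g \<Longrightarrow> cond_iter k (\<lambda>h. f h + g h) h = cond_iter k f h + cond_iter k g h"
  unfolding cond_iter_def using bounded_rv_extend[THEN bounded_rv_integrable] by (intro Bochner_Integration.integral_add)

lemma cond_iter_diff:
  fixes f g :: "_ \<Rightarrow> 'b::euclidean_space"
  shows "bounded_rv f \<Longrightarrow> bounded_rv g \<Longrightarrow> cond_iter k (\<lambda>h. f h - g h) h = cond_iter k f h - cond_iter k g h"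
  unfolding cond_iter_def using bounded_rv_extend[THEN bounded_rv_integrable] by (intro Bochner_Integration.integral_diff)

lemma bounded_rv_dev: "bounded_rv f \<Longrightarrow> bounded_rv (\<lambda>h. norm (cond_iter k f h - integral\<^sup>L S (f :: _ \<Rightarrow> 'b::euclidean_space)))"
  by (intro bounded_rv_norm bounded_rv_diff bounded_rv_cond_iter bounded_rv_const)

lemma forgets_add:
  assumes "bounded_rv f" "bounded_rv g" "forgets f" "forgets g" shows "forgets (\<lambda>h. f h + g h)"
proof -
  let ?d = "\<lambda>f k. \<integral>h. norm (cond_iter k f h - integral\<^sup>L S f) \<partial>S"
  have le: "?d (\<lambda>h. f h + g h) k \<le> ?d f k + ?d g k" for k
  proof -
    have "?d (\<lambda>h. f h + g h) k \<le> (\<integral>h. norm (cond_iter k f h - integral\<^sup>L S f) + norm (cond_iter k g h - integral\<^sup>L S g) \<partial>S)"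
    proof (rule integral_mono)
      fix h
      have "cond_iter k (\<lambda>h. f h + g h) h - integral\<^sup>L S (\<lambda>h. f h + g h)
        = (cond_iter k f h - integral\<^sup>L S f) + (cond_iter k g h - integral\<^sup>L S g)"
        using assms bounded_rv_integrable[of f] bounded_rv_integrable[of g] by (simp add: cond_iter_add)
      then show "norm (cond_iter k (\<lambda>h. f h + g h) h - integral\<^sup>L S (\<lambda>h. f h + g h))
        \<le> norm (cond_iter k f h - integral\<^sup>L S f) + norm (cond_iter k g h - integral\<^sup>L S g)"
        by (simp add: norm_triangle_ineq)
    qed (intro bounded_rv_integrable bounded_rv_add bounded_rv_dev[OF bounded_rv_add] bounded_rv_dev assms)+
    also have "\<dots> = ?d f k + ?d g k"
      by (intro Bochner_Integration.integral_add bounded_rv_integrable bounded_rv_dev assms)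
    finally show ?thesis .
  qed
  have "(\<lambda>k. ?d f k + ?d g k) \<longlonglongrightarrow> 0 + 0"
    using assms unfolding forgets_def by (intro tendsto_add) auto
  then have "(\<lambda>k. ?d f k + ?d g k) \<longlonglongrightarrow> 0" by simp
  then show ?thesis unfolding forgets_def
    by (rule Lim_null_comparison[rotated]) (use le in \<open>auto intro: always_eventually\<close>)
qed

lemma forgets_scaleR:
  fixes f :: "_ \<Rightarrow> real" and c :: "'b::euclidean_space"
  assumes "bounded_rv f" "forgets f" shows "forgets (\<lambda>h. f h *\<^sub>R c)"
proof -
  have 1: "cond_iter k (\<lambda>h. f h *\<^sub>R c) h = cond_iter k f h *\<^sub>R c" for k h
    unfolding cond_iter_def using bounded_rv_extend[OF assms(1), THEN bounded_rv_integrable] by simp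
  have 2: "integral\<^sup>L S (\<lambda>h. f h *\<^sub>R c) = integral\<^sup>L S f *\<^sub>R c"
    using bounded_rv_integrable[OF assms(1)] by simp
  have "(\<lambda>k. (\<integral>h. norm (cond_iter k f h - integral\<^sup>L S f) \<partial>S) * norm c) \<longlonglongrightarrow> 0 * norm c"
    using assms(2) unfolding forgets_def by (intro tendsto_mult_right)
  then show ?thesis unfolding forgets_def 1 2
    by (simp add: scaleR_diff_left[symmetric])
qed

lemma forgets_sum:
  "(\<And>i. i \<in> I \<Longrightarrow> bounded_rv (f i)) \<Longrightarrow> (\<And>i. i \<in> I \<Longrightarrow> forgets (f i)) \<Longrightarrow> forgets (\<lambda>h. \<Sum>i\<in>I. f i h)"
  by (induction I rule: infinite_finite_induct) (auto intro!: forgets_const forgets_add bounded_rv_sum)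

text \<open>Prediction is a contraction in L^1. Replacing \<open>f\<close> by \<open>s i\<close>
  therefore costs at most twice their L^1 distance (once for the prediction, once for the mean)
  uniformly in k, and that distance vanishes by dominated convergence.\<close>

lemma forgets_lim:
  fixes f :: "_ \<Rightarrow> 'b::euclidean_space"
  assumes f: "bounded_rv f" and s: "\<And>i. bounded_rv (s i)" "\<And>i. forgets (s i)"
    and lim: "\<And>h. (\<lambda>i. s i h) \<longlonglongrightarrow> f h" and bd: "\<And>i h. norm (s i h) \<le> C"
  shows "forgets f"
proof -
  let ?d = "\<lambda>f k. \<integral>h. norm (cond_iter k f h - integral\<^sup>L S f) \<partial>S"
  let ?r = "\<lambda>i. \<integral>h. norm (f h - s i h) \<partial>S"
  obtain D where D: "\<And>h. norm (f h) \<le> D" using f by (auto simp: bounded_rv_def)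
  have "?r \<longlonglongrightarrow> (\<integral>h. 0 \<partial>S)"
  proof (rule integral_dominated_convergence[where w="\<lambda>_. D + C"])
    show "AE h in S. (\<lambda>i. norm (f h - s i h)) \<longlonglongrightarrow> 0"
    proof (intro AE_I2)
      fix h
      have "(\<lambda>i. norm (f h - s i h)) \<longlonglongrightarrow> norm (f h - f h)" by (intro tendsto_intros lim)
      then show "(\<lambda>i. norm (f h - s i h)) \<longlonglongrightarrow> 0" by simp
    qed
    show "AE h in S. norm (norm (f h - s i h)) \<le> D + C" for i
      by (intro AE_I2) (simp add: order_trans[OF norm_triangle_ineq4 add_mono[OF D bd]])
  qed (use bounded_rv_meas[OF f] bounded_rv_meas[OF s(1)] in auto)
  then have r: "?r \<longlonglongrightarrow> 0" by simp
  have dle: "?d f k \<le> ?d (s i) k + 2 * ?r i" for k i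
  proof -
    have b: "bounded_rv (\<lambda>h. f h - s i h)" using f s by auto
    have n: "norm (integral\<^sup>L S f - integral\<^sup>L S (s i)) \<le> ?r i"
      using bounded_rv_integrable[OF f] bounded_rv_integrable[OF s(1)[of i]]
      integral_norm_bound[of S "\<lambda>h. f h - s i h"] by simp
    have "?d f k \<le> (\<integral>h. norm (cond_iter k (s i) h - integral\<^sup>L S (s i)) + (cond_iter k (\<lambda>h. norm (f h - s i h)) h + ?r i) \<partial>S)"
    proof (rule integral_mono)
      fix h
      have "cond_iter k f h - integral\<^sup>L S f = (cond_iter k (s i) h - integral\<^sup>L S (s i)) +
         cond_iter k (\<lambda>h. f h - s i h) h - (integral\<^sup>L S f - integral\<^sup>L S (s i))"
        using f s by (simp add: cond_iter_diff)
      moreover have "norm (x + y - z) \<le> norm x + norm y + norm z" for x y z :: 'b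
        by (rule order_trans[OF norm_triangle_ineq4 add_right_mono[OF norm_triangle_ineq]])
      ultimately have "norm (cond_iter k f h - integral\<^sup>L S f) \<le> norm (cond_iter k (s i) h - integral\<^sup>L S (s i)) +
         norm (cond_iter k (\<lambda>h. f h - s i h) h) + norm (integral\<^sup>L S f - integral\<^sup>L S (s i))"
        by (simp only:)
      then show "norm (cond_iter k f h - integral\<^sup>L S f) \<le> norm (cond_iter k (s i) h - integral\<^sup>L S (s i)) +
         (cond_iter k (\<lambda>h. norm (f h - s i h)) h + ?r i)"
        using n cond_iter_norm_le[OF b, of k h] by linarith
    next
      show "integrable S (\<lambda>h. norm (cond_iter k (s i) h - integral\<^sup>L S (s i)) + (cond_iter k (\<lambda>h. norm (f h - s i h)) h + ?r i))"
        by (rule bounded_rv_integrable, rule bounded_rv_add[OF bounded_rv_dev[OF s(1)]], rule bounded_rv_add[OF bounded_rv_cond_iter[OF bounded_rv_norm[OF b]] bounded_rv_const])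
    qed (rule bounded_rv_integrable[OF bounded_rv_dev[OF f]])
    also have "\<dots> = ?d (s i) k + (integral\<^sup>L S (cond_iter k (\<lambda>h. norm (f h - s i h))) + ?r i)"
      using bounded_rv_integrable[OF bounded_rv_dev[OF s(1)[of i], of k]] bounded_rv_integrable[OF bounded_rv_cond_iter[OF bounded_rv_norm[OF b], of k]]
      by (simp add: seq.P.prob_space[simplified])
    finally show ?thesis by (simp add: integral_cond_iter[OF bounded_rv_norm[OF b]])
  qed
  show ?thesis unfolding forgets_def
  proof (rule LIMSEQ_I)
    fix e :: real assume e: "e > 0"
    obtain i where i: "norm (?r i) < e / 4"
      using LIMSEQ_D[OF r, of "e/4"] e by auto
    obtain N where N: "\<And>k. k \<ge> N \<Longrightarrow> norm (?d (s i) k) < e / 4"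
      using LIMSEQ_D[OF s(2)[of i, unfolded forgets_def], of "e/4"] e by auto
    have "norm (?d f k - 0) < e" if "k \<ge> N" for k
    proof -
      have "0 \<le> ?d f k" by simp
      moreover have "?d (s i) k < e / 4" using N[OF that] by (simp add: abs_less_iff)
      moreover have "?r i < e / 4" using i by (simp add: abs_less_iff)
      ultimately show ?thesis using dle[of k i] e by simp
    qed
    then show "\<exists>N. \<forall>k\<ge>N. norm (?d f k - 0) < e" by blast
  qed
qed

lemma bounded_rv_indicator [intro]: "A \<in> sets S \<Longrightarrow> bounded_rv (indicator A :: _ \<Rightarrow> real)"
  by (rule bounded_rvI[where C=1]) (auto simp: indicator_def)

text \<open>Induction over the generated sigma-algebra. A cylinder set depends on finitely many of
  the newest entries; once all of these have been redrawn, the prediction is constant and equals the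
  mean. Countable disjoint unions are limits of bounded finite sums.\<close>

lemma forgets_indicator:
  assumes "A \<in> sets S" shows "forgets (indicator A :: _ \<Rightarrow> real)"
proof -
  have A: "A \<in> sigma_sets (space S) (prod_algebra UNIV (\<lambda>_::nat. \<mu>))"
    using assms by (simp add: sets_PiM space_PiM)
  have sub: "prod_algebra UNIV (\<lambda>_::nat. \<mu>) \<subseteq> Pow (space S)" by auto
  have sS: "sigma_sets (space S) (prod_algebra UNIV (\<lambda>_::nat. \<mu>)) = sets S"
    by (simp add: sets_PiM space_PiM)
  show ?thesis
  proof (rule sigma_sets_induct_disjoint[OF Int_stable_prod_algebra sub A])
    fix A assume "A \<in> prod_algebra UNIV (\<lambda>_::nat. \<mu>)"
    then obtain J E where A: "A = prod_emb UNIV (\<lambda>_::nat. \<mu>) J (Pi\<^sub>E J E)" "finite J" "\<And>i. i \<in> J \<Longrightarrow> E i \<in> sets \<mu>"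
      by (rule prod_algebraE) blast
    then have [measurable]: "A \<in> sets S" by (auto intro!: sets_PiM_I)
    have A': "h \<in> A \<longleftrightarrow> (\<forall>j\<in>J. h j \<in> E j)" for h
      unfolding A(1) prod_emb_def by (auto simp: PiE_UNIV_domain)
    obtain N where N: "\<And>j. j \<in> J \<Longrightarrow> j < N" using A(2) by (metis finite_nat_set_iff_bounded)
    have "(\<integral>h. norm (cond_iter k (indicator A) h - integral\<^sup>L S (indicator A :: _ \<Rightarrow> real)) \<partial>S) = 0" if "k \<ge> N" for k
    proof -
      have "indicator A (extend_hist k h e) = (indicator A (extend_hist k h' e) :: real)" for h h' e
      proof -
        have "j < k" if "j \<in> J" for j using N[OF that] \<open>k \<ge> N\<close> by simp
        then show ?thesis by (auto simp: indicator_def A' extend_hist_def)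
      qed
      then have c: "cond_iter k (indicator A) h = (cond_iter k (indicator A) h' :: real)" for h h'
        unfolding cond_iter_def by metis
      have "integral\<^sup>L S (indicator A :: _ \<Rightarrow> real) = integral\<^sup>L S (cond_iter k (indicator A))"
        by (simp add: integral_cond_iter bounded_rv_indicator)
      also have "\<dots> = (\<integral>h. cond_iter k (indicator A) undefined \<partial>S)" using c by metis
      also have "\<dots> = cond_iter k (indicator A) undefined" by (simp add: seq.P.prob_space[simplified])
      finally have "integral\<^sup>L S (indicator A :: _ \<Rightarrow> real) = cond_iter k (indicator A) h" for h using c by metis
      then show ?thesis by simp
    qed
    then show "forgets (indicator A :: _ \<Rightarrow> real)" unfolding forgets_def
      by (intro tendsto_eventually) (auto simp: eventually_sequentially)
  next
    show "forgets (indicator {} :: _ \<Rightarrow> real)" using forgets_const[of "0::real"] by (simp add: indicator_def[abs_def])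
  next
    fix A assume A: "A \<in> sigma_sets (space S) (prod_algebra UNIV (\<lambda>_::nat. \<mu>))" "forgets (indicator A :: _ \<Rightarrow> real)"
    then have [measurable]: "A \<in> sets S" using sS by simp
    have "forgets (\<lambda>h. 1 + indicator A h *\<^sub>R (-1) :: real)"
      using bounded_rv_mult[OF bounded_rv_indicator[of A] bounded_rv_const[of "-1"]]
      by (intro forgets_add forgets_scaleR forgets_const A bounded_rv_const bounded_rv_indicator) (simp_all add: mult.commute)
    moreover have "(\<lambda>h. 1 + indicator A h *\<^sub>R (-1) :: real) = indicator (space S - A)"
      by (auto simp: indicator_def fun_eq_iff)
    ultimately show "forgets (indicator (space S - A) :: _ \<Rightarrow> real)" by simp
  next
    fix A :: "nat \<Rightarrow> _" assume dis: "disjoint_family A" and "range A \<subseteq> sigma_sets (space S) (prod_algebra UNIV (\<lambda>_::nat. \<mu>))"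
      and f: "\<And>i. forgets (indicator (A i) :: _ \<Rightarrow> real)"
    then have [measurable]: "A i \<in> sets S" for i using sS by auto
    show "forgets (indicator (\<Union>i. A i) :: _ \<Rightarrow> real)"
    proof (rule forgets_lim)
      show "bounded_rv (\<lambda>h. \<Sum>i<n. indicator (A i) h :: real)" for n by (intro bounded_rv_sum bounded_rv_indicator) measurable
      show "forgets (\<lambda>h. \<Sum>i<n. indicator (A i) h :: real)" for n by (intro forgets_sum bounded_rv_indicator f) measurable
      have e: "(\<Sum>i<n. indicator (A i) h :: real) = indicator (\<Union>i<n. A i) h" for n h
        using dis by (subst indicator_UN_disjoint) (auto simp: disjoint_family_on_def)
      show "norm (\<Sum>i<n. indicator (A i) h :: real) \<le> 1" for n h unfolding e by (simp add: indicator_def)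
      show "(\<lambda>n. \<Sum>i<n. indicator (A i) h :: real) \<longlonglongrightarrow> indicator (\<Union>i. A i) h" for h
        unfolding e by (rule LIMSEQ_indicator_UN)
      show "bounded_rv (indicator (\<Union>i. A i) :: _ \<Rightarrow> real)" by (intro bounded_rv_indicator) measurable
    qed
  qed
qed

text \<open>An elementary substitute for backward martingale convergence combined with Kolmogorov's
  zero-one law. Its purpose is to remove the remainder of the lag expansion.\<close>

lemma forgets_bounded_rv:
  fixes f :: "_ \<Rightarrow> 'b::euclidean_space"
  assumes f: "bounded_rv f" shows "forgets f"
proof -
  obtain C where C: "\<And>h. norm (f h) \<le> C" using f by (auto simp: bounded_rv_def)
  from borel_measurable_implies_sequence_metric[OF bounded_rv_meas[OF f], of 0]
  obtain s where s: "\<And>i. simple_function S (s i)" "\<And>x. x \<in> space S \<Longrightarrow> (\<lambda>i. s i x) \<longlonglongrightarrow> f x"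
    "\<And>i x. x \<in> space S \<Longrightarrow> dist (s i x) 0 \<le> 2 * dist (f x) 0" by metis
  have bd: "norm (s i h) \<le> 2 * C" for i h using s(3)[of h i] C[of h] by simp
  have eq: "s i = (\<lambda>h. \<Sum>y\<in>range (s i). indicator (s i -` {y}) h *\<^sub>R y)" for i
  proof
    fix h
    have "finite (range (s i))" using simple_functionD(1)[OF s(1)[of i]] by simp
    then show "s i h = (\<Sum>y\<in>range (s i). indicator (s i -` {y}) h *\<^sub>R y)"
      by (subst sum.remove[of _ "s i h"]) (auto intro!: sum.neutral simp: indicator_def)
  qed
  have m: "s i -` {y} \<in> sets S" for i y using simple_functionD(2)[OF s(1)[of i], of "{y}"] by simp
  have bs: "bounded_rv (s i)" for i using borel_measurable_simple_function[OF s(1)[of i]] bd by (rule bounded_rvI)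
  have b: "bounded_rv (\<lambda>h. indicator (s i -` {y}) h *\<^sub>R y)" for i y
  proof (rule bounded_rvI[where C="norm y"])
    show "(\<lambda>h. indicator (s i -` {y}) h *\<^sub>R y) \<in> borel_measurable S"
      using m by (intro borel_measurable_scaleR borel_measurable_indicator) auto
  qed (auto simp: indicator_def)
  show ?thesis
  proof (rule forgets_lim[OF f bs _ _ bd])
    show "forgets (s i)" for i
      by (subst eq, intro forgets_sum forgets_scaleR forgets_indicator m b bounded_rv_indicator)
    show "(\<lambda>i. s i h) \<longlonglongrightarrow> f h" for h using s(2) by simp
  qed
qed

end

section \<open>The martingale part\<close>

lemma htail_hist: "htail (hist eps k \<omega>) = hist eps (k - 1) \<omega>"
  by (simp add: htail_def hist_def fun_eq_iff algebra_simps)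

lemma psum_hist: "psum u n (hist eps (j + int n) \<omega>) = (\<Sum>i\<in>{1..n}. u (hist eps (j + int i) \<omega>))"
  by (induction n) (auto simp: htail_hist)

text \<open>The choice of \<alpha> makes \<open>t <= 1\<close>, since ln n <= K n b. The product t
  lam equals (c0 \<alpha>^2 + 5) ln n. Its first part pays for the power (1 + t^2 c0 N / n)^n, up to
  exp (2 c0). Its second part gives n^(-5) against the n^3 produced by (N + 1)^2 and the factor n,
  which leaves the summable n^(-2).\<close>

lemma exponential_tail_numeric:
  fixes K c0 b \<alpha> C t lam :: real and n N :: nat
  assumes K: "K > 0" and n: "n \<ge> 3" and b: "0 < b" "b \<le> 1" and ln: "ln n \<le> K * (n * b)" and c0: "c0 > 0"
  defines "\<alpha> \<equiv> 1 / sqrt K"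
  defines "C \<equiv> (c0 * \<alpha>\<^sup>2 + 5) / \<alpha>"
  defines "t \<equiv> \<alpha> * sqrt (ln n / (n * b))" and "lam \<equiv> C * sqrt (n * b * ln n)" and "N \<equiv> nat \<lfloor>n * b\<rfloor> + 2"
  shows "0 < t" "t \<le> 1" "0 < lam" "0 < cosh (t * lam) - 1"
    "(real N + 1)\<^sup>2 * (n * t\<^sup>2 * (1 + t\<^sup>2 * (c0 * (N / n))) ^ n / (cosh (t * lam) - 1)) \<le> 16 * exp (2 * c0) / (real n)\<^sup>2"
proof -
  have lnp: "ln n > 0" using n by simp
  have al: "\<alpha> > 0" "\<alpha>\<^sup>2 = 1 / K" using K by (auto simp: \<alpha>_def power_divide)
  have nb: "n * b > 0" using n b by simp
  have C: "C > 0" unfolding C_def using al(1) c0 by (intro divide_pos_pos add_nonneg_pos) auto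
  show t0: "0 < t" using al lnp nb by (simp add: t_def)
  have t2: "t\<^sup>2 = ln n / (n * b) / K" using al lnp nb by (simp add: t_def power_mult_distrib)
  have "t\<^sup>2 \<le> 1" unfolding t2 using ln nb K by (simp add: field_simps)
  then show t1: "t \<le> 1" using t0 by (metis abs_le_square_iff abs_of_pos one_power2 power2_eq_square zero_less_one)
  show "0 < lam" using C lnp nb by (simp add: lam_def)
  have "t * lam = \<alpha> * C * (sqrt (ln n / (n * b)) * sqrt (n * b * ln n))" by (simp add: t_def lam_def)
  also have "sqrt (ln n / (n * b)) * sqrt (n * b * ln n) = sqrt ((ln n)\<^sup>2)"
    unfolding real_sqrt_mult[symmetric] using b n by (simp add: power2_eq_square)
  also have "\<dots> = ln n" using lnp by simp
  finally have tl: "t * lam = (c0 * \<alpha>\<^sup>2 + 5) * ln n" using al by (simp add: C_def)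
  have e4: "exp (t * lam) \<ge> 4"
  proof -
    have "(4::real) \<le> real n * real n" using n mult_mono[of 3 "real n" 3 "real n"] by simp
    also have "\<dots> = exp (ln n + ln n)" unfolding exp_add using n by simp
    also have "\<dots> \<le> exp (t * lam)"
    proof -
      have "2 * ln n \<le> (c0 * \<alpha>\<^sup>2 + 5) * ln n" using lnp c0 by (intro mult_right_mono) auto
      then show ?thesis unfolding tl by simp
    qed
    finally show ?thesis .
  qed
  \<comment> \<open>Once exp >= 4, the loss of 1 in exp / 2 - 1 still leaves exp / 4.\<close>
  have cosh: "exp (t * lam) / 4 \<le> cosh (t * lam) - 1"
  proof -
    have "cosh (t * lam) = exp (t * lam) / 2 + exp (- (t * lam)) / 2" by (simp add: cosh_field_def add_divide_distrib)
    moreover have "exp (- (t * lam)) > 0" by simp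
    ultimately show ?thesis using e4 by linarith
  qed
  then show cp: "0 < cosh (t * lam) - 1" using e4 by linarith
  have N: "real N \<le> n * b + 2" using nb by (simp add: N_def)
  have "n * b \<le> n" using b n by (simp add: mult_left_le)
  then have "real N + 1 \<le> 2 * real n" using N n by linarith
  then have N2: "(real N + 1)\<^sup>2 \<le> 4 * (real n)\<^sup>2" using power_mono[of "real N + 1" "2 * real n" 2] by (simp add: power_mult_distrib)
  have "(1 + t\<^sup>2 * (c0 * (N / n))) ^ n \<le> exp (t\<^sup>2 * (c0 * (N / n))) ^ n"
    using c0 by (intro power_mono) (auto simp: exp_ge_add_one_self)
  also have "\<dots> = exp (t\<^sup>2 * (c0 * real N))" using n by (simp add: exp_of_nat_mult[symmetric])
  also have "\<dots> \<le> exp (t\<^sup>2 * (c0 * (n * b + 2)))" using N c0 by (simp add: mult_left_mono)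
  also have "t\<^sup>2 * (c0 * (n * b + 2)) = c0 * \<alpha>\<^sup>2 * ln n + 2 * c0 * t\<^sup>2"
    using b n K unfolding t2 al(2) by (simp add: field_simps)
  also have "exp \<dots> \<le> exp (c0 * \<alpha>\<^sup>2 * ln n + 2 * c0)" using \<open>t\<^sup>2 \<le> 1\<close> c0 by simp
  finally have P: "(1 + t\<^sup>2 * (c0 * (N / n))) ^ n \<le> exp (c0 * \<alpha>\<^sup>2 * ln n + 2 * c0)" .
  have "(real N + 1)\<^sup>2 * (n * t\<^sup>2 * (1 + t\<^sup>2 * (c0 * (N / n))) ^ n / (cosh (t * lam) - 1))
    \<le> (4 * (real n)\<^sup>2) * (n * 1 * exp (c0 * \<alpha>\<^sup>2 * ln n + 2 * c0) / (exp (t * lam) / 4))"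
    using N2 P cosh e4 mult_left_mono[OF \<open>t\<^sup>2 \<le> 1\<close>, of "real n"] c0
    by (intro mult_mono frac_le mult_nonneg_nonneg divide_nonneg_nonneg) auto
  also have "\<dots> = 16 * exp (2 * c0) * (real n ^ 3 * exp (- (5 * ln n)))"
    unfolding tl by (simp add: exp_add exp_minus field_simps power2_eq_square power3_eq_cube)
  also have "exp (- (5 * ln n)) = 1 / real n ^ 5"
  proof -
    have "exp (5 * ln n) = exp (ln n) ^ 5" by (simp add: exp_of_nat_mult[symmetric])
    then show ?thesis using n by (simp add: exp_minus inverse_eq_divide)
  qed
  also have "real n ^ 3 * (1 / real n ^ 5) = 1 / (real n)\<^sup>2"
    using n by (simp add: field_simps flip: power_add)
  finally show "(real N + 1)\<^sup>2 * (n * t\<^sup>2 * (1 + t\<^sup>2 * (c0 * (N / n))) ^ n / (cosh (t * lam) - 1)) \<le> 16 * exp (2 * c0) / (real n)\<^sup>2"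
    by simp
qed

section \<open>Tail bounds for single cells and for the whole grid\<close>

locale innovations_map = innovations \<mu> for \<mu> :: "real measure" +
  fixes g :: "(nat \<Rightarrow> real) \<Rightarrow> real"
  assumes g_meas [measurable]: "g \<in> borel_measurable S"
begin

definition next_cdf :: "real \<Rightarrow> (nat \<Rightarrow> real) \<Rightarrow> real" where
  "next_cdf x h = cond_cdf \<mu> g 1 x h"

definition cell_prob :: "real \<Rightarrow> real \<Rightarrow> (nat \<Rightarrow> real) \<Rightarrow> real" where
  "cell_prob a b = cond_step (\<lambda>h. indicator {a<..b} (g h))"

definition mdiff :: "real \<Rightarrow> real \<Rightarrow> (nat \<Rightarrow> real) \<Rightarrow> real" where
  "mdiff a b h = indicator {a<..b} (g h) - cell_prob a b (htail h)"

lemma bounded_rv_ind: "A \<in> sets borel \<Longrightarrow> bounded_rv (\<lambda>h. indicator A (g h) :: real)"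
  by (rule bounded_rvI[where C=1]) (auto simp: indicator_def)

lemma g_vimage [measurable]: "A \<in> sets borel \<Longrightarrow> {h. g h \<in> A} \<in> sets S"
  using measurable_sets[OF g_meas, of A] by (simp add: vimage_def)

lemma sets_Collect_S: "Measurable.pred S P \<Longrightarrow> {h. P h} \<in> sets S"
  by (simp add: pred_def)

lemma case_nat_meas [measurable]: "(\<lambda>x. case_nat x h) \<in> \<mu> \<rightarrow>\<^sub>M S"
  using measurable_compose[OF measurable_Pair2'[of h S \<mu>] case_nat_S] by simp

lemma next_cdf_eq_cond_step: "next_cdf x h = cond_step (\<lambda>h. indicator {..x} (g h)) h"
proof -
  have [measurable]: "(\<lambda>e. extend_hist (Suc 0) h e) \<in> S \<rightarrow>\<^sub>M S" by (rule measurable_extend_hist2)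
  have "next_cdf x h = (\<integral>e. indicator {e \<in> space S. g (extend_hist 1 h e) \<le> x} e \<partial>S)"
    unfolding next_cdf_def cond_cdf_def by (subst Bochner_Integration.integral_indicator) auto
  also have "\<dots> = cond_iter (Suc 0) (\<lambda>h. indicator {..x} (g h)) h"
    unfolding cond_iter_def by (intro Bochner_Integration.integral_cong) (auto simp: indicator_def)
  also have "\<dots> = cond_step (\<lambda>h. indicator {..x} (g h)) h"
    by (subst cond_iter_Suc) (auto intro!: bounded_rv_ind)
  finally show ?thesis .
qed

lemma next_cdf_range: "0 \<le> next_cdf x h" "next_cdf x h \<le> 1"
  unfolding next_cdf_def cond_cdf_def by auto

lemma next_cdf_mono: assumes "x \<le> y" shows "next_cdf x h \<le> next_cdf y h"
  unfolding next_cdf_eq_cond_step cond_step_def using assms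
  by (intro integral_mono bounded_rv_slice bounded_rv_ind) (auto simp: indicator_def)

lemma next_cdf_meas [measurable]: "next_cdf x \<in> borel_measurable S"
  unfolding next_cdf_eq_cond_step[abs_def] by (intro cond_step_meas) auto

lemma cell_prob_eq: assumes "a \<le> b" shows "cell_prob a b h = next_cdf b h - next_cdf a h"
proof -
  have "indicator {a<..b} y = (indicator {..b} y - indicator {..a} y :: real)" for y
    using assms by (auto simp: indicator_def)
  then show ?thesis unfolding cell_prob_def next_cdf_eq_cond_step cond_step_def
    using bounded_rv_slice[OF bounded_rv_ind[of "{..b}"], of h] bounded_rv_slice[OF bounded_rv_ind[of "{..a}"], of h] by simp
qed

text \<open>The form in which the bound on the conditional density is used. It mentions no
  derivative, so it can be tested on rational points and defines a measurable set of
  histories.\<close>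

definition Lip :: "real \<Rightarrow> (nat \<Rightarrow> real) \<Rightarrow> bool" where
  "Lip c h \<longleftrightarrow> (\<forall>x y. x \<le> y \<longrightarrow> next_cdf y h - next_cdf x h \<le> c * (y - x))"

lemma Lip_rat:
  assumes "c \<ge> 0"
  shows "Lip c h \<longleftrightarrow> (\<forall>x y :: rat. x \<le> y \<longrightarrow> next_cdf (of_rat y) h - next_cdf (of_rat x) h \<le> c * (of_rat y - of_rat x))"
    (is "_ \<longleftrightarrow> ?R")
proof
  assume R: ?R
  show "Lip c h" unfolding Lip_def
  proof (intro allI impI)
    fix x y :: real assume xy: "x \<le> y"
    show "next_cdf y h - next_cdf x h \<le> c * (y - x)"
    proof (rule field_le_epsilon)
      fix e :: real assume e: "e > 0"
      define d where "d = e / (2 * (c + 1))"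
      have d: "d > 0" "2 * c * d \<le> e" using e assms by (auto simp: d_def field_simps)
      \<comment> \<open>The rational points lie outside [x, y], so monotonicity of the distribution
        function gives the comparison and no continuity has to be known beforehand.\<close>
      obtain r s where r: "x - d < of_rat r" "of_rat r < x" and s: "y < of_rat s" "of_rat s < y + d"
        using of_rat_dense[of "x - d" x] of_rat_dense[of y "y + d"] d by auto
      have "(of_rat r::real) \<le> of_rat s" using r s xy by linarith
      then have "r \<le> s" by (simp add: of_rat_less_eq)
      then have "next_cdf (of_rat s) h - next_cdf (of_rat r) h \<le> c * (of_rat s - of_rat r)" using R by blast
      also have "\<dots> \<le> c * (y - x + 2 * d)" using r s assms by (intro mult_left_mono) auto
      also have "\<dots> \<le> c * (y - x) + e" using d by (simp add: algebra_simps)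
      finally have "next_cdf (of_rat s) h - next_cdf (of_rat r) h \<le> c * (y - x) + e" .
      moreover have "next_cdf y h \<le> next_cdf (of_rat s) h" "next_cdf (of_rat r) h \<le> next_cdf x h" using r s by (auto intro!: next_cdf_mono)
      ultimately show "next_cdf y h - next_cdf x h \<le> c * (y - x) + e" by linarith
    qed
  qed
qed (auto simp: Lip_def of_rat_less_eq)

lemma Lip_meas: "c \<ge> 0 \<Longrightarrow> {h \<in> space S. Lip c h} \<in> sets S"
  unfolding Lip_rat by measurable

text \<open>The square of an indicator is the indicator, so with p the cell probability the
  conditional second moment is p - p^2, hence at most p. These facts are the hypotheses of
  \<open>cosh_psum_bound\<close> with \<open>q\<close> taken to be the cell probability.\<close>

lemma mdiff_props:
  assumes "a \<le> b"
  shows "bounded_rv (cell_prob a b)" "bounded_rv (mdiff a b)" "cond_step (mdiff a b) h = 0" "\<bar>mdiff a b h\<bar> \<le> 1"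
    "0 \<le> cell_prob a b h" "cond_step (\<lambda>h. (mdiff a b h)\<^sup>2) h \<le> cell_prob a b h"
    "integral\<^sup>L S (cell_prob a b) = measure S {h. g h \<in> {a<..b}}"
proof -
  let ?i = "\<lambda>h. indicator {a<..b} (g h) :: real"
  have bi: "bounded_rv ?i" by (rule bounded_rv_ind) auto
  show bq: "bounded_rv (cell_prob a b)" unfolding cell_prob_def using bi by (rule bounded_rv_cond_step)
  show bmd: "bounded_rv (mdiff a b)" unfolding mdiff_def[abs_def] using bi bounded_rv_htail[OF bq] by (rule bounded_rv_diff)
  note sl = bounded_rv_slice[OF bi, of h]
  have qh: "cell_prob a b h = (\<integral>x. ?i (case_nat x h) \<partial>\<mu>)" by (simp add: cell_prob_def cond_step_def)
  show "cond_step (mdiff a b) h = 0" unfolding cond_step_def mdiff_def using sl qh by (simp add: prob_UNIV)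
  have q01: "0 \<le> cell_prob a b h" "cell_prob a b h \<le> 1" for h
    using next_cdf_range[of b h] next_cdf_range[of a h] next_cdf_mono[OF assms, of h] by (auto simp: cell_prob_eq[OF assms])
  then show "0 \<le> cell_prob a b h" by simp
  show "\<bar>mdiff a b h\<bar> \<le> 1" unfolding mdiff_def using q01[of "htail h"] by (auto simp: indicator_def)
  have "(mdiff a b (case_nat x h))\<^sup>2 = (1 - 2 * cell_prob a b h) * ?i (case_nat x h) + (cell_prob a b h)\<^sup>2" for x
    unfolding mdiff_def by (auto simp: indicator_def power2_eq_square algebra_simps)
  then have "cond_step (\<lambda>h. (mdiff a b h)\<^sup>2) h = (1 - 2 * cell_prob a b h) * cell_prob a b h + (cell_prob a b h)\<^sup>2"
    unfolding cond_step_def using sl qh by (simp add: prob_UNIV)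
  also have "\<dots> \<le> cell_prob a b h" by (simp add: algebra_simps power2_eq_square)
  finally show "cond_step (\<lambda>h. (mdiff a b h)\<^sup>2) h \<le> cell_prob a b h" .
  have "integral\<^sup>L S (cell_prob a b) = integral\<^sup>L S ?i" unfolding cell_prob_def using integral_S[OF bi] by simp
  also have "\<dots> = (\<integral>h. indicator {h. g h \<in> {a<..b}} h \<partial>S)"
    by (intro Bochner_Integration.integral_cong) (auto simp: indicator_def)
  also have "\<dots> = measure S {h. g h \<in> {a<..b}}" by (subst Bochner_Integration.integral_indicator) auto
  finally show "integral\<^sup>L S (cell_prob a b) = measure S {h. g h \<in> {a<..b}}" .
qed

text \<open>Markov's inequality for cosh (t s) - 1. This function is even and nonnegative, so both
  tails are treated together, and the mass of the cell survives as a factor.\<close>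

lemma mdiff_tail:
  fixes t c lam :: real
  assumes ab: "a \<le> b" and lip: "AE h in S. Lip c h" and c: "c \<ge> 0" and t: "0 < t" "t \<le> 1" and l: "0 < lam"
  shows "measure S {h. lam < \<bar>psum (mdiff a b) n h\<bar>} \<le>
     measure S {h. g h \<in> {a<..b}} * (n * t\<^sup>2 * (1 + t\<^sup>2 * (c * (b - a))) ^ n / (cosh (t * lam) - 1))"
proof -
  note mp = mdiff_props[OF ab]
  let ?s = "psum (mdiff a b) n"
  have bs: "bounded_rv ?s" using mp(2) by blast
  have [measurable]: "?s \<in> borel_measurable S" using bs by (rule bounded_rv_meas)
  have cl: "cosh (t * lam) > 1" using t l cosh_real_nonneg_less_iff[of 0 "t * lam"] by simp
  have [measurable]: "{h. lam < \<bar>?s h\<bar>} \<in> sets S" by (rule sets_Collect_S) measurable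
  have bc: "bounded_rv (\<lambda>h. cosh (t * ?s h) - 1)"
    by (rule bounded_rv_cont[of "\<lambda>x. cosh (t * x) - 1", OF _ bs]) (intro continuous_intros)
  have "measure S {h. lam < \<bar>?s h\<bar>} * (cosh (t * lam) - 1) = (\<integral>h. indicator {h. lam < \<bar>?s h\<bar>} h * (cosh (t * lam) - 1) \<partial>S)"
    by simp
  also have "\<dots> \<le> (\<integral>h. cosh (t * ?s h) - 1 \<partial>S)"
  proof (rule integral_mono)
    show "integrable S (\<lambda>h. indicator {h. lam < \<bar>?s h\<bar>} h * (cosh (t * lam) - 1))"
      by (intro integrable_mult_left integrable_real_indicator) (auto simp: seq.P.emeasure_finite less_top[symmetric])
    show "integrable S (\<lambda>h. cosh (t * ?s h) - 1)" using bc by (rule bounded_rv_integrable)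
    fix h
    have "cosh (t * lam) \<le> cosh (t * ?s h)" if "lam < \<bar>?s h\<bar>"
    proof -
      have "cosh (t * lam) \<le> cosh \<bar>t * ?s h\<bar>"
        using that t l by (intro cosh_real_nonneg_le_iff[THEN iffD2]) (auto simp: abs_mult)
      then show ?thesis by (simp add: cosh_real_abs)
    qed
    then show "indicator {h. lam < \<bar>?s h\<bar>} h * (cosh (t * lam) - 1) \<le> cosh (t * ?s h) - 1"
      using cosh_real_ge_1[of "t * ?s h"] by (auto simp: indicator_def)
  qed
  also have "\<dots> \<le> n * (t\<^sup>2 * measure S {h. g h \<in> {a<..b}}) * (1 + t\<^sup>2 * (c * (b - a))) ^ n"
  proof (rule cosh_psum_bound[where q="cell_prob a b"])
    show "AE h in S. cell_prob a b h \<le> c * (b - a)"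
      using lip by eventually_elim (use ab in \<open>auto simp: cell_prob_eq Lip_def\<close>)
  qed (use mp t ab c in auto)
  finally show ?thesis using cl by (simp add: field_simps)
qed

text \<open>An interval of m mesh cells starts at every grid point, so each real number is covered m
  times and the total mass is at most m. The map \<open>int_decode\<close> enumerates the grid
  points by natural numbers.\<close>

lemma sum_cells_le:
  fixes n m :: nat assumes n: "n > 0"
  shows "(\<Sum>i. emeasure S {h. g h \<in> {of_int (int_decode i) / real n <.. (of_int (int_decode i) + real m) / real n}}) \<le> of_nat m"
proof -
  define c where "c k = {h. g h \<in> {of_int k / real n <.. (of_int k + 1) / real n}}" for k :: int
  have [measurable]: "c k \<in> sets S" for k unfolding c_def by (intro g_vimage) simp
  have sub: "{h. g h \<in> {of_int k / real n <.. (of_int k + real m) / real n}} \<subseteq> (\<Union>r<m. c (k + int r))" for k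
  proof
    fix h assume h: "h \<in> {h. g h \<in> {of_int k / real n <.. (of_int k + real m) / real n}}"
    \<comment> \<open>Cells are open on the left and closed on the right; hence the ceiling minus
      one and not the floor.\<close>
    define j where "j = \<lceil>real n * g h\<rceil> - 1"
    have j: "of_int j < real n * g h" "real n * g h \<le> of_int j + 1" unfolding j_def by linarith+
    have h': "of_int k < real n * g h" "real n * g h \<le> of_int k + real m" using h n by (auto simp: field_simps)
    have "k \<le> j" "j < k + int m" using j h' by linarith+
    then have "j = k + int (nat (j - k))" "nat (j - k) < m" by auto
    moreover have "h \<in> c j" using j n by (auto simp: c_def field_simps)
    ultimately show "h \<in> (\<Union>r<m. c (k + int r))" by (intro UN_I[of "nat (j - k)"]) simp_all
  qed
  have "emeasure S {h. g h \<in> {of_int k / real n <.. (of_int k + real m) / real n}} \<le> (\<Sum>r<m. emeasure S (c (k + int r)))" for k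
    by (rule order_trans[OF emeasure_mono[OF sub] emeasure_subadditive_finite]) auto
  then have "(\<Sum>i. emeasure S {h. g h \<in> {of_int (int_decode i) / real n <.. (of_int (int_decode i) + real m) / real n}})
    \<le> (\<Sum>i. \<Sum>r<m. emeasure S (c (int_decode i + int r)))"
    by (intro suminf_le) auto
  also have "\<dots> = (\<Sum>r<m. \<Sum>i. emeasure S (c (int_decode i + int r)))"
    by (subst suminf_sum) auto
  also have "\<dots> \<le> (\<Sum>r<m. 1)"
  proof (rule sum_mono)
    fix r
    have d: "c k \<inter> c l = {}" if "k < l" for k l
    proof -
      have "(of_int k + 1) / real n \<le> of_int l / real n" using that n by (intro divide_right_mono) linarith+
      then show ?thesis by (fastforce simp: c_def)
    qed
    have "disjoint_family (\<lambda>i. c (int_decode i + int r))"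
      unfolding disjoint_family_on_def
    proof safe
      fix i j x assume ij: "i \<noteq> j" and x: "x \<in> c (int_decode i + int r)" "x \<in> c (int_decode j + int r)"
      have "int_decode i \<noteq> int_decode j" using ij by (metis int_decode_inverse)
      then have "int_decode i + int r < int_decode j + int r \<or> int_decode j + int r < int_decode i + int r" by linarith
      then show "x \<in> {}" using d x by blast
    qed
    then have "(\<Sum>i. emeasure S (c (int_decode i + int r))) = emeasure S (\<Union>i. c (int_decode i + int r))"
      by (intro suminf_emeasure) auto
    also have "\<dots> \<le> 1" by (rule seq.P.emeasure_le_1)
    finally show "(\<Sum>i. emeasure S (c (int_decode i + int r))) \<le> 1" .
  qed
  finally show ?thesis by simp
qed

text \<open>The power is estimated at the largest length N / n. For each of the N + 1 lengths the
  masses of all intervals add up to at most N + 1 by \<open>sum_cells_le\<close>; this gives (N +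
  1)^2 although the grid is infinite.\<close>

lemma grid_tail:
  fixes n N :: nat and t c lam :: real
  assumes n: "n > 0" and lip: "AE h in S. Lip c h" and c: "c \<ge> 0" and t: "0 < t" "t \<le> 1" and l: "0 < lam"
  shows "measure S {h. \<exists>k::int. \<exists>m\<le>N. lam < \<bar>psum (mdiff (of_int k / real n) ((of_int k + real m) / real n)) n h\<bar>}
    \<le> (real N + 1)\<^sup>2 * (n * t\<^sup>2 * (1 + t\<^sup>2 * (c * (N / n))) ^ n / (cosh (t * lam) - 1))"
proof -
  let ?a = "\<lambda>k::int. of_int k / real n" and ?b = "\<lambda>(k::int) (m::nat). (of_int k + real m) / real n"
  let ?E = "\<lambda>k m. {h. lam < \<bar>psum (mdiff (?a k) (?b k m)) n h\<bar>}"
  let ?p = "\<lambda>k m. emeasure S {h. g h \<in> {?a k <.. ?b k m}}"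
  define B where "B = n * t\<^sup>2 * (1 + t\<^sup>2 * (c * (N / n))) ^ n / (cosh (t * lam) - 1)"
  have cl: "cosh (t * lam) > 1" using t l cosh_real_nonneg_less_iff[of 0 "t * lam"] by simp
  have B0: "0 \<le> B" unfolding B_def using cl c t by (intro divide_nonneg_nonneg mult_nonneg_nonneg zero_le_power) auto
  have ab: "?a k \<le> ?b k m" for k m by (intro divide_right_mono) auto
  have [measurable]: "psum (mdiff (?a k) (?b k m)) n \<in> borel_measurable S" for k m
    using mdiff_props(2)[OF ab] by (intro bounded_rv_meas bounded_rv_psum)
  have mE [measurable]: "?E k m \<in> sets S" for k m by (rule sets_Collect_S) measurable
  have E: "emeasure S (?E k m) \<le> ennreal B * ?p k m" if "m \<le> N" for k m
  proof -
    have "measure S (?E k m) \<le> measure S {h. g h \<in> {?a k <.. ?b k m}} *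
       (n * t\<^sup>2 * (1 + t\<^sup>2 * (c * (?b k m - ?a k))) ^ n / (cosh (t * lam) - 1))"
      using ab lip c t l by (intro mdiff_tail) simp_all
    also have "\<dots> \<le> measure S {h. g h \<in> {?a k <.. ?b k m}} * B"
    proof (rule mult_left_mono)
      have "?b k m - ?a k = m / n" by (simp add: diff_divide_distrib[symmetric])
      also have "\<dots> \<le> N / n" using that by (simp add: divide_right_mono)
      finally have "c * (?b k m - ?a k) \<le> c * (N / n)" using c by (rule mult_left_mono)
      moreover have "0 \<le> c * (?b k m - ?a k)" using c ab[of k m] by simp
      ultimately have "(1 + t\<^sup>2 * (c * (?b k m - ?a k))) ^ n \<le> (1 + t\<^sup>2 * (c * (N / n))) ^ n"
        by (intro power_mono add_left_mono mult_left_mono[of "c * _" "c * _"]) (simp_all add: add_nonneg_nonneg)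
      then show "n * t\<^sup>2 * (1 + t\<^sup>2 * (c * (?b k m - ?a k))) ^ n / (cosh (t * lam) - 1) \<le> B"
        unfolding B_def using cl by (intro divide_right_mono mult_left_mono) simp_all
    qed auto
    finally have "measure S (?E k m) \<le> B * measure S {h. g h \<in> {?a k <.. ?b k m}}" by (simp add: mult.commute)
    then show ?thesis
      using B0 by (simp add: seq.P.emeasure_eq_measure ennreal_mult[symmetric] ennreal_leI)
  qed
  have "emeasure S (\<Union>m\<in>{..N}. \<Union>i. ?E (int_decode i) m) \<le> (\<Sum>m\<in>{..N}. emeasure S (\<Union>i. ?E (int_decode i) m))"
    by (rule emeasure_subadditive_finite) auto
  also have "\<dots> \<le> (\<Sum>m\<in>{..N}. ennreal B * of_nat (N + 1))"
  proof (rule sum_mono)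
    fix m assume "m \<in> {..N}"
    then have m: "m \<le> N" by simp
    have "emeasure S (\<Union>i. ?E (int_decode i) m) \<le> (\<Sum>i. emeasure S (?E (int_decode i) m))"
      by (rule emeasure_subadditive_countably) auto
    also have "\<dots> \<le> (\<Sum>i. ennreal B * ?p (int_decode i) m)"
      using E[OF m] by (intro suminf_le) auto
    also have "\<dots> = ennreal B * (\<Sum>i. ?p (int_decode i) m)" by simp
    also have "\<dots> \<le> ennreal B * of_nat m" by (intro mult_left_mono sum_cells_le n) auto
    also have "\<dots> \<le> ennreal B * of_nat (N + 1)" using m by (intro mult_left_mono of_nat_mono) simp_all
    finally show "emeasure S (\<Union>i. ?E (int_decode i) m) \<le> ennreal B * of_nat (N + 1)" .
  qed
  also have "\<dots> = ennreal ((real N + 1)\<^sup>2 * B)"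
    using B0 by (simp add: ennreal_of_nat_eq_real_of_nat ennreal_mult[symmetric] power2_eq_square algebra_simps
        del: of_nat_Suc of_nat_add flip: of_nat_Suc)
  finally have "measure S (\<Union>m\<in>{..N}. \<Union>i. ?E (int_decode i) m) \<le> (real N + 1)\<^sup>2 * B"
    using B0 by (simp add: seq.P.emeasure_eq_measure ennreal_le_iff)
  moreover have "(\<Union>m\<in>{..N}. \<Union>i. ?E (int_decode i) m) = {h. \<exists>k::int. \<exists>m\<le>N. lam < \<bar>psum (mdiff (?a k) (?b k m)) n h\<bar>}"
  proof (rule set_eqI)
    fix h
    have "(\<exists>i. P (int_decode i)) \<longleftrightarrow> (\<exists>k. P k)" for P by (metis int_encode_inverse)
    from this[of "\<lambda>k. \<exists>m\<le>N. h \<in> ?E k m"]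
    show "h \<in> (\<Union>m\<in>{..N}. \<Union>i. ?E (int_decode i) m) \<longleftrightarrow>
      h \<in> {h. \<exists>k::int. \<exists>m\<le>N. lam < \<bar>psum (mdiff (?a k) (?b k m)) n h\<bar>}" by auto
  qed
  ultimately show ?thesis by (simp add: B_def)
qed

end

section \<open>From grid points to all pairs of points\<close>

lemma floor_grid:
  fixes x :: real assumes n: "n > (0::nat)"
  shows "of_int \<lfloor>n * x\<rfloor> / n \<le> x" "x - of_int \<lfloor>n * x\<rfloor> / n \<le> 1 / n"
proof -
  have e: "x - of_int \<lfloor>n * x\<rfloor> / n = (n * x - of_int \<lfloor>n * x\<rfloor>) / n" using n by (simp add: diff_divide_distrib)
  have "0 \<le> n * x - of_int \<lfloor>n * x\<rfloor>" "n * x - of_int \<lfloor>n * x\<rfloor> \<le> 1" by linarith+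
  then have "0 \<le> (n * x - of_int \<lfloor>n * x\<rfloor>) / n" "(n * x - of_int \<lfloor>n * x\<rfloor>) / n \<le> 1 / n"
    by (auto intro!: divide_right_mono)
  then show "of_int \<lfloor>n * x\<rfloor> / n \<le> x" "x - of_int \<lfloor>n * x\<rfloor> / n \<le> 1 / n"
    using e by linarith+
qed

lemma ceiling_grid:
  fixes x :: real assumes n: "n > (0::nat)"
  shows "x \<le> of_int \<lceil>n * x\<rceil> / n" "of_int \<lceil>n * x\<rceil> / n - x \<le> 1 / n"
  using floor_grid[OF n, of "-x"] by (simp_all add: ceiling_def)

text \<open>Independence enters only through two laws: every history has law \<open>S\<close>, and
  so has xi_0 with the copy \<open>eps0'\<close> put in front as one more entry. The latter is just
  the joint law of the copy and xi_0; its position 0 is bookkeeping and not a later time.\<close>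

locale causal_process = innovations_map \<mu> g + M: prob_space M
  for \<mu> :: "real measure" and g :: "(nat \<Rightarrow> real) \<Rightarrow> real" and M :: "'a measure" +
  fixes eps :: "int \<Rightarrow> 'a \<Rightarrow> real" and eps0' :: "'a \<Rightarrow> real"
  assumes hist_meas [measurable]: "\<And>k. hist eps k \<in> M \<rightarrow>\<^sub>M S"
    and hist_law: "\<And>k. distr M S (hist eps k) = S"
    and star_meas [measurable]: "(\<lambda>\<omega>. case_nat (eps0' \<omega>) (hist eps 0 \<omega>)) \<in> M \<rightarrow>\<^sub>M S"
    and star_law: "distr M S (\<lambda>\<omega>. case_nat (eps0' \<omega>) (hist eps 0 \<omega>)) = S"
begin

lemma AE_hist:
  assumes "{h \<in> space S. P h} \<in> sets S"
  shows "(AE \<omega> in M. P (hist eps k \<omega>)) \<longleftrightarrow> (AE h in S. P h)"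
  using AE_distr_iff[OF hist_meas[of k] assms] unfolding hist_law by simp

lemma AE_hist_of_AE: "AE h in S. P h \<Longrightarrow> AE \<omega> in M. P (hist eps k \<omega>)"
  using AE_distrD[OF hist_meas[of k], of P] unfolding hist_law by blast

definition mart :: "nat \<Rightarrow> real \<Rightarrow> 'a \<Rightarrow> real" where
  "mart n x \<omega> = (\<Sum>i\<in>{1..n}. indicator {..x} (g (hist eps (int i) \<omega>)) - next_cdf x (hist eps (int i - 1) \<omega>))"

lemma mart_diff: assumes "a \<le> b" shows "mart n b \<omega> - mart n a \<omega> = psum (mdiff a b) n (hist eps (int n) \<omega>)"
proof -
  have "indicator {a<..b} y = (indicator {..b} y - indicator {..a} y :: real)" for y
    using assms by (auto simp: indicator_def)
  then show ?thesis
    unfolding mart_def psum_hist[of _ _ _ 0, simplified] sum_subtractf[symmetric]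
    by (intro sum.cong) (auto simp: mdiff_def htail_hist cell_prob_eq[OF assms])
qed

text \<open>The count is monotone, and the compensator grows by at most c over one mesh width, n
  terms of size c / n each. Rounding the interval outward bounds the increment from above, rounding
  inward bounds it from below; either way two roundings cost 2 c.\<close>

lemma mart_bound_of_grid:
  fixes n :: nat and N :: nat
  assumes n: "n > 0" and xy: "x \<le> y" "y - x \<le> b" and N: "real n * b + 2 \<le> real N + 1" and c: "c \<ge> 0"
    and lip: "\<And>i. Lip c (hist eps i \<omega>)"
    and grid: "\<And>(k::int) m. m \<le> N \<Longrightarrow> \<bar>mart n ((of_int k + real m) / real n) \<omega> - mart n (of_int k / real n) \<omega>\<bar> \<le> lam"
  shows "\<bar>mart n y \<omega> - mart n x \<omega>\<bar> \<le> lam + 2 * c"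
proof -
  define V where "V x = (\<Sum>i\<in>{1..n}. next_cdf x (hist eps (int i - 1) \<omega>))" for x
  define E where "E x = (\<Sum>i\<in>{1..n}. indicator {..x} (g (hist eps (int i) \<omega>)) :: real)" for x
  have m: "mart n x \<omega> = E x - V x" for x by (simp add: mart_def E_def V_def sum_subtractf)
  have Em: "E x \<le> E y" if "x \<le> y" for x y unfolding E_def using that by (intro sum_mono) (auto simp: indicator_def)
  have VL: "V t - V s \<le> c" if "s \<le> t" "t - s \<le> 1 / real n" for s t
  proof -
    have "V t - V s = (\<Sum>i\<in>{1..n}. next_cdf t (hist eps (int i - 1) \<omega>) - next_cdf s (hist eps (int i - 1) \<omega>))"
      by (simp add: V_def sum_subtractf)
    also have "\<dots> \<le> (\<Sum>i\<in>{1..n}. c * (1 / real n))"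
    proof (rule sum_mono)
      fix i
      have "next_cdf t (hist eps (int i - 1) \<omega>) - next_cdf s (hist eps (int i - 1) \<omega>) \<le> c * (t - s)"
        using lip[of "int i - 1"] that by (simp add: Lip_def)
      also have "\<dots> \<le> c * (1 / real n)" using that c by (intro mult_left_mono) auto
      finally show "next_cdf t (hist eps (int i - 1) \<omega>) - next_cdf s (hist eps (int i - 1) \<omega>) \<le> c * (1 / real n)" .
    qed
    also have "\<dots> = c" using n by simp
    finally show ?thesis .
  qed
  \<comment> \<open>Both orders of k and l are needed: rounding inward can exchange the endpoints
    when x and y lie in the same cell.\<close>
  have grid': "\<bar>mart n (of_int l / real n) \<omega> - mart n (of_int k / real n) \<omega>\<bar> \<le> lam" if "\<bar>l - k\<bar> \<le> int N" for l k :: int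
  proof (cases "k \<le> l")
    case True
    then have "of_int l = of_int k + real (nat (l - k))" by simp
    then show ?thesis using grid[of "nat (l - k)" k] that True by (simp add: nat_le_iff)
  next
    case False
    then have "of_int k = of_int l + real (nat (k - l))" by simp
    then show ?thesis using grid[of "nat (k - l)" l] that False by (simp add: nat_le_iff abs_minus_commute)
  qed
  define k1 where "k1 = \<lfloor>n * x\<rfloor>"
  define l1 where "l1 = \<lceil>n * y\<rceil>"
  define k2 where "k2 = \<lceil>n * x\<rceil>"
  define l2 where "l2 = \<lfloor>n * y\<rfloor>"
  have nxy: "n * y - n * x \<le> n * b" "n * x \<le> n * y"
    using xy n by (auto simp flip: right_diff_distrib intro!: mult_left_mono)
  have "of_int l1 < n * y + 1" "n * x - 1 < of_int k1" unfolding l1_def k1_def by linarith+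
  then have "real_of_int (l1 - k1) < real N + 1" using nxy N by simp
  moreover have "k1 \<le> l1" using nxy(2) unfolding k1_def l1_def by linarith
  ultimately have g1: "\<bar>l1 - k1\<bar> \<le> int N" by linarith
  have k1: "of_int k1 / n \<le> x" "x - of_int k1 / n \<le> 1 / n"
    unfolding k1_def by (rule floor_grid[OF n])+
  have l1: "y \<le> of_int l1 / n" "of_int l1 / n - y \<le> 1 / n"
    unfolding l1_def by (rule ceiling_grid[OF n])+
  have k2: "x \<le> of_int k2 / n" "of_int k2 / n - x \<le> 1 / n"
    unfolding k2_def by (rule ceiling_grid[OF n])+
  have l2: "of_int l2 / n \<le> y" "y - of_int l2 / n \<le> 1 / n"
    unfolding l2_def by (rule floor_grid[OF n])+
  have "real_of_int (l2 - k2) \<le> n * b" using nxy unfolding k2_def l2_def by linarith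
  then have "l2 - k2 \<le> int N" using N by linarith
  moreover have "k2 - l2 \<le> int N"
  proof -
    have "real_of_int (k2 - l2) < 2" using nxy(2) unfolding k2_def l2_def by linarith
    moreover have "1 \<le> real N" using N nxy by linarith
    ultimately show ?thesis by linarith
  qed
  ultimately have g2: "\<bar>l2 - k2\<bar> \<le> int N" by linarith
  have "mart n y \<omega> - mart n x \<omega> \<le> lam + 2 * c"
    using grid'[OF g1] VL[OF k1] VL[OF l1] Em[OF k1(1)] Em[OF l1(1)] unfolding m by linarith
  moreover have "- (mart n y \<omega> - mart n x \<omega>) \<le> lam + 2 * c"
    using grid'[OF g2] VL[OF k2] VL[OF l2] Em[OF k2(1)] Em[OF l2(1)] unfolding m by linarith
  ultimately show ?thesis by linarith
qed

lemma martingale_modulus: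
  fixes b :: "nat \<Rightarrow> real"
  assumes lip: "AE h in S. Lip c h" and c: "c > 0"
    and b_pos: "\<And>n. b n > 0" and b_lim: "b \<longlonglongrightarrow> 0" and b_log: "(\<lambda>n. ln (real n)) \<in> O(\<lambda>n. real n * b n)"
  shows "\<exists>C. AE \<omega> in M. eventually (\<lambda>n. \<forall>x y. x \<le> y \<longrightarrow> y - x \<le> b n \<longrightarrow>
     \<bar>mart n y \<omega> - mart n x \<omega>\<bar> \<le> C * sqrt (n * b n * ln n)) sequentially"
proof -
  obtain K where K: "K > 0" and ev: "eventually (\<lambda>n. norm (ln (real n)) \<le> K * norm (real n * b n)) sequentially"
    using b_log by (auto elim: landau_o.bigE)
  define \<alpha> where "\<alpha> = 1 / sqrt K"
  define C where "C = (c * \<alpha>\<^sup>2 + 5) / \<alpha>"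
  define t where "t n = \<alpha> * sqrt (ln n / (n * b n))" for n :: nat
  define lam where "lam n = C * sqrt (n * b n * ln n)" for n :: nat
  define N where "N n = nat \<lfloor>n * b n\<rfloor> + 2" for n :: nat
  have "eventually (\<lambda>n. b n < 1) sequentially" using b_lim by (rule order_tendstoD) simp
  then have "eventually (\<lambda>n. n \<ge> 3 \<and> b n \<le> 1 \<and> ln (real n) \<le> K * (n * b n)) sequentially"
    using ev eventually_ge_at_top[of 3] by eventually_elim (auto simp: abs_mult abs_of_pos[OF b_pos])
  then obtain n0 where n0: "\<And>n. n \<ge> n0 \<Longrightarrow> n \<ge> 3 \<and> b n \<le> 1 \<and> ln (real n) \<le> K * (n * b n)"
    by (auto simp: eventually_sequentially)
  define E where "E n = {h. \<exists>k::int. \<exists>m\<le>N n. lam n < \<bar>psum (mdiff (of_int k / real n) ((of_int k + real m) / real n)) n h\<bar>}" for n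
  \<comment> \<open>Leaving out the indices below \<open>n0\<close> makes the n^(-2) bound valid for
    every n, as the summability test wants it.\<close>
  define A where "A n = (if n \<ge> n0 then {\<omega> \<in> space M. hist eps (int n) \<omega> \<in> E n} else {})" for n
  have mE: "E n \<in> sets S" for n
  proof -
    have ab: "of_int k / real n \<le> (of_int k + real m) / real n" for k :: int and m by (intro divide_right_mono) auto
    have [measurable]: "psum (mdiff (of_int k / real n) ((of_int k + real m) / real n)) n \<in> borel_measurable S" for k :: int and m
      using mdiff_props(2)[OF ab] by (intro bounded_rv_meas bounded_rv_psum)
    show ?thesis unfolding E_def by (rule sets_Collect_S) measurable
  qed
  have E_le: "measure S (E n) \<le> 16 * exp (2 * c) / (real n)\<^sup>2" if "n \<ge> n0" for n
  proof -
    note num = exponential_tail_numeric[OF K _ b_pos[of n] _ _ c, of n, folded \<alpha>_def, folded C_def,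
      folded t_def lam_def N_def]
    have n3: "n \<ge> 3" "b n \<le> 1" "ln (real n) \<le> K * (n * b n)" using n0[OF that] by auto
    have "measure S (E n) \<le> (real (N n) + 1)\<^sup>2 * (n * (t n)\<^sup>2 * (1 + (t n)\<^sup>2 * (c * (N n / n))) ^ n / (cosh (t n * lam n) - 1))"
      unfolding E_def using num[OF n3] n3 lip c by (intro grid_tail) auto
    then show ?thesis using num(5)[OF n3] by linarith
  qed
  have mA [measurable]: "A n \<in> sets M" for n
    unfolding A_def using measurable_sets[OF hist_meas[of "int n"] mE[of n]]
    by (auto simp: vimage_def Int_def conj_commute)
  have A_le: "measure M (A n) \<le> 16 * exp (2 * c) * (1 / (real n)\<^sup>2)" for n
  proof (cases "n \<ge> n0")
    case True
    have "measure M (A n) = measure (distr M S (hist eps (int n))) (E n)"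
      using True mE[of n] by (subst measure_distr) (auto simp: A_def vimage_def Int_def conj_commute)
    then show ?thesis using E_le[OF True] by (simp add: hist_law)
  qed (simp add: A_def)
  have "summable (\<lambda>n. measure M (A n))"
  proof (rule summable_comparison_test')
    show "summable (\<lambda>n. 16 * exp (2 * c) * (1 / (real n)\<^sup>2))"
      using inverse_power_summable[of 2, where 'a=real] by (intro summable_mult) (simp add: inverse_eq_divide)
    show "norm (measure M (A n)) \<le> 16 * exp (2 * c) * (1 / (real n)\<^sup>2)" for n
      using A_le[of n] by simp
  qed
  then have ae1: "AE \<omega> in M. eventually (\<lambda>n. \<omega> \<in> space M - A n) sequentially"
    by (intro borel_cantelli_AE1) (auto simp: M.emeasure_finite less_top[symmetric])
  have ae2: "AE \<omega> in M. \<forall>i. Lip c (hist eps i \<omega>)"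
    unfolding AE_all_countable using AE_hist_of_AE[OF lip] by blast
  have "AE \<omega> in M. eventually (\<lambda>n. \<forall>x y. x \<le> y \<longrightarrow> y - x \<le> b n \<longrightarrow>
     \<bar>mart n y \<omega> - mart n x \<omega>\<bar> \<le> (C + 2 * c * sqrt K) * sqrt (n * b n * ln n)) sequentially"
    using ae1 ae2
  proof eventually_elim
    case (elim \<omega>)
    from elim(1) eventually_ge_at_top[of n0]
    show ?case
    proof eventually_elim
      case (elim n)
      have n3: "n \<ge> 3" "b n \<le> 1" "ln (real n) \<le> K * (n * b n)" using n0 elim by auto
      have lnn: "ln n \<ge> 1"
      proof -
        have "exp 1 \<le> (3::real)" using exp_le by simp
        then have "exp 1 \<le> real n" using n3 by linarith
        then show ?thesis using n3 by (simp add: ln_ge_iff)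
      qed
      have "hist eps (int n) \<omega> \<notin> E n" using elim by (auto simp: A_def)
      then have grid: "\<bar>mart n ((of_int k + real m) / real n) \<omega> - mart n (of_int k / real n) \<omega>\<bar> \<le> lam n"
        if "m \<le> N n" for k :: int and m
        using that by (subst mart_diff) (auto simp: E_def not_less intro!: divide_right_mono)
      have NN: "real n * b n + 2 \<le> real (N n) + 1"
        using b_pos[of n] by (simp add: N_def) linarith
      \<comment> \<open>The rounding cost 2 c is constant; as ln n >= 1 and ln n <= K n b, it is
        absorbed into the main term at the price of the summand 2 c sqrt K in the constant.\<close>
      have "1 \<le> sqrt K * sqrt (n * b n * ln n)"
      proof -
        have "1 * 1 \<le> ln n * ln n" using lnn by (intro mult_mono) auto
        also have "ln n * ln n \<le> (K * (n * b n)) * ln n" using n3 lnn by (intro mult_right_mono) auto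
        finally have "1 \<le> sqrt (K * (n * b n * ln n))" by (simp add: mult.assoc)
        then show ?thesis by (simp add: real_sqrt_mult)
      qed
      then have "2 * c * 1 \<le> 2 * c * (sqrt K * sqrt (n * b n * ln n))" using c by (intro mult_left_mono) auto
      then have lam: "lam n + 2 * c \<le> (C + 2 * c * sqrt K) * sqrt (n * b n * ln n)" by (simp add: lam_def algebra_simps)
      show ?case
      proof (intro allI impI)
        fix x y assume "x \<le> y" "y - x \<le> b n"
        then have "\<bar>mart n y \<omega> - mart n x \<omega>\<bar> \<le> lam n + 2 * c"
          using n3 c \<open>\<forall>i. Lip c (hist eps i \<omega>)\<close> NN grid by (intro mart_bound_of_grid[where N="N n"]) auto
        with lam show "\<bar>mart n y \<omega> - mart n x \<omega>\<bar> \<le> (C + 2 * c * sqrt K) * sqrt (n * b n * ln n)" by linarith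
      qed
    qed
  qed
  then show ?thesis by blast
qed

end

section \<open>Second moments of the Fourier sums\<close>

lemma measurable_cis [measurable]: "cis \<in> borel_measurable borel"
  by (intro borel_measurable_continuous_onI continuous_intros)

lemma psum_le_pmax: "k \<le> n \<Longrightarrow> psum u k (hist eps (j + int k) \<omega>) \<le> pmax u n (hist eps (j + int n) \<omega>)"
proof (induction n)
  case (Suc n)
  show ?case
  proof (cases "k = Suc n")
    case True then show ?thesis by (simp only: pmax.simps)
  next
    case False
    then have "psum u k (hist eps (j + int k) \<omega>) \<le> pmax u n (hist eps (j + int n) \<omega>)" using Suc by simp
    then show ?thesis by (simp add: htail_hist)
  qed
qed simp

lemma psum_uminus: "psum (\<lambda>h. - u h) k h = - psum u k h"
  by (induction k arbitrary: h) auto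

lemma psum_Re: "psum (\<lambda>h. Re (u h)) k h = Re (psum u k h)"
  by (induction k arbitrary: h) auto

lemma psum_Im: "psum (\<lambda>h. Im (u h)) k h = Im (psum u k h)"
  by (induction k arbitrary: h) auto

text \<open>The maximal inequality is real and one-sided. The squared modulus is therefore dominated
  by the four running maxima of the real and imaginary parts with both signs; each part counted
  twice turns the factor 4 into 8.\<close>

definition cmax :: "((nat \<Rightarrow> real) \<Rightarrow> complex) \<Rightarrow> nat \<Rightarrow> (nat \<Rightarrow> real) \<Rightarrow> real" where
  "cmax u n h = ((pmax (\<lambda>h. Re (u h)) n h)\<^sup>2 + (pmax (\<lambda>h. - Re (u h)) n h)\<^sup>2)
     + ((pmax (\<lambda>h. Im (u h)) n h)\<^sup>2 + (pmax (\<lambda>h. - Im (u h)) n h)\<^sup>2)"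

lemma cmax_nonneg: "0 \<le> cmax u n h"
  by (simp add: cmax_def)

lemma psum_le_cmax:
  assumes "k \<le> n"
  shows "(cmod (psum u k (hist eps (j + int k) \<omega>)))\<^sup>2 \<le> cmax u n (hist eps (j + int n) \<omega>)"
proof -
  let ?h = "hist eps (j + int n) \<omega>"
  have sq: "x\<^sup>2 \<le> p\<^sup>2 + m\<^sup>2" if "x \<le> p" "- x \<le> m" for x p m :: real
  proof (cases "x \<ge> 0")
    case True
    then have "x\<^sup>2 \<le> p\<^sup>2" using that by (intro power_mono) auto
    then show ?thesis by (simp add: add_increasing2)
  next
    case False
    then have "(-x)\<^sup>2 \<le> m\<^sup>2" using that by (intro power_mono) auto
    then show ?thesis by (simp add: add_increasing)
  qed
  show ?thesis
    unfolding cmax_def cmod_power2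
    using psum_le_pmax[OF assms, of "\<lambda>h. Re (u h)" eps j \<omega>] psum_le_pmax[OF assms, of "\<lambda>h. - Re (u h)" eps j \<omega>]
      psum_le_pmax[OF assms, of "\<lambda>h. Im (u h)" eps j \<omega>] psum_le_pmax[OF assms, of "\<lambda>h. - Im (u h)" eps j \<omega>]
    by (intro add_mono sq) (auto simp: psum_uminus psum_Re psum_Im)
qed

text \<open>Cauchy-Schwarz with free weights, so that the number of lags does not appear as a factor
  when their martingales are added.\<close>

lemma sum_square_weighted:
  fixes x a :: "'i \<Rightarrow> real"
  assumes "finite I" "\<And>i. i \<in> I \<Longrightarrow> a i > 0"
  shows "(\<Sum>i\<in>I. x i)\<^sup>2 \<le> (\<Sum>i\<in>I. a i) * (\<Sum>i\<in>I. (x i)\<^sup>2 / a i)"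
proof -
  have "(\<Sum>i\<in>I. x i) = (\<Sum>i\<in>I. sqrt (a i) * (x i / sqrt (a i)))"
    using assms by (intro sum.cong) (force simp: less_imp_neq)+
  then have "(\<Sum>i\<in>I. x i)\<^sup>2 \<le> (\<Sum>i\<in>I. (sqrt (a i))\<^sup>2) * (\<Sum>i\<in>I. (x i / sqrt (a i))\<^sup>2)"
    by (simp only: Cauchy_Schwarz_ineq_sum)
  also have "(\<Sum>i\<in>I. (sqrt (a i))\<^sup>2) = (\<Sum>i\<in>I. a i)" using assms by (intro sum.cong) (auto simp: less_imp_le)
  also have "(\<Sum>i\<in>I. (x i / sqrt (a i))\<^sup>2) = (\<Sum>i\<in>I. (x i)\<^sup>2 / a i)"
    using assms by (intro sum.cong) (auto simp: power_divide less_imp_le)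
  finally show ?thesis .
qed

context innovations
begin

lemma bounded_rv_uminus: "bounded_rv f \<Longrightarrow> bounded_rv (\<lambda>h. - (f h :: 'b::euclidean_space))"
  by (rule bounded_rv_cont[of uminus]) (auto intro!: continuous_intros)

lemma bounded_rv_Re: "bounded_rv f \<Longrightarrow> bounded_rv (\<lambda>h. Re (f h))"
  by (rule bounded_rv_cont[of Re]) (auto intro!: continuous_intros)

lemma bounded_rv_Im: "bounded_rv f \<Longrightarrow> bounded_rv (\<lambda>h. Im (f h))"
  by (rule bounded_rv_cont[of Im]) (auto intro!: continuous_intros)

lemma bounded_rv_square: "bounded_rv f \<Longrightarrow> bounded_rv (\<lambda>h. (f h :: real)\<^sup>2)"
  unfolding power2_eq_square by (rule bounded_rv_mult)

lemma bounded_rv_cmax: assumes "bounded_rv u" shows "bounded_rv (cmax u n)"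
proof -
  have "bounded_rv (\<lambda>h. cmax u n h)" unfolding cmax_def
    by (intro bounded_rv_add bounded_rv_square bounded_rv_pmax bounded_rv_uminus bounded_rv_Re bounded_rv_Im assms)
  then show ?thesis by simp
qed

lemma integral_cmax_le:
  assumes u: "bounded_rv u" "\<And>h. cond_step u h = 0"
  shows "(\<integral>h. cmax u n h \<partial>S) \<le> 8 * real n * (\<integral>h. (cmod (u h))\<^sup>2 \<partial>S)"
proof -
  note b = bounded_rv_Re[OF u(1)] bounded_rv_Im[OF u(1)]
  note b' = bounded_rv_uminus[OF b(1)] bounded_rv_uminus[OF b(2)]
  have q: "cond_step (\<lambda>h. Re (u h)) h = 0" "cond_step (\<lambda>h. Im (u h)) h = 0" for h
    using u(2)[of h] bounded_rv_slice[OF u(1), of h] by (auto simp: cond_step_def complex_eq_iff)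
  then have q': "cond_step (\<lambda>h. - Re (u h)) h = 0" "cond_step (\<lambda>h. - Im (u h)) h = 0" for h
    using u(2)[of h] bounded_rv_slice[OF u(1), of h] by (auto simp: cond_step_def complex_eq_iff)
  note i = bounded_rv_integrable[OF bounded_rv_square[OF bounded_rv_pmax[OF b(1)]], of n] bounded_rv_integrable[OF bounded_rv_square[OF bounded_rv_pmax[OF b(2)]], of n]
    bounded_rv_integrable[OF bounded_rv_square[OF bounded_rv_pmax[OF b'(1)]], of n] bounded_rv_integrable[OF bounded_rv_square[OF bounded_rv_pmax[OF b'(2)]], of n]
  have "(\<integral>h. cmax u n h \<partial>S) = ((\<integral>h. (pmax (\<lambda>h. Re (u h)) n h)\<^sup>2 \<partial>S) + (\<integral>h. (pmax (\<lambda>h. - Re (u h)) n h)\<^sup>2 \<partial>S))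
     + ((\<integral>h. (pmax (\<lambda>h. Im (u h)) n h)\<^sup>2 \<partial>S) + (\<integral>h. (pmax (\<lambda>h. - Im (u h)) n h)\<^sup>2 \<partial>S))"
    unfolding cmax_def using i by simp
  also have "\<dots> \<le> (4 * real n * (\<integral>h. (Re (u h))\<^sup>2 \<partial>S) + 4 * real n * (\<integral>h. (- Re (u h))\<^sup>2 \<partial>S))
     + (4 * real n * (\<integral>h. (Im (u h))\<^sup>2 \<partial>S) + 4 * real n * (\<integral>h. (- Im (u h))\<^sup>2 \<partial>S))"
    by (intro add_mono doob_L2 b b' q q')
  also have "\<dots> = 8 * real n * ((\<integral>h. (Re (u h))\<^sup>2 \<partial>S) + (\<integral>h. (Im (u h))\<^sup>2 \<partial>S))" by (simp add: algebra_simps)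
  also have "(\<integral>h. (Re (u h))\<^sup>2 \<partial>S) + (\<integral>h. (Im (u h))\<^sup>2 \<partial>S) = (\<integral>h. (cmod (u h))\<^sup>2 \<partial>S)"
    unfolding cmod_power2 using bounded_rv_integrable[OF bounded_rv_square[OF b(1)]] bounded_rv_integrable[OF bounded_rv_square[OF b(2)]] by simp
  finally show ?thesis .
qed

end

section \<open>Conditional characteristic functions and their differences over one lag\<close>

context innovations_map
begin

definition cond_char :: "real \<Rightarrow> nat \<Rightarrow> (nat \<Rightarrow> real) \<Rightarrow> complex" where
  "cond_char \<theta> k = cond_iter k (\<lambda>h. cis (\<theta> * g h))"

definition mean_char :: "real \<Rightarrow> complex" where
  "mean_char \<theta> = (\<integral>h. cis (\<theta> * g h) \<partial>S)"

lemma cond_cf_eq_cond_char: "cond_cf \<mu> g k \<theta> h = cond_char \<theta> k h"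
  by (simp add: cond_cf_def cond_char_def cond_iter_def)

lemma bounded_rv_cis: "bounded_rv (\<lambda>h. cis (\<theta> * g h))"
  by (rule bounded_rvI[where C=1]) auto

lemma bounded_rv_cond_char: "bounded_rv (cond_char \<theta> k)"
  unfolding cond_char_def by (intro bounded_rv_cond_iter bounded_rv_cis)

lemma cond_char_Suc: "cond_char \<theta> (Suc k) = cond_step (cond_char \<theta> k)"
  unfolding cond_char_def by (rule cond_iter_Suc[OF bounded_rv_cis])

lemma cond_char_meas: "(\<lambda>(\<theta>, h). cond_char \<theta> k h) \<in> borel_measurable (borel \<Otimes>\<^sub>M S)"
proof -
  have [measurable]: "(\<lambda>x. extend_hist k (snd (fst x)) (snd x)) \<in> (borel \<Otimes>\<^sub>M S) \<Otimes>\<^sub>M S \<rightarrow>\<^sub>M S"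
    using measurable_compose[OF _ measurable_extend_hist, of "\<lambda>x. (snd (fst x), snd x)" "(borel \<Otimes>\<^sub>M S) \<Otimes>\<^sub>M S"] by simp
  show ?thesis unfolding cond_char_def cond_iter_def split_beta' by measurable
qed

lemma cond_char_measurable [measurable (raw)]:
  assumes "f \<in> borel_measurable N" "h \<in> N \<rightarrow>\<^sub>M S"
  shows "(\<lambda>x. cond_char (f x) k (h x)) \<in> borel_measurable N"
  using measurable_compose[OF measurable_Pair[OF assms] cond_char_meas] by simp

lemma mean_char_measurable [measurable]: "mean_char \<in> borel_measurable borel"
  unfolding mean_char_def by measurable

lemma cmod_cond_char_le: "cmod (cond_char \<theta> k h) \<le> 1"
proof -
  have "cmod (cond_char \<theta> k h) \<le> (\<integral>e. cmod (cis (\<theta> * g (extend_hist k h e))) \<partial>S)"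
    unfolding cond_char_def cond_iter_def by (rule integral_norm_bound)
  also have "\<dots> = 1" by (simp add: seq.P.prob_space[simplified])
  finally show ?thesis .
qed

lemma cmod_mean_char_le: "cmod (mean_char \<theta>) \<le> 1"
proof -
  have "cmod (mean_char \<theta>) \<le> (\<integral>h. cmod (cis (\<theta> * g h)) \<partial>S)"
    unfolding mean_char_def by (rule integral_norm_bound)
  also have "\<dots> = 1" by (simp add: seq.P.prob_space[simplified])
  finally show ?thesis .
qed

text \<open>The gain in predicting one and the same variable, l + 1 steps ahead of \<open>h\<close>,
  when the newest entry of \<open>h\<close> becomes known. The lags start at one because the
  compensator is already a one-step prediction.\<close>

definition lag_diff :: "real \<Rightarrow> nat \<Rightarrow> (nat \<Rightarrow> real) \<Rightarrow> complex" where
  "lag_diff \<theta> l h = cond_char \<theta> (Suc l) h - cond_char \<theta> (Suc (Suc l)) (htail h)"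

lemma bounded_rv_lag_diff: "bounded_rv (lag_diff \<theta> l)"
  unfolding lag_diff_def[abs_def] by (intro bounded_rv_diff bounded_rv_htail bounded_rv_cond_char)

lemma cond_step_lag_diff: "cond_step (lag_diff \<theta> l) h = 0"
proof -
  have "cond_step (lag_diff \<theta> l) h = cond_step (cond_char \<theta> (Suc l)) h - cond_char \<theta> (Suc (Suc l)) h"
    unfolding cond_step_def lag_diff_def using bounded_rv_slice[OF bounded_rv_cond_char, of \<theta> "Suc l" h] by (simp add: prob_UNIV)
  then show ?thesis by (simp add: cond_char_Suc)
qed

lemma jensen_square:
  fixes f :: "real \<Rightarrow> complex"
  assumes f: "integrable \<mu> f" "integrable \<mu> (\<lambda>x. (cmod (f x))\<^sup>2)"
  shows "(cmod (\<integral>x. f x \<partial>\<mu>))\<^sup>2 \<le> (\<integral>x. (cmod (f x))\<^sup>2 \<partial>\<mu>)"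
proof -
  let ?m = "\<integral>x. cmod (f x) \<partial>\<mu>"
  have "0 \<le> (\<integral>x. (cmod (f x) - ?m)\<^sup>2 \<partial>\<mu>)" by simp
  also have "\<dots> = (\<integral>x. (cmod (f x))\<^sup>2 - 2 * ?m * cmod (f x) + ?m\<^sup>2 \<partial>\<mu>)"
    by (simp add: power2_diff algebra_simps)
  also have "\<dots> = (\<integral>x. (cmod (f x))\<^sup>2 \<partial>\<mu>) - ?m\<^sup>2"
    using f by (simp add: prob_UNIV power2_eq_square)
  finally have "?m\<^sup>2 \<le> (\<integral>x. (cmod (f x))\<^sup>2 \<partial>\<mu>)" by simp
  moreover have "(cmod (\<integral>x. f x \<partial>\<mu>))\<^sup>2 \<le> ?m\<^sup>2" by (intro power_mono integral_norm_bound) auto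
  ultimately show ?thesis by linarith
qed

end

context causal_process
begin

definition coupling_sq :: "nat \<Rightarrow> real \<Rightarrow> real" where
  "coupling_sq k \<theta> = (\<integral>\<omega>. (cmod (cond_char \<theta> k (hist eps 0 \<omega>) - cond_char \<theta> k (hist0_star eps eps0' \<omega>)))\<^sup>2 \<partial>M)"

text \<open>The difference is the average, over a fresh innovation x, of the change in the
  conditional characteristic function when the newest entry is replaced by x. Jensen moves the
  square inside the average, and a fresh innovation together with a history has the law of
  \<open>eps0'\<close> together with xi_0.\<close>

lemma lag_diff_sq_le: "(\<integral>h. (cmod (lag_diff \<theta> l h))\<^sup>2 \<partial>S) \<le> coupling_sq (Suc l) \<theta>"
proof -
  let ?k = "Suc l"
  \<comment> \<open>The argument carries the fresh copy at position 0 and the actual history in its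
    tail; the second term swaps the copy in for the newest entry of that history.\<close>
  let ?f = "\<lambda>h. (cmod (cond_char \<theta> ?k (htail h) - cond_char \<theta> ?k (case_nat (h 0) (htail (htail h)))))\<^sup>2"
  have [measurable]: "(\<lambda>h. case_nat (h 0) (htail (htail h))) \<in> S \<rightarrow>\<^sub>M S"
  proof -
    have "(\<lambda>h. (h 0, htail (htail h))) \<in> S \<rightarrow>\<^sub>M \<mu> \<Otimes>\<^sub>M S" by measurable
    from measurable_compose[OF this case_nat_S] show ?thesis by simp
  qed
  have bf: "bounded_rv ?f"
  proof -
    have "bounded_rv (\<lambda>h. cond_char \<theta> ?k (case_nat (h 0) (htail (htail h))))"
      by (rule bounded_rvI[where C=1]) (use cmod_cond_char_le in auto)
    then show ?thesis by (intro bounded_rv_square bounded_rv_norm bounded_rv_diff bounded_rv_htail bounded_rv_cond_char)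
  qed
  have star: "hist0_star eps eps0' \<omega> = case_nat (eps0' \<omega>) (htail (hist eps 0 \<omega>))" for \<omega>
    by (auto simp: hist0_star_def hist_def htail_def fun_eq_iff split: nat.split)
  have "coupling_sq ?k \<theta> = (\<integral>\<omega>. ?f (case_nat (eps0' \<omega>) (hist eps 0 \<omega>)) \<partial>M)"
    by (simp add: coupling_sq_def star)
  also have "\<dots> = integral\<^sup>L (distr M S (\<lambda>\<omega>. case_nat (eps0' \<omega>) (hist eps 0 \<omega>))) ?f"
    using bounded_rv_meas[OF bf] by (subst integral_distr) auto
  also have "\<dots> = integral\<^sup>L S (cond_step ?f)" unfolding star_law by (rule integral_S[OF bf])
  finally have cd: "coupling_sq ?k \<theta> = integral\<^sup>L S (cond_step ?f)" .
  have "(\<integral>h. (cmod (lag_diff \<theta> l h))\<^sup>2 \<partial>S) \<le> integral\<^sup>L S (cond_step ?f)"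
  proof (rule integral_mono)
    show "integrable S (\<lambda>h. (cmod (lag_diff \<theta> l h))\<^sup>2)" by (intro bounded_rv_integrable bounded_rv_square bounded_rv_norm bounded_rv_lag_diff)
    show "integrable S (cond_step ?f)" by (intro bounded_rv_integrable bounded_rv_cond_step bf)
    fix h
    let ?d = "\<lambda>x. cond_char \<theta> ?k h - cond_char \<theta> ?k (case_nat x (htail h))"
    have i: "integrable \<mu> ?d" using bounded_rv_slice[OF bounded_rv_cond_char, of \<theta> ?k "htail h"] by simp
    have i2: "integrable \<mu> (\<lambda>x. (cmod (?d x))\<^sup>2)" using bounded_rv_slice[OF bf, of h] by simp
    have "lag_diff \<theta> l h = (\<integral>x. ?d x \<partial>\<mu>)"
      using bounded_rv_slice[OF bounded_rv_cond_char, of \<theta> ?k "htail h"]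
      unfolding lag_diff_def cond_char_Suc[of \<theta> ?k] cond_step_def by (simp add: prob_UNIV)
    then have "(cmod (lag_diff \<theta> l h))\<^sup>2 \<le> (\<integral>x. (cmod (?d x))\<^sup>2 \<partial>\<mu>)" using jensen_square[OF i i2] by simp
    also have "\<dots> = cond_step ?f h" by (simp add: cond_step_def)
    finally show "(cmod (lag_diff \<theta> l h))\<^sup>2 \<le> cond_step ?f h" .
  qed
  then show ?thesis using cd by simp
qed

lemma integral_hist: "bounded_rv f \<Longrightarrow> (\<integral>\<omega>. f (hist eps k \<omega>) \<partial>M) = integral\<^sup>L S f"
  using integral_distr[OF hist_meas[of k] bounded_rv_meas, of f] unfolding hist_law by simp

lemma bounded_rv_hist_integrable: "bounded_rv f \<Longrightarrow> integrable M (\<lambda>\<omega>. f (hist eps k \<omega>))"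
  using integrable_distr[OF hist_meas[of k], of f] bounded_rv_integrable[of f] unfolding hist_law by simp

definition char_sum :: "nat \<Rightarrow> real \<Rightarrow> 'a \<Rightarrow> complex" where
  "char_sum n \<theta> \<omega> = (\<Sum>i\<in>{1..n}. cond_char \<theta> 1 (hist eps (int i - 1) \<omega>) - mean_char \<theta>)"

text \<open>The maximum is taken before integrating over \<theta>, so that the weighted integral
  increases with n and can be compared with its value at the next power of two.\<close>

primrec char_max :: "nat \<Rightarrow> real \<Rightarrow> 'a \<Rightarrow> real" where
  "char_max 0 \<theta> \<omega> = 0"
| "char_max (Suc n) \<theta> \<omega> = max (char_max n \<theta> \<omega>) ((cmod (char_sum (Suc n) \<theta> \<omega>))\<^sup>2)"

lemma char_sum_measurable [measurable (raw)]:
  assumes [measurable]: "f \<in> borel_measurable N" "h \<in> N \<rightarrow>\<^sub>M M"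
  shows "(\<lambda>x. char_sum n (f x) (h x)) \<in> borel_measurable N"
  unfolding char_sum_def by measurable

lemma char_max_measurable [measurable (raw)]:
  assumes [measurable]: "f \<in> borel_measurable N" "h \<in> N \<rightarrow>\<^sub>M M"
  shows "(\<lambda>x. char_max n (f x) (h x)) \<in> borel_measurable N"
  by (induction n) auto

lemma char_max_nonneg: "0 \<le> char_max n \<theta> \<omega>"
  by (induction n) auto

lemma char_max_mono: "m \<le> n \<Longrightarrow> char_max m \<theta> \<omega> \<le> char_max n \<theta> \<omega>"
  by (rule lift_Suc_mono_le[of "\<lambda>n. char_max n \<theta> \<omega>"]) auto

lemma char_sum_le_char_max: "(cmod (char_sum n \<theta> \<omega>))\<^sup>2 \<le> char_max n \<theta> \<omega>"
  by (cases n) (auto simp: char_sum_def)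

lemma char_max_leI: "0 \<le> B \<Longrightarrow> (\<And>k. k \<le> n \<Longrightarrow> (cmod (char_sum k \<theta> \<omega>))\<^sup>2 \<le> B) \<Longrightarrow> char_max n \<theta> \<omega> \<le> B"
  by (induction n) auto

text \<open>Term i is expanded along the conditionings on xi_(i-1), xi_(i-2), and so on down to
  xi_(i-1-L). For a fixed lag the differences form a martingale in i; what remains predicts X_i from
  L + 1 steps back.\<close>

lemma char_sum_decomp:
  "char_sum k \<theta> \<omega> = (\<Sum>l<L. psum (lag_diff \<theta> l) k (hist eps (- 1 - int l + int k) \<omega>))
     + (\<Sum>i\<in>{1..k}. cond_char \<theta> (Suc L) (hist eps (int i - 1 - int L) \<omega>) - mean_char \<theta>)"
proof -
  have "(\<Sum>l<L. psum (lag_diff \<theta> l) k (hist eps (- 1 - int l + int k) \<omega>)) =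
    (\<Sum>l<L. \<Sum>i\<in>{1..k}. lag_diff \<theta> l (hist eps (- 1 - int l + int i) \<omega>))"
    by (simp only: psum_hist)
  also have "\<dots> = (\<Sum>i\<in>{1..k}. \<Sum>l<L. lag_diff \<theta> l (hist eps (- 1 - int l + int i) \<omega>))"
    by (rule sum.swap)
  also have "\<dots> = (\<Sum>i\<in>{1..k}. cond_char \<theta> 1 (hist eps (int i - 1) \<omega>) - cond_char \<theta> (Suc L) (hist eps (int i - 1 - int L) \<omega>))"
  proof (rule sum.cong[OF refl])
    fix i
    show "(\<Sum>l<L. lag_diff \<theta> l (hist eps (- 1 - int l + int i) \<omega>)) =
      cond_char \<theta> 1 (hist eps (int i - 1) \<omega>) - cond_char \<theta> (Suc L) (hist eps (int i - 1 - int L) \<omega>)"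
      by (induction L) (auto simp: lag_diff_def htail_hist algebra_simps)
  qed
  finally show ?thesis by (simp add: char_sum_def sum_subtractf)
qed

text \<open>The lag martingales are combined by Cauchy-Schwarz with weights \<open>a\<close>, and
  their maxima by \<open>integral_cmax_le\<close>; 16 is 8 times the 2 from splitting off the
  remainder. The remainder is bounded crudely by n^2 times a second moment, which tends to 0 as L
  grows while n and \<theta> are fixed.\<close>

lemma char_max_expectation_le:
  fixes a :: "nat \<Rightarrow> real"
  assumes a: "\<And>l. a l > 0" "summable a"
  shows "(\<integral>\<^sup>+\<omega>. ennreal (char_max n \<theta> \<omega>) \<partial>M) \<le> ennreal (16 * real n * suminf a) * (\<Sum>l. ennreal (coupling_sq (Suc l) \<theta> / a l))"
proof -
  define A where "A = suminf a"
  have A0: "A \<ge> 0" unfolding A_def using a by (intro suminf_nonneg) (auto simp: less_imp_le)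
  have cd0: "0 \<le> coupling_sq k \<theta>" for k unfolding coupling_sq_def by simp
  define R where "R L h = (cmod (cond_char \<theta> (Suc L) h - mean_char \<theta>))\<^sup>2" for L h
  have bR: "bounded_rv (R L)" for L unfolding R_def[abs_def] by (intro bounded_rv_square bounded_rv_norm bounded_rv_diff bounded_rv_cond_char bounded_rv_const)
  \<comment> \<open>For each truncation level L this is a majorant of the whole running maximum with
    computable expectation; k no longer occurs in it.\<close>
  define G where "G L \<omega> = 2 * (A * (\<Sum>l<L. cmax (lag_diff \<theta> l) n (hist eps (- 1 - int l + int n) \<omega>) / a l))
     + 2 * (n * (\<Sum>i\<in>{1..n}. R L (hist eps (int i - 1 - int L) \<omega>)))" for L \<omega>
  have le: "char_max n \<theta> \<omega> \<le> G L \<omega>" for L \<omega>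
  proof (rule char_max_leI)
    show "0 \<le> G L \<omega>" unfolding G_def R_def using A0 a
      by (intro add_nonneg_nonneg mult_nonneg_nonneg sum_nonneg divide_nonneg_nonneg cmax_nonneg) (auto simp: less_imp_le)
    fix k assume k: "k \<le> n"
    let ?T = "\<lambda>l. psum (lag_diff \<theta> l) k (hist eps (- 1 - int l + int k) \<omega>)"
    let ?r = "\<lambda>i. cond_char \<theta> (Suc L) (hist eps (int i - 1 - int L) \<omega>) - mean_char \<theta>"
    have n1: "(cmod (x + y))\<^sup>2 \<le> 2 * (cmod x)\<^sup>2 + 2 * (cmod y)\<^sup>2" for x y
    proof -
      have "(cmod (x + y))\<^sup>2 \<le> (cmod x + cmod y)\<^sup>2" by (intro power_mono norm_triangle_ineq) auto
      moreover have "0 \<le> (cmod x - cmod y)\<^sup>2" by simp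
      ultimately show ?thesis by (simp add: power2_eq_square algebra_simps)
    qed
    have "(cmod (\<Sum>l<L. ?T l))\<^sup>2 \<le> (\<Sum>l<L. cmod (?T l))\<^sup>2" by (intro power_mono norm_sum) auto
    also have "\<dots> \<le> (\<Sum>l<L. a l) * (\<Sum>l<L. (cmod (?T l))\<^sup>2 / a l)" using a by (intro sum_square_weighted) auto
    also have "\<dots> \<le> A * (\<Sum>l<L. cmax (lag_diff \<theta> l) n (hist eps (- 1 - int l + int n) \<omega>) / a l)"
      using a A0 unfolding A_def
      by (intro mult_mono sum_mono divide_right_mono psum_le_cmax[OF k] sum_le_suminf sum_nonneg) (auto simp: less_imp_le)
    finally have 1: "(cmod (\<Sum>l<L. ?T l))\<^sup>2 \<le> A * (\<Sum>l<L. cmax (lag_diff \<theta> l) n (hist eps (- 1 - int l + int n) \<omega>) / a l)" .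
    have "(cmod (\<Sum>i\<in>{1..k}. ?r i))\<^sup>2 \<le> (\<Sum>i\<in>{1..k}. cmod (?r i))\<^sup>2" by (intro power_mono norm_sum) auto
    also have "\<dots> \<le> (\<Sum>i\<in>{1..k}. 1) * (\<Sum>i\<in>{1..k}. (cmod (?r i))\<^sup>2 / 1)" by (intro sum_square_weighted) auto
    also have "\<dots> \<le> n * (\<Sum>i\<in>{1..n}. R L (hist eps (int i - 1 - int L) \<omega>))"
      unfolding R_def using k by (intro mult_mono) (auto intro!: sum_mono2 sum_nonneg)
    finally have 2: "(cmod (\<Sum>i\<in>{1..k}. ?r i))\<^sup>2 \<le> n * (\<Sum>i\<in>{1..n}. R L (hist eps (int i - 1 - int L) \<omega>))" .
    show "(cmod (char_sum k \<theta> \<omega>))\<^sup>2 \<le> G L \<omega>"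
      unfolding char_sum_decomp[of k \<theta> \<omega> L] G_def using n1[of "\<Sum>l<L. ?T l" "\<Sum>i\<in>{1..k}. ?r i"] 1 2 by linarith
  qed
  have G0: "0 \<le> G L \<omega>" for L \<omega> using le[of \<omega> L] char_max_nonneg[of n \<theta> \<omega>] by linarith
  have G_int: "integrable M (G L)" and G_eq: "integral\<^sup>L M (G L) =
      2 * (A * (\<Sum>l<L. integral\<^sup>L S (cmax (lag_diff \<theta> l) n) / a l)) + 2 * (n * (n * integral\<^sup>L S (R L)))" for L
  proof -
    have i1: "integrable M (\<lambda>\<omega>. cmax (lag_diff \<theta> l) n (hist eps k \<omega>))" for l k
      by (intro bounded_rv_hist_integrable bounded_rv_cmax bounded_rv_lag_diff)
    have i2: "integrable M (\<lambda>\<omega>. R L (hist eps k \<omega>))" for k by (intro bounded_rv_hist_integrable bR)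
    show "integrable M (G L)" unfolding G_def[abs_def] using i1 i2 by auto
    show "integral\<^sup>L M (G L) =
      2 * (A * (\<Sum>l<L. integral\<^sup>L S (cmax (lag_diff \<theta> l) n) / a l)) + 2 * (n * (n * integral\<^sup>L S (R L)))"
      unfolding G_def[abs_def] using i1 i2 by (simp add: integral_hist bR bounded_rv_cmax bounded_rv_lag_diff)
  qed
  have bound: "(\<integral>\<^sup>+\<omega>. ennreal (char_max n \<theta> \<omega>) \<partial>M) \<le>
     ennreal (16 * real n * A) * (\<Sum>l. ennreal (coupling_sq (Suc l) \<theta> / a l)) + ennreal (2 * (n * (n * integral\<^sup>L S (R L))))" for L
  proof -
    have "(\<integral>\<^sup>+\<omega>. ennreal (char_max n \<theta> \<omega>) \<partial>M) \<le> (\<integral>\<^sup>+\<omega>. ennreal (G L \<omega>) \<partial>M)"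
      by (intro nn_integral_mono ennreal_leI le)
    also have "\<dots> = ennreal (integral\<^sup>L M (G L))" using G_int G0 by (intro nn_integral_eq_integral) auto
    also have "\<dots> \<le> ennreal (16 * real n * A * (\<Sum>l<L. coupling_sq (Suc l) \<theta> / a l) + 2 * (n * (n * integral\<^sup>L S (R L))))"
    proof (rule ennreal_leI)
      have "(\<Sum>l<L. integral\<^sup>L S (cmax (lag_diff \<theta> l) n) / a l) \<le> (\<Sum>l<L. 8 * real n * coupling_sq (Suc l) \<theta> / a l)"
      proof (intro sum_mono divide_right_mono)
        fix l
        have "integral\<^sup>L S (cmax (lag_diff \<theta> l) n) \<le> 8 * real n * (\<integral>h. (cmod (lag_diff \<theta> l h))\<^sup>2 \<partial>S)"
          by (intro integral_cmax_le bounded_rv_lag_diff cond_step_lag_diff)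
        also have "\<dots> \<le> 8 * real n * coupling_sq (Suc l) \<theta>" by (intro mult_left_mono lag_diff_sq_le) auto
        finally show "integral\<^sup>L S (cmax (lag_diff \<theta> l) n) \<le> 8 * real n * coupling_sq (Suc l) \<theta>" .
      qed (use a in \<open>auto simp: less_imp_le\<close>)
      also have "\<dots> = 8 * real n * (\<Sum>l<L. coupling_sq (Suc l) \<theta> / a l)" by (simp add: sum_distrib_left)
      finally have "A * (\<Sum>l<L. integral\<^sup>L S (cmax (lag_diff \<theta> l) n) / a l) \<le> A * (8 * real n * (\<Sum>l<L. coupling_sq (Suc l) \<theta> / a l))"
        using A0 by (rule mult_left_mono)
      then show "integral\<^sup>L M (G L) \<le> 16 * real n * A * (\<Sum>l<L. coupling_sq (Suc l) \<theta> / a l) + 2 * (n * (n * integral\<^sup>L S (R L)))"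
        unfolding G_eq by (simp add: algebra_simps)
    qed
    also have "\<dots> = ennreal (16 * real n * A) * ennreal (\<Sum>l<L. coupling_sq (Suc l) \<theta> / a l) + ennreal (2 * (n * (n * integral\<^sup>L S (R L))))"
    proof -
      have "0 \<le> (\<Sum>l<L. coupling_sq (Suc l) \<theta> / a l)" using a cd0 by (intro sum_nonneg divide_nonneg_nonneg) (auto simp: less_imp_le)
      moreover have "0 \<le> integral\<^sup>L S (R L)" by (simp add: R_def)
      ultimately show ?thesis using A0 by (simp add: ennreal_plus ennreal_mult)
    qed
    also have "ennreal (\<Sum>l<L. coupling_sq (Suc l) \<theta> / a l) = (\<Sum>l<L. ennreal (coupling_sq (Suc l) \<theta> / a l))"
      using a cd0 by (intro sum_ennreal[symmetric] divide_nonneg_nonneg) (auto simp: less_imp_le)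
    also have "ennreal (16 * real n * A) * (\<Sum>l<L. ennreal (coupling_sq (Suc l) \<theta> / a l)) \<le> ennreal (16 * real n * A) * (\<Sum>l. ennreal (coupling_sq (Suc l) \<theta> / a l))"
      by (intro mult_left_mono sum_le_suminf) auto
    finally show ?thesis by (simp add: add_right_mono)
  qed
  \<comment> \<open>Both characteristic functions have modulus at most 1, so the square is at most
    twice the modulus and L^1 convergence suffices.\<close>
  have "(\<lambda>L. integral\<^sup>L S (R L)) \<longlonglongrightarrow> 0"
  proof (rule Lim_null_comparison)
    have "(\<lambda>k. \<integral>h. cmod (cond_char \<theta> k h - mean_char \<theta>) \<partial>S) \<longlonglongrightarrow> 0"
      using forgets_bounded_rv[OF bounded_rv_cis] unfolding forgets_def cond_char_def mean_char_def .
    then have "(\<lambda>L. 2 * (\<integral>h. cmod (cond_char \<theta> (Suc L) h - mean_char \<theta>) \<partial>S)) \<longlonglongrightarrow> 2 * 0"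
      by (intro tendsto_mult_left LIMSEQ_Suc)
    then show "(\<lambda>L. 2 * (\<integral>h. cmod (cond_char \<theta> (Suc L) h - mean_char \<theta>) \<partial>S)) \<longlonglongrightarrow> 0" by simp
    have "norm (integral\<^sup>L S (R L)) \<le> 2 * (\<integral>h. cmod (cond_char \<theta> (Suc L) h - mean_char \<theta>) \<partial>S)" for L
    proof -
      have "integral\<^sup>L S (R L) \<le> (\<integral>h. 2 * cmod (cond_char \<theta> (Suc L) h - mean_char \<theta>) \<partial>S)"
      proof (rule integral_mono)
        show "integrable S (R L)" by (intro bounded_rv_integrable bR)
        show "integrable S (\<lambda>h. 2 * cmod (cond_char \<theta> (Suc L) h - mean_char \<theta>))"
          by (intro bounded_rv_integrable bounded_rv_mult[OF bounded_rv_const] bounded_rv_norm bounded_rv_diff bounded_rv_cond_char bounded_rv_const)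
        fix h
        have "cmod (cond_char \<theta> (Suc L) h - mean_char \<theta>) \<le> 2"
          using norm_triangle_ineq4[of "cond_char \<theta> (Suc L) h" "mean_char \<theta>"] cmod_cond_char_le[of \<theta> "Suc L" h] cmod_mean_char_le[of \<theta>] by linarith
        then show "R L h \<le> 2 * cmod (cond_char \<theta> (Suc L) h - mean_char \<theta>)"
          unfolding R_def power2_eq_square by (intro mult_right_mono) auto
      qed
      moreover have "0 \<le> integral\<^sup>L S (R L)" by (simp add: R_def)
      ultimately show ?thesis by simp
    qed
    then show "\<forall>\<^sub>F L in sequentially. norm (integral\<^sup>L S (R L)) \<le> 2 * (\<integral>h. cmod (cond_char \<theta> (Suc L) h - mean_char \<theta>) \<partial>S)" by simp
  qed
  then have "(\<lambda>L. 2 * (n * (n * integral\<^sup>L S (R L)))) \<longlonglongrightarrow> 2 * (real n * (real n * 0))" by (intro tendsto_intros)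
  then have "(\<lambda>L. ennreal (2 * (n * (n * integral\<^sup>L S (R L))))) \<longlonglongrightarrow> ennreal 0" by (intro tendsto_ennrealI) simp
  then have "(\<lambda>L. ennreal (16 * real n * A) * (\<Sum>l. ennreal (coupling_sq (Suc l) \<theta> / a l)) + ennreal (2 * (n * (n * integral\<^sup>L S (R L)))))
     \<longlonglongrightarrow> ennreal (16 * real n * A) * (\<Sum>l. ennreal (coupling_sq (Suc l) \<theta> / a l)) + ennreal 0" by (intro tendsto_add tendsto_const)
  then have "(\<integral>\<^sup>+\<omega>. ennreal (char_max n \<theta> \<omega>) \<partial>M) \<le> ennreal (16 * real n * A) * (\<Sum>l. ennreal (coupling_sq (Suc l) \<theta> / a l)) + ennreal 0"
    by (rule LIMSEQ_le_const) (use bound in blast)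
  then show ?thesis by (simp add: A_def)
qed

text \<open>Extended values are used because finiteness is obtained only almost surely, from the
  bound on the expectation.\<close>

definition Wstar :: "nat \<Rightarrow> 'a \<Rightarrow> ennreal" where
  "Wstar n \<omega> = (\<integral>\<^sup>+\<theta>. ennreal ((1 + \<theta>\<^sup>2) * char_max n \<theta> \<omega>) \<partial>lborel)"

lemma Wstar_measurable [measurable]: "Wstar n \<in> borel_measurable M"
  unfolding Wstar_def by measurable

lemma Wstar_mono: "m \<le> n \<Longrightarrow> Wstar m \<omega> \<le> Wstar n \<omega>"
  unfolding Wstar_def by (intro nn_integral_mono ennreal_leI mult_left_mono char_max_mono) auto

lemma hist0_star_measurable [measurable]: "hist0_star eps eps0' \<in> M \<rightarrow>\<^sub>M S"
proof -
  have star: "hist0_star eps eps0' \<omega> = (\<lambda>h. case_nat (h 0) (htail (htail h))) (case_nat (eps0' \<omega>) (hist eps 0 \<omega>))" for \<omega>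
    by (auto simp: hist0_star_def hist_def htail_def fun_eq_iff split: nat.split)
  have "(\<lambda>h. (h 0, htail (htail h))) \<in> S \<rightarrow>\<^sub>M \<mu> \<Otimes>\<^sub>M S" by measurable
  from measurable_compose[OF this case_nat_S] have "(\<lambda>h. case_nat (h 0) (htail (htail h))) \<in> S \<rightarrow>\<^sub>M S" by simp
  from measurable_compose[OF star_meas this] show ?thesis unfolding star[abs_def] by simp
qed

lemma coupling_sq_measurable [measurable]: "coupling_sq k \<in> borel_measurable borel"
  unfolding coupling_sq_def by measurable

text \<open>The weights \<open>a\<close> do not depend on \<theta>, so integrating the pointwise
  bound by Tonelli leaves the series of (D l)^2 / a l, which is dominated by the series of the
  hypothesis.\<close>

lemma Wstar_expectation_le:
  assumes fin: "\<And>k. k \<ge> 1 \<Longrightarrow> (\<integral>\<^sup>+\<theta>. ennreal ((1 + \<theta>\<^sup>2) * coupling_sq k \<theta>) \<partial>lborel) < \<infinity>"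
    and sum: "summable (\<lambda>k. sqrt (enn2real (\<integral>\<^sup>+\<theta>. ennreal ((1 + \<theta>\<^sup>2) * coupling_sq (Suc k) \<theta>) \<partial>lborel)))"
  shows "\<exists>C\<ge>0. \<forall>n. (\<integral>\<^sup>+\<omega>. Wstar n \<omega> \<partial>M) \<le> ennreal (C * real n)"
proof -
  define I where "I l = (\<integral>\<^sup>+\<theta>. ennreal ((1 + \<theta>\<^sup>2) * coupling_sq (Suc l) \<theta>) \<partial>lborel)" for l
  define D where "D l = sqrt (enn2real (I l))" for l
  \<comment> \<open>The natural weight is \<open>D l\<close>; the geometric summand keeps it
    positive where \<open>D l\<close> vanishes and does not spoil summability. The choice gives (D
    l)^2 / a l <= D l.\<close>
  define a where "a l = D l + (1/2) ^ l" for l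
  have D0: "D l \<ge> 0" for l by (simp add: D_def)
  \<comment> \<open>Finiteness of each integral matters here: \<open>enn2real\<close> sends infinity
    to 0, so summability alone would not exclude an infinite term.\<close>
  have I: "I l = ennreal ((D l)\<^sup>2)" for l
    using fin[of "Suc l"] by (simp add: I_def D_def ennreal_enn2real less_top)
  have sD: "summable D" using sum by (simp add: D_def[abs_def] I_def)
  have a0: "a l > 0" for l using D0[of l] by (simp add: a_def add_nonneg_pos)
  have sa: "summable a" unfolding a_def[abs_def] using sD by (intro summable_add summable_geometric) auto
  have A0: "suminf a \<ge> 0" using a0 sa by (intro suminf_nonneg) (auto simp: less_imp_le)
  have cd0: "0 \<le> coupling_sq k \<theta>" for k \<theta> unfolding coupling_sq_def by simp
  interpret pair_sigma_finite M lborel by unfold_locales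
  have "(\<integral>\<^sup>+\<omega>. Wstar n \<omega> \<partial>M) \<le> ennreal (16 * suminf a * suminf D * real n)" for n
  proof -
    have "(\<integral>\<^sup>+\<omega>. Wstar n \<omega> \<partial>M) = (\<integral>\<^sup>+\<theta>. \<integral>\<^sup>+\<omega>. ennreal ((1 + \<theta>\<^sup>2) * char_max n \<theta> \<omega>) \<partial>M \<partial>lborel)"
      unfolding Wstar_def by (rule Fubini'[symmetric]) measurable
    also have "\<dots> = (\<integral>\<^sup>+\<theta>. ennreal (1 + \<theta>\<^sup>2) * (\<integral>\<^sup>+\<omega>. ennreal (char_max n \<theta> \<omega>) \<partial>M) \<partial>lborel)"
      by (intro nn_integral_cong) (simp add: ennreal_mult char_max_nonneg nn_integral_cmult)
    also have "\<dots> \<le> (\<integral>\<^sup>+\<theta>. ennreal (1 + \<theta>\<^sup>2) * (ennreal (16 * real n * suminf a) * (\<Sum>l. ennreal (coupling_sq (Suc l) \<theta> / a l))) \<partial>lborel)"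
      by (intro nn_integral_mono mult_left_mono char_max_expectation_le a0 sa) auto
    also have "\<dots> = (\<integral>\<^sup>+\<theta>. ennreal (16 * real n * suminf a) * (\<Sum>l. ennreal (1 / a l) * ennreal ((1 + \<theta>\<^sup>2) * coupling_sq (Suc l) \<theta>)) \<partial>lborel)"
    proof (rule nn_integral_cong)
      fix \<theta>
      have "ennreal (1 + \<theta>\<^sup>2) * (\<Sum>l. ennreal (coupling_sq (Suc l) \<theta> / a l)) = (\<Sum>l. ennreal (1 + \<theta>\<^sup>2) * ennreal (coupling_sq (Suc l) \<theta> / a l))"
        by (rule ennreal_suminf_cmult[symmetric])
      also have "\<dots> = (\<Sum>l. ennreal (1 / a l) * ennreal ((1 + \<theta>\<^sup>2) * coupling_sq (Suc l) \<theta>))"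
      proof (rule suminf_cong)
        fix l
        have "ennreal (1 + \<theta>\<^sup>2) * ennreal (coupling_sq (Suc l) \<theta> / a l) = ennreal ((1 + \<theta>\<^sup>2) * (coupling_sq (Suc l) \<theta> / a l))"
          using a0[of l] cd0 by (intro ennreal_mult[symmetric]) (auto simp: less_imp_le)
        also have "(1 + \<theta>\<^sup>2) * (coupling_sq (Suc l) \<theta> / a l) = 1 / a l * ((1 + \<theta>\<^sup>2) * coupling_sq (Suc l) \<theta>)" by simp
        also have "ennreal \<dots> = ennreal (1 / a l) * ennreal ((1 + \<theta>\<^sup>2) * coupling_sq (Suc l) \<theta>)"
          using a0[of l] cd0 by (intro ennreal_mult) (auto simp: less_imp_le)
        finally show "ennreal (1 + \<theta>\<^sup>2) * ennreal (coupling_sq (Suc l) \<theta> / a l) =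
          ennreal (1 / a l) * ennreal ((1 + \<theta>\<^sup>2) * coupling_sq (Suc l) \<theta>)" .
      qed
      finally show "ennreal (1 + \<theta>\<^sup>2) * (ennreal (16 * real n * suminf a) * (\<Sum>l. ennreal (coupling_sq (Suc l) \<theta> / a l))) =
        ennreal (16 * real n * suminf a) * (\<Sum>l. ennreal (1 / a l) * ennreal ((1 + \<theta>\<^sup>2) * coupling_sq (Suc l) \<theta>))"
        by (subst mult.left_commute) (simp only:)
    qed
    also have "\<dots> = ennreal (16 * real n * suminf a) * (\<Sum>l. ennreal (1 / a l) * I l)"
      unfolding I_def by (simp add: nn_integral_cmult nn_integral_suminf)
    also have "\<dots> \<le> ennreal (16 * real n * suminf a) * (\<Sum>l. ennreal (D l))"
    proof (intro mult_left_mono suminf_le)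
      fix l
      have "1 / a l * (D l)\<^sup>2 \<le> D l"
        using a0[of l] D0[of l] by (simp add: a_def field_simps power2_eq_square)
      then show "ennreal (1 / a l) * I l \<le> ennreal (D l)"
        unfolding I using a0[of l] by (simp add: ennreal_mult[symmetric] less_imp_le ennreal_leI)
    qed auto
    also have "(\<Sum>l. ennreal (D l)) = ennreal (suminf D)" using D0 sD by (intro suminf_ennreal2) auto
    also have "ennreal (16 * real n * suminf a) * ennreal (suminf D) = ennreal (16 * suminf a * suminf D * real n)"
      using A0 suminf_nonneg[OF sD] D0 by (simp add: ennreal_mult[symmetric] mult_ac)
    finally show ?thesis .
  qed
  moreover have "16 * suminf a * suminf D \<ge> 0" using A0 suminf_nonneg[OF sD] D0 by simp
  ultimately show ?thesis by blast
qed

end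

section \<open>Almost sure rate along dyadic blocks\<close>

text \<open>Cauchy condensation: the condensed terms are at most 1 / (n ln 2)^2.\<close>

lemma summable_inverse_ln_sq: "summable (\<lambda>j::nat. 1 / (real j * (ln (real j))\<^sup>2))"
proof -
  \<comment> \<open>At \<open>m = 0\<close> the logarithm vanishes and division by zero gives the
    value 0, so \<open>f\<close> decreases only from \<open>m = 1\<close> on, which is all that
    condensation asks.\<close>
  define f where "f m = 1 / (real (Suc m) * (ln (real (Suc m)))\<^sup>2)" for m :: nat
  have "summable f \<longleftrightarrow> summable (\<lambda>n. 2 ^ n * f (2 ^ n))"
  proof (rule condensation_test)
    fix m :: nat assume m: "0 < m"
    have "ln (real (Suc m)) > 0" using m by simp
    then have "0 < real (Suc m) * (ln (real (Suc m)))\<^sup>2" by simp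
    moreover have "real (Suc m) * (ln (real (Suc m)))\<^sup>2 \<le> real (Suc (Suc m)) * (ln (real (Suc (Suc m))))\<^sup>2"
      using m by (intro mult_mono power_mono) auto
    ultimately show "f (Suc m) \<le> f m" unfolding f_def by (intro frac_le) auto
  qed (simp add: f_def)
  moreover have "summable (\<lambda>n. 2 ^ n * f (2 ^ n))"
  proof (rule summable_comparison_test')
    show "summable (\<lambda>n. 1 / (ln 2)\<^sup>2 * (1 / (real n)\<^sup>2))"
      using inverse_power_summable[of 2, where 'a=real] by (intro summable_mult) (simp add: inverse_eq_divide)
    fix n :: nat assume n: "n \<ge> 1"
    have l: "real n * ln 2 \<le> ln (real (Suc (2 ^ n)))"
    proof -
      have "real n * ln 2 = ln (2 ^ n)" by (simp add: ln_realpow)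
      also have "\<dots> \<le> ln (real (Suc (2 ^ n)))" by (subst ln_le_cancel_iff) (simp_all add: add_pos_pos)
      finally show ?thesis .
    qed
    have "2 ^ n * f (2 ^ n) = (2 ^ n / real (Suc (2 ^ n))) * (1 / (ln (real (Suc (2 ^ n))))\<^sup>2)" by (simp add: f_def)
    also have "\<dots> \<le> 1 * (1 / (real n * ln 2)\<^sup>2)"
    proof (intro mult_mono)
      show "2 ^ n / real (Suc (2 ^ n)) \<le> 1" by (simp add: divide_le_eq_1 add_pos_pos)
      have "0 < real n * ln 2" using n by simp
      then show "1 / (ln (real (Suc (2 ^ n))))\<^sup>2 \<le> 1 / (real n * ln 2)\<^sup>2"
        using l n by (intro frac_le power_mono) auto
    qed auto
    also have "\<dots> = 1 / (ln 2)\<^sup>2 * (1 / (real n)\<^sup>2)" by (simp add: power_mult_distrib)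
    finally show "norm (2 ^ n * f (2 ^ n)) \<le> 1 / (ln 2)\<^sup>2 * (1 / (real n)\<^sup>2)" by (simp add: f_def)
  qed
  ultimately have "summable f" by simp
  then show ?thesis unfolding f_def by (subst summable_Suc_iff[symmetric])
qed

lemma ln_nat_gt_1: "n \<ge> 3 \<Longrightarrow> 1 < ln (real n)"
  using ln3_gt_1 ln_le_cancel_iff[of 3 "real n"] by (simp del: ln_le_cancel_iff)

lemma iota_pos: "n \<ge> 3 \<Longrightarrow> 0 < iota n"
  using ln_nat_gt_1[of n] by (simp add: iota_def)

lemma iota_mono: "3 \<le> m \<Longrightarrow> m \<le> n \<Longrightarrow> iota m \<le> iota n"
  unfolding iota_def using ln_nat_gt_1[of m] ln_nat_gt_1[of n]
  by (intro mult_mono) auto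

text \<open>The square of iota at 2^j is j ln 2 (ln (j ln 2))^2. From j = 4 on j ln 2 >= sqrt j, so
  the inner logarithm is at least half of ln j. The iterated logarithm in \<open>iota\<close> is
  what makes this series converge.\<close>

lemma summable_iota_dyadic: "summable (\<lambda>j. 1 / (iota (2 ^ j))\<^sup>2)"
proof (rule summable_comparison_test')
  show "summable (\<lambda>j::nat. 4 / ln 2 * (1 / (real j * (ln (real j))\<^sup>2)))"
    by (intro summable_mult summable_inverse_ln_sq)
  fix j :: nat assume j: "j \<ge> 4"
  have l2: "1 / 2 \<le> ln (2::real)" using ln_2_less_1 ln2_ge_two_thirds by simp
  have lnj: "0 < ln (real j)" using j by simp
  have "sqrt (real j) = real j / sqrt (real j)" using j by (simp add: real_div_sqrt)
  also have "\<dots> \<le> real j / 2"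
  proof -
    have "2 \<le> sqrt (real j)" using j real_le_rsqrt[of 2 "real j"] by simp
    then show ?thesis using j by (intro divide_left_mono) auto
  qed
  also have "\<dots> \<le> real j * ln 2" using l2 j mult_left_mono[OF l2, of "real j"] by simp
  finally have s: "sqrt (real j) \<le> real j * ln 2" .
  have "ln (real j) / 2 = ln (sqrt (real j))" using j by (simp add: ln_sqrt)
  also have "\<dots> \<le> ln (real j * ln 2)" using s j by (subst ln_le_cancel_iff) auto
  finally have l: "ln (real j) / 2 \<le> ln (real j * ln 2)" .
  have eq: "(iota (2 ^ j))\<^sup>2 = real j * ln 2 * (ln (real j * ln 2))\<^sup>2"
    by (simp add: iota_def ln_realpow power_mult_distrib)
  have "real j * ln 2 * (ln (real j) / 2)\<^sup>2 \<le> (iota (2 ^ j))\<^sup>2"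
    unfolding eq using l lnj by (intro mult_left_mono power_mono) auto
  moreover have "0 < real j * ln 2 * (ln (real j) / 2)\<^sup>2" using lnj j by simp
  ultimately have "1 / (iota (2 ^ j))\<^sup>2 \<le> 1 / (real j * ln 2 * (ln (real j) / 2)\<^sup>2)"
    by (intro frac_le) auto
  also have "\<dots> = 4 / ln 2 * (1 / (real j * (ln (real j))\<^sup>2))" by (simp add: power_divide)
  finally show "norm (1 / (iota (2 ^ j))\<^sup>2) \<le> 4 / ln 2 * (1 / (real j * (ln (real j))\<^sup>2))" by simp
qed

text \<open>The series of V (2^(j+1)) / (2^j iota(2^j)^2) has finite expectation, hence converges
  almost surely and its terms tend to 0. For n between 2^j and 2^(j+1), V is replaced by its value
  at the upper end and the normalisation by its value at the lower end; the mismatch costs a factor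
  2 in the expectation.\<close>

lemma dyadic_null:
  fixes V :: "nat \<Rightarrow> 'a \<Rightarrow> ennreal"
  assumes [measurable]: "\<And>n. V n \<in> borel_measurable M"
    and mono: "\<And>m n \<omega>. m \<le> n \<Longrightarrow> V m \<omega> \<le> V n \<omega>"
    and C: "C \<ge> 0" "\<And>n. (\<integral>\<^sup>+\<omega>. V n \<omega> \<partial>M) \<le> ennreal (C * real n)"
  shows "AE \<omega> in M. (\<forall>n. V n \<omega> < \<infinity>) \<and> (\<lambda>n. enn2real (V n \<omega>) / (real n * (iota n)\<^sup>2)) \<longlonglongrightarrow> 0"
proof -
  define c where "c j = (1 / 2 ^ j) * (1 / (iota (2 ^ j))\<^sup>2)" for j :: nat
  have c0: "c j \<ge> 0" for j by (simp add: c_def)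
  define Z where "Z \<omega> = (\<Sum>j. ennreal (c j) * V (2 ^ Suc j) \<omega>)" for \<omega>
  have "(\<integral>\<^sup>+\<omega>. Z \<omega> \<partial>M) = (\<Sum>j. ennreal (c j) * (\<integral>\<^sup>+\<omega>. V (2 ^ Suc j) \<omega> \<partial>M))"
    unfolding Z_def by (simp add: nn_integral_suminf nn_integral_cmult)
  also have "\<dots> \<le> (\<Sum>j. ennreal (2 * C * (1 / (iota (2 ^ j))\<^sup>2)))"
  proof (intro suminf_le)
    fix j
    have "ennreal (c j) * (\<integral>\<^sup>+\<omega>. V (2 ^ Suc j) \<omega> \<partial>M) \<le> ennreal (c j) * ennreal (C * real (2 ^ Suc j))"
      by (intro mult_left_mono C) auto
    also have "\<dots> = ennreal (c j * (C * real (2 ^ Suc j)))" using c0 C by (simp add: ennreal_mult)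
    also have "c j * (C * real (2 ^ Suc j)) = 2 * C * (1 / (iota (2 ^ j))\<^sup>2)" by (simp add: c_def)
    finally show "ennreal (c j) * (\<integral>\<^sup>+\<omega>. V (2 ^ Suc j) \<omega> \<partial>M) \<le> ennreal (2 * C * (1 / (iota (2 ^ j))\<^sup>2))" .
  qed auto
  also have "\<dots> = ennreal (\<Sum>j. 2 * C * (1 / (iota (2 ^ j))\<^sup>2))"
    using C summable_iota_dyadic by (intro suminf_ennreal2 summable_mult) auto
  finally have "(\<integral>\<^sup>+\<omega>. Z \<omega> \<partial>M) < \<infinity>" by (rule le_less_trans) simp
  moreover have [measurable]: "Z \<in> borel_measurable M" unfolding Z_def by measurable
  ultimately have aeZ: "AE \<omega> in M. Z \<omega> \<noteq> \<infinity>" by (intro nn_integral_PInf_AE) auto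
  have "AE \<omega> in M. V n \<omega> \<noteq> \<infinity>" for n
    using C(2)[of n] by (intro nn_integral_PInf_AE) (auto simp: top_unique)
  then have aeV: "AE \<omega> in M. \<forall>n. V n \<omega> \<noteq> \<infinity>" by (simp add: AE_all_countable)
  show ?thesis using aeZ aeV
  proof eventually_elim
    case (elim \<omega>)
    let ?v = "\<lambda>n. enn2real (V n \<omega>)"
    have V: "V n \<omega> = ennreal (?v n)" for n using elim by (simp add: ennreal_enn2real less_top)
    have "Z \<omega> = (\<Sum>j. ennreal (c j * ?v (2 ^ Suc j)))"
      unfolding Z_def using V c0 by (simp add: ennreal_mult)
    then have "summable (\<lambda>j. c j * ?v (2 ^ Suc j))"
      using elim c0 by (intro summable_suminf_not_top) auto
    then have lim0: "(\<lambda>j. c j * ?v (2 ^ Suc j)) \<longlonglongrightarrow> 0" by (rule summable_LIMSEQ_zero)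
    have fl: "filterlim floor_log at_top at_top"
    proof (rule filterlim_at_top[THEN iffD2], rule allI)
      fix J :: nat
      show "eventually (\<lambda>n. J \<le> floor_log n) at_top"
        using eventually_ge_at_top[of "2 ^ J"]
      proof eventually_elim
        case (elim n)
        then have "floor_log (2 ^ J) \<le> floor_log n" by (intro floor_log_mono[THEN monoD])
        then show ?case by simp
      qed
    qed
    have lim: "(\<lambda>n. c (floor_log n) * ?v (2 ^ Suc (floor_log n))) \<longlonglongrightarrow> 0"
      using filterlim_compose[OF lim0 fl] .
    have "(\<lambda>n. ?v n / (real n * (iota n)\<^sup>2)) \<longlonglongrightarrow> 0"
    proof (rule Lim_null_comparison[OF _ lim])
      show "eventually (\<lambda>n. norm (?v n / (real n * (iota n)\<^sup>2)) \<le> c (floor_log n) * ?v (2 ^ Suc (floor_log n))) sequentially"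
        using eventually_ge_at_top[of 4]
      proof eventually_elim
        case (elim n)
        define j where "j = floor_log n"
        have j: "2 ^ j \<le> n" "n \<le> 2 ^ Suc j" unfolding j_def
          using floor_log_exp2_le[of n] floor_log_exp2_gt[of n] elim by auto
        have "floor_log (2 ^ 2) \<le> j" unfolding j_def using elim by (intro floor_log_mono[THEN monoD]) simp
        then have j2: "j \<ge> 2" by (simp only: floor_log_power)
        have "(2::nat) ^ 2 \<le> 2 ^ j" using j2 by (intro power_increasing) auto
        then have j4: "(3::nat) \<le> 2 ^ j" by simp
        have v: "?v n \<le> ?v (2 ^ Suc j)"
          using mono[OF j(2), of \<omega>] V by (metis enn2real_mono ennreal_less_top)
        have i: "0 < iota (2 ^ j)" "iota (2 ^ j) \<le> iota n" using iota_pos[OF j4] iota_mono[OF j4 j(1)] by auto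
        have "?v n / (real n * (iota n)\<^sup>2) \<le> ?v (2 ^ Suc j) / (2 ^ j * (iota (2 ^ j))\<^sup>2)"
        proof (rule frac_le[OF _ v])
          show "0 < 2 ^ j * (iota (2 ^ j))\<^sup>2" using i by simp
          have "real (2 ^ j) \<le> real n" using j(1) by (simp only: of_nat_le_iff)
          then show "2 ^ j * (iota (2 ^ j))\<^sup>2 \<le> real n * (iota n)\<^sup>2"
            using i by (intro mult_mono power_mono) auto
        qed simp
        then show ?case by (simp add: c_def j_def[symmetric])
      qed
    qed
    then show ?case using elim by (simp add: less_top)
  qed
qed

section \<open>Fourier inversion\<close>

text \<open>For t different from 0 this is the integral of exp (-i t x) over the interval from a to
  b. Division by zero makes it 0 at t = 0, which respects the bound by b - a and affects only a null
  set.\<close>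

definition levy_kernel :: "real \<Rightarrow> real \<Rightarrow> real \<Rightarrow> complex" where
  "levy_kernel a b t = (iexp (-(t * a)) - iexp (-(t * b))) / (\<i> * t)"

lemma cmod_levy_kernel_le: assumes "a \<le> b" shows "cmod (levy_kernel a b t) \<le> b - a"
proof (cases "t = 0")
  case False
  then show ?thesis using Levy_Inversion_aux2[of "-b" "-a" t] assms by (simp add: levy_kernel_def)
qed (use assms in \<open>simp add: levy_kernel_def\<close>)

lemma levy_kernel_measurable [measurable]: "levy_kernel a b \<in> borel_measurable borel"
  unfolding levy_kernel_def[abs_def] by measurable

text \<open>Levy's formula is a limit of truncated integrals for each law separately, while only the
  weighted sum of the transforms is assumed integrable. The sum is therefore formed under the
  truncated integrals, bounded uniformly in the truncation by |kernel| <= b - a, and only then is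
  the limit taken.\<close>

lemma inversion_bound:
  fixes D :: "'i \<Rightarrow> real measure" and w :: "'i \<Rightarrow> real"
  assumes I: "finite I" and D: "\<And>i. i \<in> I \<Longrightarrow> real_distribution (D i)" and ab: "a \<le> b"
    and atoms: "\<And>i. i \<in> I \<Longrightarrow> measure (D i) {a} = 0" "\<And>i. i \<in> I \<Longrightarrow> measure (D i) {b} = 0"
    and int: "integrable lborel (\<lambda>t. \<Sum>i\<in>I. w i * char (D i) t)"
  shows "\<bar>\<Sum>i\<in>I. w i * measure (D i) {a<..b}\<bar> \<le> (b - a) / (2 * pi) * (\<integral>t. cmod (\<Sum>i\<in>I. w i * char (D i) t) \<partial>lborel)"
proof -
  let ?h = "\<lambda>t. \<Sum>i\<in>I. w i * char (D i) t"
  let ?k = "levy_kernel a b"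
  let ?J = "\<lambda>i T. \<integral>t. indicator {-real T<..<real T} t *\<^sub>R (?k t * char (D i) t) \<partial>lborel"
  have lim: "(\<lambda>T. 1 / (2 * pi) * ?J i T) \<longlonglongrightarrow> measure (D i) {a<..b}" if "i \<in> I" for i
    using real_distribution.Levy_Inversion[OF D[OF that] ab atoms(1)[OF that] atoms(2)[OF that]]
    by (simp add: interval_lebesgue_integral_def set_lebesgue_integral_def levy_kernel_def)
  have JI: "integrable lborel (\<lambda>t. indicator {-real T<..<real T} t *\<^sub>R (?k t * char (D i) t))" if "i \<in> I" for i and T :: nat
  proof -
    interpret real_distribution "D i" using D[OF that] .
    show ?thesis
    proof (rule integrableI_bounded_set_indicator[where B="b - a"])
      show "AE x in lborel. x \<in> {- real T<..<real T} \<longrightarrow> norm (?k x * char (D i) x) \<le> b - a"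
      proof (intro AE_I2 impI)
        fix x
        have "norm (?k x * char (D i) x) \<le> (b - a) * 1"
          unfolding norm_mult using ab by (intro mult_mono cmod_levy_kernel_le cmod_char_le_1) auto
        then show "norm (?k x * char (D i) x) \<le> b - a" by simp
      qed
    qed auto
  qed
  have "(\<lambda>T. \<Sum>i\<in>I. w i * (1 / (2 * pi) * ?J i T)) \<longlonglongrightarrow> (\<Sum>i\<in>I. of_real (w i) * of_real (measure (D i) {a<..b}))"
    by (intro tendsto_sum tendsto_mult_left lim)
  then have "(\<lambda>T. cmod (\<Sum>i\<in>I. w i * (1 / (2 * pi) * ?J i T))) \<longlonglongrightarrow>
      cmod (\<Sum>i\<in>I. of_real (w i) * of_real (measure (D i) {a<..b}))"
    by (rule tendsto_norm)
  also have "(\<Sum>i\<in>I. of_real (w i) * of_real (measure (D i) {a<..b})) = complex_of_real (\<Sum>i\<in>I. w i * measure (D i) {a<..b})"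
    by (simp only: of_real_sum of_real_mult)
  also have "cmod \<dots> = \<bar>\<Sum>i\<in>I. w i * measure (D i) {a<..b}\<bar>" by (rule norm_of_real)
  finally have L: "(\<lambda>T. cmod (\<Sum>i\<in>I. w i * (1 / (2 * pi) * ?J i T))) \<longlonglongrightarrow> \<bar>\<Sum>i\<in>I. w i * measure (D i) {a<..b}\<bar>" .
  have "cmod (\<Sum>i\<in>I. w i * (1 / (2 * pi) * ?J i T)) \<le> (b - a) / (2 * pi) * (\<integral>t. cmod (?h t) \<partial>lborel)" for T :: nat
  proof -
    have "(\<Sum>i\<in>I. w i * ?J i T) = (\<Sum>i\<in>I. \<integral>t. w i * (indicator {-real T<..<real T} t *\<^sub>R (?k t * char (D i) t)) \<partial>lborel)"
      by (intro sum.cong refl integral_mult_right_zero[symmetric])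
    also have "\<dots> = (\<integral>t. (\<Sum>i\<in>I. w i * (indicator {-real T<..<real T} t *\<^sub>R (?k t * char (D i) t))) \<partial>lborel)"
      by (intro Bochner_Integration.integral_sum[symmetric] integrable_mult_right JI)
    also have "\<dots> = (\<integral>t. indicator {-real T<..<real T} t *\<^sub>R (?k t * ?h t) \<partial>lborel)"
      by (intro Bochner_Integration.integral_cong refl) (simp add: sum_distrib_left scaleR_sum_right mult_ac indicator_def)
    finally have e: "(\<Sum>i\<in>I. w i * ?J i T) = (\<integral>t. indicator {-real T<..<real T} t *\<^sub>R (?k t * ?h t) \<partial>lborel)" .
    have "cmod (\<Sum>i\<in>I. w i * ?J i T) \<le> (\<integral>t. cmod (indicator {-real T<..<real T} t *\<^sub>R (?k t * ?h t)) \<partial>lborel)"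
      unfolding e by (rule integral_norm_bound)
    also have "\<dots> \<le> (\<integral>t. (b - a) * cmod (?h t) \<partial>lborel)"
    proof (rule integral_mono')
      show "integrable lborel (\<lambda>t. (b - a) * cmod (?h t))" using int by (intro integrable_mult_right integrable_norm)
      fix t
      have "cmod (?k t * ?h t) \<le> (b - a) * cmod (?h t)"
        unfolding norm_mult by (intro mult_right_mono cmod_levy_kernel_le ab) auto
      then show "cmod (indicator {-real T<..<real T} t *\<^sub>R (?k t * ?h t)) \<le> (b - a) * cmod (?h t)"
        using ab by (auto simp: indicator_def)
    qed (use ab in auto)
    also have "\<dots> = (b - a) * (\<integral>t. cmod (?h t) \<partial>lborel)" by simp
    finally have f: "cmod (\<Sum>i\<in>I. w i * ?J i T) \<le> (b - a) * (\<integral>t. cmod (?h t) \<partial>lborel)" .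
    have "(\<Sum>i\<in>I. w i * (1 / (2 * pi) * ?J i T)) = 1 / (2 * pi) * (\<Sum>i\<in>I. w i * ?J i T)"
      unfolding sum_distrib_left by (intro sum.cong) (auto simp: mult_ac)
    then have "cmod (\<Sum>i\<in>I. w i * (1 / (2 * pi) * ?J i T)) = 1 / (2 * pi) * cmod (\<Sum>i\<in>I. w i * ?J i T)"
      by (simp add: norm_mult norm_divide)
    also have "\<dots> \<le> 1 / (2 * pi) * ((b - a) * (\<integral>t. cmod (?h t) \<partial>lborel))" by (intro mult_left_mono f) auto
    finally show ?thesis by simp
  qed
  then show ?thesis by (intro LIMSEQ_le_const2[OF L]) blast
qed

text \<open>Cauchy-Schwarz after multiplying and dividing by the square root of 1 + t^2; the
  constant is the integral of 1 / (1 + t^2), which is pi.\<close>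

lemma weighted_L1_bound:
  fixes h :: "real \<Rightarrow> complex"
  assumes [measurable]: "h \<in> borel_measurable borel"
    and fin: "(\<integral>\<^sup>+t. ennreal ((1 + t\<^sup>2) * (cmod (h t))\<^sup>2) \<partial>lborel) < \<infinity>"
  shows "integrable lborel h"
    "(\<integral>t. cmod (h t) \<partial>lborel) \<le> sqrt pi * sqrt (enn2real (\<integral>\<^sup>+t. ennreal ((1 + t\<^sup>2) * (cmod (h t))\<^sup>2) \<partial>lborel))"
proof -
  let ?W = "\<integral>\<^sup>+t. ennreal ((1 + t\<^sup>2) * (cmod (h t))\<^sup>2) \<partial>lborel"
  have 1: "(\<integral>\<^sup>+t. ennreal (inverse (1 + t\<^sup>2)) \<partial>lborel) = ennreal pi"
  proof -
    have "integrable lborel (\<lambda>t::real. inverse (1 + t\<^sup>2))" "(\<integral>t. inverse (1 + t\<^sup>2) \<partial>lborel) = pi"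
      using integrable_inverse_1_plus_square LBINT_inverse_1_plus_square by (simp_all add: set_integrable_def interval_lebesgue_integral_def set_lebesgue_integral_def)
    then show ?thesis by (subst nn_integral_eq_integral) (auto simp: add_nonneg_nonneg)
  qed
  have p: "0 < 1 + t\<^sup>2" for t :: real by (simp add: add_pos_nonneg)
  have "(\<integral>\<^sup>+t. ennreal (cmod (h t)) \<partial>lborel)\<^sup>2 = (\<integral>\<^sup>+t. ennreal (sqrt (inverse (1 + t\<^sup>2))) * ennreal (sqrt (1 + t\<^sup>2) * cmod (h t)) \<partial>lborel)\<^sup>2"
    using p by (intro arg_cong[where f="\<lambda>x. x\<^sup>2"] nn_integral_cong)
      (simp add: ennreal_mult[symmetric] less_imp_le real_sqrt_inverse less_imp_neq[symmetric] mult.assoc[symmetric])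
  also have "\<dots> \<le> (\<integral>\<^sup>+t. ennreal (sqrt (inverse (1 + t\<^sup>2))) ^ 2 \<partial>lborel) * (\<integral>\<^sup>+t. ennreal (sqrt (1 + t\<^sup>2) * cmod (h t)) ^ 2 \<partial>lborel)"
    by (rule Cauchy_Schwarz_nn_integral) auto
  also have "(\<integral>\<^sup>+t. ennreal (sqrt (inverse (1 + t\<^sup>2))) ^ 2 \<partial>lborel) = ennreal pi"
    unfolding 1[symmetric] using p by (intro nn_integral_cong) (simp add: ennreal_power less_imp_le)
  also have "(\<integral>\<^sup>+t. ennreal (sqrt (1 + t\<^sup>2) * cmod (h t)) ^ 2 \<partial>lborel) = ?W"
    using p by (intro nn_integral_cong) (simp add: ennreal_power power_mult_distrib less_imp_le)
  also have "ennreal pi * ?W = ennreal (pi * enn2real ?W)"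
    using fin by (simp add: ennreal_mult ennreal_enn2real less_top)
  finally have sq: "(\<integral>\<^sup>+t. ennreal (cmod (h t)) \<partial>lborel)\<^sup>2 \<le> ennreal (pi * enn2real ?W)" .
  then have "(\<integral>\<^sup>+t. ennreal (cmod (h t)) \<partial>lborel)\<^sup>2 < \<top>" by (rule le_less_trans) simp
  then have f: "(\<integral>\<^sup>+t. ennreal (cmod (h t)) \<partial>lborel) < \<infinity>" by (auto simp: power2_eq_square ennreal_mult_less_top)
  then show int: "integrable lborel h" by (intro integrableI_bounded) auto
  then have e: "(\<integral>\<^sup>+t. ennreal (cmod (h t)) \<partial>lborel) = ennreal (\<integral>t. cmod (h t) \<partial>lborel)"
    by (intro nn_integral_eq_integral integrable_norm) auto
  have "(\<integral>t. cmod (h t) \<partial>lborel)\<^sup>2 \<le> pi * enn2real ?W"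
    using sq unfolding e by (simp add: ennreal_power ennreal_le_iff)
  then have "(\<integral>t. cmod (h t) \<partial>lborel) \<le> sqrt (pi * enn2real ?W)" by (rule real_le_rsqrt)
  then show "(\<integral>t. cmod (h t) \<partial>lborel) \<le> sqrt pi * sqrt (enn2real ?W)" by (simp add: real_sqrt_mult)
qed

section \<open>The modulus of continuity\<close>

lemma measure_Ioc_cdf:
  assumes "real_distribution D" "a \<le> b"
  shows "measure D {a<..b} = measure D {..b} - measure D {..a}"
proof -
  interpret real_distribution D by fact
  have "{a<..b} = {..b} - {..a}" by auto
  then show ?thesis using assms(2) by (simp add: finite_measure_Diff)
qed

text \<open>Levy inversion requires endpoints without mass; the Lipschitz bound supplies this for
  every point.\<close>

lemma Lipschitz_no_atom:
  assumes D: "real_distribution D" and lip: "\<And>x y. x \<le> y \<Longrightarrow> measure D {..y} - measure D {..x} \<le> c * (y - x)" and c: "c \<ge> 0"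
  shows "measure D {a} = 0"
proof -
  interpret real_distribution D by fact
  have "measure D {a} \<le> 0 + e" if e: "e > 0" for e
  proof -
    define d where "d = e / (c + 1)"
    have d: "d > 0" "c * d \<le> e" using e c by (auto simp: d_def field_simps)
    have "measure D {a} \<le> measure D {a - d<..a}" using d by (intro finite_measure_mono) auto
    also have "\<dots> \<le> c * d" using lip[of "a - d" a] d measure_Ioc_cdf[OF D, of "a - d" a] by simp
    finally show ?thesis using d by simp
  qed
  then have "measure D {a} \<le> 0" by (rule field_le_epsilon)
  then show ?thesis by (simp add: measure_le_0_iff)
qed

text \<open>An arbitrary injection into the index set is allowed, so one statement covers both the
  time-reversed histories and a history with the independent copy in front.\<close>

lemma (in prob_space) distr_iid_reindex:
  fixes Z :: "'i \<Rightarrow> 'a \<Rightarrow> real" and f :: "nat \<Rightarrow> 'i"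
  assumes rv: "\<And>i. Z i \<in> borel_measurable M" and indep: "indep_vars (\<lambda>_. borel) Z UNIV"
    and ident: "\<And>i. distr M borel (Z i) = \<mu>" and f: "inj f"
  shows "(\<lambda>\<omega> j. Z (f j) \<omega>) \<in> M \<rightarrow>\<^sub>M PiM UNIV (\<lambda>_::nat. \<mu>)"
    "distr M (PiM UNIV (\<lambda>_::nat. \<mu>)) (\<lambda>\<omega> j. Z (f j) \<omega>) = PiM UNIV (\<lambda>_::nat. \<mu>)"
proof -
  have sets_mu [measurable_cong]: "sets \<mu> = sets borel" using ident[of undefined] by (metis sets_distr)
  have sp: "space \<mu> = UNIV" using sets_eq_imp_space_eq[OF sets_mu] by simp
  have pm: "prob_space \<mu>" using prob_space_distr[OF rv] ident by metis
  have sets_P: "sets (PiM (UNIV :: 'i set) (\<lambda>_. \<mu>)) = sets (PiM UNIV (\<lambda>_. borel))"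
    by (rule sets_PiM_cong) (auto simp: sets_mu)
  have mZ: "(\<lambda>\<omega> i. Z i \<omega>) \<in> M \<rightarrow>\<^sub>M PiM UNIV (\<lambda>_. \<mu>)"
    using rv by (intro measurable_PiM_single') (auto simp: sp PiE_UNIV_domain measurable_cong_sets[OF refl sets_mu])
  show mf: "(\<lambda>\<omega> j. Z (f j) \<omega>) \<in> M \<rightarrow>\<^sub>M PiM UNIV (\<lambda>_::nat. \<mu>)"
    using rv by (intro measurable_PiM_single') (auto simp: sp PiE_UNIV_domain measurable_cong_sets[OF refl sets_mu])
  have "distr M (PiM UNIV (\<lambda>_. borel)) (\<lambda>x. \<lambda>i\<in>UNIV. Z i x) = PiM UNIV (\<lambda>i. distr M borel (Z i))"
    using indep_vars_iff_distr_eq_PiM[of UNIV Z "\<lambda>_. borel"] rv indep by simp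
  moreover have "distr M (PiM UNIV (\<lambda>_. borel)) (\<lambda>x. \<lambda>i\<in>UNIV. Z i x) = distr M (PiM UNIV (\<lambda>_. \<mu>)) (\<lambda>x i. Z i x)"
    by (rule distr_cong) (auto simp: sets_P)
  ultimately have law: "distr M (PiM UNIV (\<lambda>_. \<mu>)) (\<lambda>x i. Z i x) = PiM UNIV (\<lambda>_. \<mu>)"
    by (simp add: ident)
  have "PiM UNIV (\<lambda>_::nat. \<mu>) = distr (PiM UNIV (\<lambda>_::'i. \<mu>)) (PiM UNIV (\<lambda>_::nat. \<mu>)) (\<lambda>\<omega>. \<lambda>n\<in>UNIV. \<omega> (f n))"
    using distr_PiM_reindex[of UNIV "\<lambda>_. \<mu>" f UNIV] pm f by simp
  also have "\<dots> = distr (distr M (PiM UNIV (\<lambda>_. \<mu>)) (\<lambda>x i. Z i x)) (PiM UNIV (\<lambda>_::nat. \<mu>)) (\<lambda>\<omega>. \<lambda>n\<in>UNIV. \<omega> (f n))"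
    by (simp only: law)
  also have "\<dots> = distr M (PiM UNIV (\<lambda>_::nat. \<mu>)) ((\<lambda>\<omega>. \<lambda>n\<in>UNIV. \<omega> (f n)) \<circ> (\<lambda>x i. Z i x))"
    by (rule distr_distr[OF _ mZ]) measurable
  finally show "distr M (PiM UNIV (\<lambda>_::nat. \<mu>)) (\<lambda>\<omega> j. Z (f j) \<omega>) = PiM UNIV (\<lambda>_::nat. \<mu>)"
    by (simp add: comp_def restrict_def)
qed

section \<open>The one-step conditional law and the marginal law\<close>

context innovations_map
begin

definition marg_cdf :: "real \<Rightarrow> real" where
  "marg_cdf x = measure S {h. g h \<le> x}"

definition cdist :: "(nat \<Rightarrow> real) \<Rightarrow> real measure" where
  "cdist h = distr \<mu> borel (\<lambda>s. g (case_nat s h))"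

lemma cdist_props:
  shows "real_distribution (cdist h)" "char (cdist h) \<theta> = cond_char \<theta> 1 h" "measure (cdist h) {..x} = next_cdf x h"
proof -
  show "real_distribution (cdist h)" unfolding cdist_def by (intro real_distribution_distr) measurable
  have "char (cdist h) \<theta> = (\<integral>s. cis (\<theta> * g (case_nat s h)) \<partial>\<mu>)"
    unfolding char_def cdist_def by (subst integral_distr) (auto simp: cis_conv_exp)
  then show "char (cdist h) \<theta> = cond_char \<theta> 1 h" by (simp add: cond_char_Suc cond_step_def) (simp add: cond_char_def)
  have "measure (cdist h) {..x} = measure \<mu> {s. g (case_nat s h) \<le> x}"
    unfolding cdist_def by (subst measure_distr) (auto simp: vimage_def)
  also have "\<dots> = (\<integral>s. indicator {s. g (case_nat s h) \<le> x} s \<partial>\<mu>)"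
    by simp
  also have "\<dots> = next_cdf x h" unfolding next_cdf_eq_cond_step cond_step_def by (intro Bochner_Integration.integral_cong) (auto simp: indicator_def)
  finally show "measure (cdist h) {..x} = next_cdf x h" .
qed

lemma mdist_props:
  shows "real_distribution (distr S borel g)" "char (distr S borel g) \<theta> = mean_char \<theta>" "measure (distr S borel g) {..x} = marg_cdf x"
proof -
  show "real_distribution (distr S borel g)" by (intro seq.P.real_distribution_distr) measurable
  show "char (distr S borel g) \<theta> = mean_char \<theta>"
    unfolding char_def mean_char_def by (subst integral_distr) (auto simp: cis_conv_exp)
  show "measure (distr S borel g) {..x} = marg_cdf x"
    unfolding marg_cdf_def by (subst measure_distr) (auto simp: vimage_def)
qed

lemma marg_cdf_eq: "marg_cdf x = integral\<^sup>L S (next_cdf x)"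
proof -
  have b: "bounded_rv (\<lambda>h. indicator {..x} (g h) :: real)" by (rule bounded_rv_ind) auto
  have "integral\<^sup>L S (next_cdf x) = (\<integral>h. indicator {..x} (g h) \<partial>S)"
    using integral_S[OF b] unfolding next_cdf_eq_cond_step[abs_def] by simp
  also have "\<dots> = (\<integral>h. indicator {h. g h \<le> x} h \<partial>S)"
    by (intro Bochner_Integration.integral_cong) (auto simp: indicator_def)
  finally show ?thesis by (simp add: marg_cdf_def)
qed

lemma marg_cdf_Lipschitz:
  assumes lip: "AE h in S. Lip c h" and xy: "x \<le> y"
  shows "marg_cdf y - marg_cdf x \<le> c * (y - x)"
proof -
  have b: "bounded_rv (next_cdf x)" for x by (rule bounded_rvI[where C=1]) (use next_cdf_range in auto)
  have "marg_cdf y - marg_cdf x = (\<integral>h. next_cdf y h - next_cdf x h \<partial>S)" using b[THEN bounded_rv_integrable] by (simp add: marg_cdf_eq)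
  also have "\<dots> \<le> (\<integral>h. c * (y - x) \<partial>S)"
  proof (rule integral_mono_AE)
    show "integrable S (\<lambda>h. next_cdf y h - next_cdf x h)" using b[THEN bounded_rv_integrable] by simp
    show "AE h in S. next_cdf y h - next_cdf x h \<le> c * (y - x)" using lip by eventually_elim (use xy in \<open>simp add: Lip_def\<close>)
  qed simp
  finally show ?thesis by (simp add: seq.P.prob_space[simplified])
qed

end

context causal_process
begin

text \<open>The centred compensator is a signed combination of the n conditional laws and the
  marginal law, and its Fourier transform is exactly \<open>char_sum\<close>. Inversion and the
  weighted bound apply to the combination; pi from inversion against sqrt pi from the weight leaves
  2 sqrt pi in the denominator.\<close>

lemma smooth_part_bound:
  assumes lip: "AE h in S. Lip c h" and c: "c \<ge> 0" and lip': "\<And>i. Lip c (hist eps i \<omega>)"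
    and W: "Wstar n \<omega> < \<infinity>" and w: "\<omega> \<in> space M" and xy: "x \<le> y"
  shows "\<bar>(\<Sum>i\<in>{1..n}. next_cdf y (hist eps (int i - 1) \<omega>) - next_cdf x (hist eps (int i - 1) \<omega>)) - n * (marg_cdf y - marg_cdf x)\<bar>
    \<le> (y - x) / (2 * sqrt pi) * sqrt (enn2real (Wstar n \<omega>))"
proof -
  \<comment> \<open>Index 0 is reserved for the marginal law, which gets the weight -n; indices 1 to
    n carry the conditional laws with weight 1.\<close>
  define D where "D i = (if i = 0 then distr S borel g else cdist (hist eps (int i - 1) \<omega>))" for i :: nat
  define v where "v i = (if i = 0 then - real n else 1)" for i :: nat
  have D: "real_distribution (D i)" for i unfolding D_def using cdist_props(1) mdist_props(1) by simp
  have lipD: "measure (D i) {..t} - measure (D i) {..s} \<le> c * (t - s)" if "s \<le> t" for i s t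
    unfolding D_def using marg_cdf_Lipschitz[OF lip that] lip' that by (simp add: cdist_props(3) mdist_props(3) Lip_def)
  have atom: "measure (D i) {a} = 0" for i a using Lipschitz_no_atom[OF D lipD c] .
  have split: "(\<Sum>i\<in>{0..n}. f i) = f 0 + (\<Sum>i\<in>{1..n}. f i)" for f :: "nat \<Rightarrow> 'z::comm_monoid_add"
    by (simp add: sum.atLeast_Suc_atMost)
  have h: "(\<Sum>i\<in>{0..n}. v i * char (D i) t) = char_sum n t \<omega>" for t
    unfolding split by (simp add: v_def D_def cdist_props(2) mdist_props(2) char_sum_def sum_subtractf)
  have m: "(\<Sum>i\<in>{0..n}. v i * measure (D i) {x<..y}) =
    (\<Sum>i\<in>{1..n}. next_cdf y (hist eps (int i - 1) \<omega>) - next_cdf x (hist eps (int i - 1) \<omega>)) - n * (marg_cdf y - marg_cdf x)"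
    unfolding split measure_Ioc_cdf[OF D xy]
    by (simp add: v_def D_def cdist_props(3) mdist_props(3))
  let ?W = "\<integral>\<^sup>+t. ennreal ((1 + t\<^sup>2) * (cmod (char_sum n t \<omega>))\<^sup>2) \<partial>lborel"
  have [measurable]: "(\<lambda>t. char_sum n t \<omega>) \<in> borel_measurable borel" using w by measurable
  have WW: "?W \<le> Wstar n \<omega>" unfolding Wstar_def
    by (intro nn_integral_mono ennreal_leI mult_left_mono char_sum_le_char_max) auto
  then have fin: "?W < \<infinity>" using W by (rule le_less_trans)
  note L1 = weighted_L1_bound[of "\<lambda>t. char_sum n t \<omega>", OF _ fin]
  have int: "integrable lborel (\<lambda>t. \<Sum>i\<in>{0..n}. v i * char (D i) t)" unfolding h by (rule L1(1)) measurable
  have "\<bar>\<Sum>i\<in>{0..n}. v i * measure (D i) {x<..y}\<bar> \<le> (y - x) / (2 * pi) * (\<integral>t. cmod (\<Sum>i\<in>{0..n}. v i * char (D i) t) \<partial>lborel)"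
    by (intro inversion_bound D atom xy int) auto
  also have "\<dots> \<le> (y - x) / (2 * pi) * (sqrt pi * sqrt (enn2real ?W))"
    unfolding h using xy by (intro mult_left_mono L1(2)) auto
  also have "\<dots> \<le> (y - x) / (2 * pi) * (sqrt pi * sqrt (enn2real (Wstar n \<omega>)))"
    using xy WW W by (intro mult_left_mono real_sqrt_le_mono enn2real_mono) auto
  also have "\<dots> = (y - x) / (2 * sqrt pi) * sqrt (enn2real (Wstar n \<omega>))"
  proof -
    have "z / (2 * (r * r)) * (r * s) = z / (2 * r) * s" if "r > 0" for z r s :: real
      using that by (simp add: field_simps)
    from this[of "sqrt pi"] show ?thesis by simp
  qed
  finally show ?thesis unfolding m .
qed

lemma modulus_decomposition:
  fixes b :: "nat \<Rightarrow> real"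
  assumes lip: "AE h in S. Lip c h" and c: "c > 0"
    and b_pos: "\<And>n. b n > 0" and b_lim: "b \<longlonglongrightarrow> 0" and b_log: "(\<lambda>n. ln (real n)) \<in> O(\<lambda>n. real n * b n)"
    and fin: "\<And>k. k \<ge> 1 \<Longrightarrow> (\<integral>\<^sup>+\<theta>. ennreal ((1 + \<theta>\<^sup>2) * coupling_sq k \<theta>) \<partial>lborel) < \<infinity>"
    and sum: "summable (\<lambda>k. sqrt (enn2real (\<integral>\<^sup>+\<theta>. ennreal ((1 + \<theta>\<^sup>2) * coupling_sq (Suc k) \<theta>) \<partial>lborel)))"
  shows "\<exists>A B :: nat \<Rightarrow> 'a \<Rightarrow> real.
           (AE \<omega> in M. eventually (\<lambda>n. modulus (\<lambda>k \<omega>. g (hist eps k \<omega>)) marg_cdf n (b n) \<omega> \<le> A n \<omega> + B n \<omega>) sequentially)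
         \<and> (AE \<omega> in M. limsup (\<lambda>n. ereal (\<bar>A n \<omega>\<bar> / sqrt (b n * ln (real n)))) < \<infinity>)
         \<and> (AE \<omega> in M. (\<lambda>n. B n \<omega> / (b n * iota n)) \<longlonglongrightarrow> 0)"
proof -
  let ?X = "\<lambda>k \<omega>. g (hist eps k \<omega>)"
  obtain C where C: "AE \<omega> in M. eventually (\<lambda>n. \<forall>x y. x \<le> y \<longrightarrow> y - x \<le> b n \<longrightarrow>
     \<bar>mart n y \<omega> - mart n x \<omega>\<bar> \<le> C * sqrt (n * b n * ln n)) sequentially"
    using martingale_modulus[OF lip c b_pos b_lim b_log] by blast
  obtain C' where C': "C' \<ge> 0" "\<And>n. (\<integral>\<^sup>+\<omega>. Wstar n \<omega> \<partial>M) \<le> ennreal (C' * real n)"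
    using Wstar_expectation_le[OF fin sum] by blast
  have W: "AE \<omega> in M. (\<forall>n. Wstar n \<omega> < \<infinity>) \<and> (\<lambda>n. enn2real (Wstar n \<omega>) / (real n * (iota n)\<^sup>2)) \<longlonglongrightarrow> 0"
    by (rule dyadic_null[OF Wstar_measurable Wstar_mono C'])
  define A where "A n \<omega> = C * sqrt (b n * ln (real n))" for n and \<omega> :: 'a
  \<comment> \<open>The bound of \<open>smooth_part_bound\<close> at the largest width
    \<open>b n\<close>, divided by sqrt n. Divided by b n iota(n) it is a constant times the square
    root of the quantity that \<open>dyadic_null\<close> sends to 0.\<close>
  define B where "B n \<omega> = b n / (2 * sqrt pi) * sqrt (enn2real (Wstar n \<omega>) / n)" for n \<omega>
  have lip': "AE \<omega> in M. \<forall>i. Lip c (hist eps i \<omega>)"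
    unfolding AE_all_countable using AE_hist_of_AE[OF lip] by blast
  have 1: "AE \<omega> in M. eventually (\<lambda>n. modulus ?X marg_cdf n (b n) \<omega> \<le> A n \<omega> + B n \<omega>) sequentially"
    using C W lip' AE_space
  proof eventually_elim
    case (elim \<omega>)
    note Wf = elim(2)[THEN conjunct1] and lipw = elim(3) and w = elim(4)
    from elim(1) eventually_gt_at_top[of 0] show ?case
    proof eventually_elim
      case (elim n)
      have inc: "\<bar>emp_proc ?X marg_cdf n y \<omega> - emp_proc ?X marg_cdf n x \<omega>\<bar> \<le> A n \<omega> + B n \<omega>" if xy: "x \<le> y" "y - x \<le> b n" for x y
      proof -
        have n: "sqrt (real n) > 0" using elim by simp
        let ?V = "\<lambda>x. \<Sum>i\<in>{1..n}. next_cdf x (hist eps (int i - 1) \<omega>)"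
        let ?E = "\<lambda>x. \<Sum>i\<in>{1..n}. (if ?X (int i) \<omega> \<le> x then 1 else 0 :: real)"
        let ?R = "(\<Sum>i\<in>{1..n}. next_cdf y (hist eps (int i - 1) \<omega>) - next_cdf x (hist eps (int i - 1) \<omega>)) - n * (marg_cdf y - marg_cdf x)"
        have mE: "mart n x \<omega> = ?E x - ?V x" for x
          unfolding mart_def sum_subtractf by (simp add: indicator_def if_distrib of_bool_def cong: if_cong)
        have "emp_proc ?X marg_cdf n y \<omega> - emp_proc ?X marg_cdf n x \<omega> = sqrt n / n * ((?E y - ?E x) - n * (marg_cdf y - marg_cdf x))"
          using elim by (simp add: emp_proc_def emp_cdf_def field_simps)
        also have "sqrt n / n = 1 / sqrt n" using elim by (simp add: field_simps)
        also have "(?E y - ?E x) - n * (marg_cdf y - marg_cdf x) = (mart n y \<omega> - mart n x \<omega>) + ?R"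
          unfolding mE by (simp add: sum_subtractf)
        finally have "\<bar>emp_proc ?X marg_cdf n y \<omega> - emp_proc ?X marg_cdf n x \<omega>\<bar> = \<bar>(mart n y \<omega> - mart n x \<omega>) + ?R\<bar> / sqrt n"
          using n by (simp add: abs_mult)
        also have "\<dots> \<le> (C * sqrt (n * b n * ln n) + b n / (2 * sqrt pi) * sqrt (enn2real (Wstar n \<omega>))) / sqrt n"
        proof (rule divide_right_mono)
          have "\<bar>?R\<bar> \<le> (y - x) / (2 * sqrt pi) * sqrt (enn2real (Wstar n \<omega>))"
            using smooth_part_bound[OF lip _ _ _ w xy(1), of n] lipw Wf c by simp
          also have "\<dots> \<le> b n / (2 * sqrt pi) * sqrt (enn2real (Wstar n \<omega>))"
            using xy by (intro mult_right_mono divide_right_mono) auto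
          finally show "\<bar>(mart n y \<omega> - mart n x \<omega>) + ?R\<bar> \<le> C * sqrt (n * b n * ln n) + b n / (2 * sqrt pi) * sqrt (enn2real (Wstar n \<omega>))"
            using elim xy by (smt (verit))
        qed simp
        also have "\<dots> = A n \<omega> + B n \<omega>"
          using n by (simp add: A_def B_def add_divide_distrib real_sqrt_mult real_sqrt_divide mult.assoc)
        finally show ?thesis .
      qed
      show ?case unfolding modulus_def
      proof (rule cSUP_least)
        show "{(x, y). \<bar>x - y\<bar> \<le> b n} \<noteq> {}" using b_pos[of n] by (auto intro!: exI[of _ 0])
        fix p assume "p \<in> {(x, y). \<bar>x - y\<bar> \<le> b n}"
        then obtain x y where p: "p = (x, y)" "\<bar>x - y\<bar> \<le> b n" by auto
        show "\<bar>emp_proc ?X marg_cdf n (fst p) \<omega> - emp_proc ?X marg_cdf n (snd p) \<omega>\<bar> \<le> A n \<omega> + B n \<omega>"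
          using inc[of x y] inc[of y x] p by (cases "x \<le> y") (auto simp: abs_minus_commute)
      qed
    qed
  qed
  have 2: "limsup (\<lambda>n. ereal (\<bar>A n \<omega>\<bar> / sqrt (b n * ln (real n)))) < \<infinity>" for \<omega>
  proof -
    have "\<bar>A n \<omega>\<bar> / sqrt (b n * ln (real n)) \<le> \<bar>C\<bar>" for n
    \<comment> \<open>Where the denominator vanishes, as at n = 1, the quotient is 0 by convention
      and the bound still holds.\<close>
    proof (cases "sqrt (b n * ln (real n)) = 0")
      case False
      have "0 \<le> b n * ln (real n)" using b_pos[of n] by (cases "n = 0") (auto simp: less_imp_le)
      then show ?thesis using False by (simp add: A_def abs_mult)
    qed (simp only: div_by_0 abs_ge_zero)
    then have "limsup (\<lambda>n. ereal (\<bar>A n \<omega>\<bar> / sqrt (b n * ln (real n)))) \<le> ereal \<bar>C\<bar>"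
      by (intro Limsup_bounded always_eventually allI) simp
    then show ?thesis by (rule le_less_trans) simp
  qed
  have 3: "AE \<omega> in M. (\<lambda>n. B n \<omega> / (b n * iota n)) \<longlonglongrightarrow> 0"
    using W
  proof eventually_elim
    case (elim \<omega>)
    have "(\<lambda>n. 1 / (2 * sqrt pi) * sqrt (enn2real (Wstar n \<omega>) / (real n * (iota n)\<^sup>2))) \<longlonglongrightarrow> 1 / (2 * sqrt pi) * sqrt 0"
      using elim by (intro tendsto_intros) auto
    moreover have "eventually (\<lambda>n. 1 / (2 * sqrt pi) * sqrt (enn2real (Wstar n \<omega>) / (real n * (iota n)\<^sup>2)) = B n \<omega> / (b n * iota n)) sequentially"
      using eventually_ge_at_top[of 3]
    proof eventually_elim
      case (elim n)
      show ?case using iota_pos[OF elim] b_pos[of n]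
        by (simp add: B_def real_sqrt_divide real_sqrt_mult field_simps)
    qed
    ultimately have "(\<lambda>n. B n \<omega> / (b n * iota n)) \<longlonglongrightarrow> 1 / (2 * sqrt pi) * sqrt 0"
      by (rule Lim_transform_eventually)
    then show ?case by simp
  qed
  show ?thesis using 1 2 3 by blast
qed

end

section \<open>Reduction of the stated hypotheses to the setting of histories\<close>

theorem theorem2p1:
  fixes M :: "'a measure"
    and eps :: "int \<Rightarrow> 'a \<Rightarrow> real" and eps0' :: "'a \<Rightarrow> real"
    and g :: "(nat \<Rightarrow> real) \<Rightarrow> real"
    and F f f' :: "real \<Rightarrow> real"
    and fc :: "nat \<Rightarrow> real \<Rightarrow> (nat \<Rightarrow> real) \<Rightarrow> real"
    and b :: "nat \<Rightarrow> real" and c0 :: real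
  defines "X \<equiv> (\<lambda>k \<omega>. g (hist eps k \<omega>))"
    and "\<mu> \<equiv> distr M borel eps0'"
  assumes "prob_space M"
    and rv: "\<And>i. eps i \<in> borel_measurable M" "eps0' \<in> borel_measurable M"
    and indep: "prob_space.indep_vars M (\<lambda>_. borel)
                  (\<lambda>i. case i of None \<Rightarrow> eps0' | Some j \<Rightarrow> eps j) (UNIV :: int option set)"
    and ident: "\<And>i. distr M borel (eps i) = \<mu>"
    and g_meas: "g \<in> borel_measurable (PiM UNIV (\<lambda>_::nat. borel))"
    and F_def: "\<And>x. F x = measure M {\<omega> \<in> space M. X 0 \<omega> \<le> x}"
    and dens: "distributed M lborel (X 0) (\<lambda>x. ennreal (f x))" "\<And>x. f x \<ge> 0"
    and f_L2: "integrable lborel (\<lambda>x. (f x)\<^sup>2)"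
    and f_deriv: "\<And>x. (f has_real_derivative f' x) (at x)"
    and f'_L2: "integrable lborel (\<lambda>x. (f' x)\<^sup>2)"
    and cond_dens: "\<And>k. k \<ge> 1 \<Longrightarrow> AE \<omega> in M. \<forall>x.
             ((\<lambda>y. cond_cdf \<mu> g k y (hist eps 0 \<omega>)) has_real_derivative fc k x (hist eps 0 \<omega>)) (at x)"
    and b_pos: "\<And>n. b n > 0"
    and b_lim: "b \<longlonglongrightarrow> 0"
    and b_log: "(\<lambda>n. ln (real n)) \<in> O(\<lambda>n. real n * b n)"
    and c0: "c0 > 0"
    and f1_bdd: "AE \<omega> in M. \<forall>x. fc 1 x (hist eps 0 \<omega>) \<le> c0"
    and cf_fin: "\<And>k. k \<ge> 1 \<Longrightarrow>
           (\<integral>\<^sup>+ \<theta>. ennreal ((1 + \<theta>\<^sup>2) * (\<integral>\<omega>. (cmod (cond_cf \<mu> g k \<theta> (hist eps 0 \<omega>)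
                 - cond_cf \<mu> g k \<theta> (hist0_star eps eps0' \<omega>)))\<^sup>2 \<partial>M)) \<partial>lborel) < \<infinity>"
    and cf_sum: "summable (\<lambda>k. sqrt (enn2real
           (\<integral>\<^sup>+ \<theta>. ennreal ((1 + \<theta>\<^sup>2) * (\<integral>\<omega>. (cmod (cond_cf \<mu> g (Suc k) \<theta> (hist eps 0 \<omega>)
                 - cond_cf \<mu> g (Suc k) \<theta> (hist0_star eps eps0' \<omega>)))\<^sup>2 \<partial>M)) \<partial>lborel)))"
  shows "\<exists>A B :: nat \<Rightarrow> 'a \<Rightarrow> real.
           (AE \<omega> in M. eventually (\<lambda>n. modulus X F n (b n) \<omega> \<le> A n \<omega> + B n \<omega>) sequentially)
         \<and> (AE \<omega> in M. limsup (\<lambda>n. ereal (\<bar>A n \<omega>\<bar> / sqrt (b n * ln (real n)))) < \<infinity>)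
         \<and> (AE \<omega> in M. (\<lambda>n. B n \<omega> / (b n * iota n)) \<longlonglongrightarrow> 0)"
proof -
  interpret PM: prob_space M by fact
  let ?Z = "\<lambda>i. case i of None \<Rightarrow> eps0' | Some j \<Rightarrow> eps j"
  have sets_mu: "sets \<mu> = sets borel" by (simp add: \<mu>_def)
  have pm: "prob_space \<mu>" unfolding \<mu>_def by (rule PM.prob_space_distr) (rule rv)
  interpret innovations \<mu> by (intro innovations.intro innovations_axioms.intro pm sets_mu)
  have Z: "?Z i \<in> borel_measurable M" "distr M borel (?Z i) = \<mu>" for i
    using rv ident by (auto simp: \<mu>_def split: option.split)
  note law = PM.distr_iid_reindex[where Z="?Z", OF Z(1) indep Z(2)]
  \<comment> \<open>Two injections into the index set are used: the past read backwards from time k,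
    and the past of time 0 preceded by \<open>None\<close>, the index of the copy.\<close>
  have h: "(\<lambda>\<omega> j. ?Z ((\<lambda>j. Some (k - int j)) j) \<omega>) = hist eps k" for k
    by (simp add: hist_def fun_eq_iff)
  have s: "(\<lambda>\<omega> j. ?Z (case j of 0 \<Rightarrow> None | Suc i \<Rightarrow> Some (- int i)) \<omega>) = (\<lambda>\<omega>. case_nat (eps0' \<omega>) (hist eps 0 \<omega>))"
    by (auto simp: hist_def fun_eq_iff split: nat.split)
  have i1: "inj (\<lambda>j. Some (k - int j))" for k by (auto simp: inj_def)
  have i2: "inj (\<lambda>j. case j of 0 \<Rightarrow> None | Suc i \<Rightarrow> Some (- int i))" by (auto simp: inj_def split: nat.splits)
  interpret causal_process \<mu> g M eps eps0'
  proof unfold_locales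
    show "g \<in> borel_measurable S" using g_meas by (simp add: measurable_cong_sets[OF sets_S refl])
    show "hist eps k \<in> M \<rightarrow>\<^sub>M S" "distr M S (hist eps k) = S" for k
      using law[OF i1[of k]] unfolding h .
    show "(\<lambda>\<omega>. case_nat (eps0' \<omega>) (hist eps 0 \<omega>)) \<in> M \<rightarrow>\<^sub>M S"
      "distr M S (\<lambda>\<omega>. case_nat (eps0' \<omega>) (hist eps 0 \<omega>)) = S"
      using law[OF i2] unfolding s .
  qed
  have F: "F = marg_cdf"
  proof
    fix x
    have "marg_cdf x = measure (distr M S (hist eps 0)) {h. g h \<in> {..x}}" unfolding hist_law by (simp add: marg_cdf_def)
    also have "\<dots> = measure M (hist eps 0 -` {h. g h \<in> {..x}} \<inter> space M)"
      by (rule measure_distr[OF hist_meas g_vimage]) simp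
    also have "hist eps 0 -` {h. g h \<in> {..x}} \<inter> space M = {\<omega> \<in> space M. X 0 \<omega> \<le> x}" by (auto simp: X_def)
    finally show "F x = marg_cdf x" by (simp add: F_def)
  qed
  have "AE \<omega> in M. Lip c0 (hist eps 0 \<omega>)"
    using cond_dens[OF order_refl] f1_bdd
  proof eventually_elim
    case (elim \<omega>)
    show ?case unfolding Lip_def next_cdf_def
    proof (intro allI impI)
      fix x y :: real assume xy: "x \<le> y"
      let ?F = "\<lambda>y. cond_cdf \<mu> g 1 y (hist eps 0 \<omega>)"
      \<comment> \<open>The bound on the derivative makes c0 z minus the conditional distribution
        function nondecreasing; no integral of the density is involved.\<close>
      have "(\<lambda>z. c0 * z - ?F z) x \<le> (\<lambda>z. c0 * z - ?F z) y"
      proof (rule DERIV_nonneg_imp_nondecreasing[OF xy])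
        fix z
        have "((\<lambda>z. c0 * z - ?F z) has_real_derivative c0 * 1 - fc 1 z (hist eps 0 \<omega>)) (at z)"
          using elim(1) by (intro DERIV_diff DERIV_cmult DERIV_ident) blast
        moreover have "0 \<le> c0 * 1 - fc 1 z (hist eps 0 \<omega>)" using elim(2) by simp
        ultimately show "\<exists>d. ((\<lambda>z. c0 * z - ?F z) has_real_derivative d) (at z) \<and> 0 \<le> d" by blast
      qed
      then show "?F y - ?F x \<le> c0 * (y - x)" by (simp add: algebra_simps)
    qed
  qed
  \<comment> \<open>The property is known along xi_0 on \<open>M\<close>; as it defines a measurable
    set of histories and xi_0 has law \<open>S\<close>, it passes to almost every history, and from
    there to the histories at all times.\<close>
  then have lip: "AE h in S. Lip c0 h" using AE_hist[of "Lip c0" 0] Lip_meas[of c0] c0 by simp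
  show ?thesis unfolding F X_def
  proof (rule modulus_decomposition[OF lip c0 b_pos b_lim b_log])
    show "(\<integral>\<^sup>+\<theta>. ennreal ((1 + \<theta>\<^sup>2) * coupling_sq k \<theta>) \<partial>lborel) < \<infinity>" if "k \<ge> 1" for k
      using cf_fin[OF that] by (simp add: coupling_sq_def cond_cf_eq_cond_char)
    show "summable (\<lambda>k. sqrt (enn2real (\<integral>\<^sup>+\<theta>. ennreal ((1 + \<theta>\<^sup>2) * coupling_sq (Suc k) \<theta>) \<partial>lborel)))"
      using cf_sum by (simp add: coupling_sq_def cond_cf_eq_cond_char)
  qed
qed

end
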